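(* Let $c>1$ be real, $N\ge0$ an integer, $L=\log c$, $\rho=2\pi/L$. On the full finite frequency space $\mathbb C^{I_N}$ let $$Q_T^{\rm tot}=Q_{\rm prime}^{(c)}+Q_{\rm pole}+Q_{{\rm arch},T},\qquad B_T=\frac1{\pi^2}\int_T^\infty h_+(r)\,\frac{\sin^2(Lr/2)}{\rho}\bigl(\|p_r\|_2^2+\|q_r\|_2^2\bigr)\,dr .$$ For $T>\max(\rho N,7)$: (i) $Q_\infty-Q_T^{\rm tot}\succ0$ and $0\preceq Q_\infty-Q_T^{\rm tot}\preceq B_TI$; hence $$\lambda_j(Q_T^{\rm tot})<\lambda_j(Q_\infty)\le\lambda_j(Q_T^{\rm tot})+B_T\qquad(1\le j\le 2N+1),$$ and each $\lambda_j(Q_T^{\rm tot})$ increases strictly to $\lambda_j(Q_\infty)$ as $T\uparrow\infty$. (ii) If $\lambda_j(Q_T^{\rm tot})\ge0$ then $\lambda_j(Q_\infty)>0$; if $\lambda_j(Q_T^{\rm tot})<-B_T$ then $\lambda_j(Q_\infty)<0$. (When $-B_T\le\lambda_j(Q_T^{\rm tot})<0$ the rule certifies nothing about the sign of $\lambda_j(Q_\infty)$.) (iii) For $N\ge1$, $$B_T\le\frac{2(2N+1)\rho}{\pi^2}\left[\frac{\log T}{T-\rho N}+\frac1{\rho N}\log\frac{T}{T-\rho N}\right],$$ and, as $T\to\infty$ with $(c,N)$ fixed, $$B_T=\frac{(2N+1)\rho}{\pi^2T}\Bigl(\log\frac T{2\pi}+1\Bigr)(1+o(1)).$$ In particular $B_{2T}/B_T\to\tfrac12$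 as $T\to\infty$. The corresponding restricted statements hold on the real even subspace $\{x\in\mathbb R^{I_N}:x_{-k}=x_k\}$ (i.e. for the compressions of $Q_T^{\rm tot}$ and $Q_\infty$ to that subspace, with $1\le j\le N+1$).
   Context: Notation. $I_N=\{-N,\dots,N\}$. For a real symmetric matrix $A$, $\lambda_j(A)$ denotes its $j$-th eigenvalue in a fixed monotone ordering (with multiplicity); $\succ,\preceq$ denote the Loewner order. For a $C^1$ function $\psi$ on $\mathbb R$, $Q_\psi$ is the matrix indexed by $I_N\times I_N$ with $(Q_\psi)_{mn}=\frac{\psi(m)-\psi(n)}{m-n}$ for $m\ne n$ and $(Q_\psi)_{mm}=\psi'(m)$. Let $\Lambda$ be the von Mangoldt function; sums over $q=p^a$ run over prime powers with $a\ge1$. Let $\psi_\Gamma=\Gamma'/\Gamma$ be the digamma function and $h_+(r)=\operatorname{Re}\psi_\Gamma(\tfrac14+\tfrac{ir}2)-\log\pi$. Define $$\psi_p^{(c)}(x)=-\frac1\pi\sum_{q=p^a\le c}\frac{\Lambda(q)}{\sqrt q}\sin\!\Bigl(2\pi x\bigl(1-\tfrac{\log q}{L}\bigr)\Bigr),$$ $$\psi_0(x)=\frac1\pi\int_0^L2\cosh(y/2)\sin\!\bigl(2\pi x(1-\tfrac yL)\bigr)\,dy,$$ $$\psi_{\mathbb R,T}(x)=\frac1{2\pi^2}\int_{-T}^Th_+(r)\,\mathcal S(r,x,L)\,dr,\qquad \mathcal S(r,x,L)=\int_0^L\sin\!\bigl(2\pi x(1-\tfrac yL)\bigr)\cos(ry)\,dy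 .$$ Set $Q_{\rm prime}^{(c)}=Q_{\psi_p^{(c)}}$, $Q_{\rm pole}=Q_{\psi_0}$, $Q_{{\rm arch},T}=Q_{\psi_{\mathbb R,T}}$, $Q_{{\rm arch},\infty}=\lim_{T\to\infty}Q_{{\rm arch},T}$ (this limit exists entrywise), and $Q_\infty=Q_{\rm prime}^{(c)}+Q_{\rm pole}+Q_{{\rm arch},\infty}$. For $r>\rho N$ put $a_r=r/\rho$ and let $p_r,q_r\in\mathbb R^{I_N}$ be the vectors with entries $p_r(n)=\frac1{a_r-n}$, $q_r(n)=\frac1{a_r+n}$ for $n\in I_N$. *)

theory Defs
  imports
    "HOL-Analysis.Analysis"
    "HOL-Library.Landau_Symbols"
    "HOL-Number_Theory.Prime_Powers"
    "Jordan_Normal_Form.Char_Poly"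
    "Jordan_Normal_Form.Schur_Decomposition"
begin

subsection \<open>Hermitian matrices, Loewner order, ordered eigenvalues\<close>

definition hermitian_mat :: "'a :: conjugatable_ordered_field mat \<Rightarrow> bool" where
  "hermitian_mat A \<longleftrightarrow> square_mat A \<and> mat_adjoint A = A"

definition loewner_le :: "'a :: conjugatable_ordered_field mat \<Rightarrow> 'a mat \<Rightarrow> bool"
    (infix \<open>\<preceq>\<^sub>L\<close> 50) where
  "A \<preceq>\<^sub>L B \<longleftrightarrow> hermitian_mat A \<and> hermitian_mat B \<and> dim_row A = dim_row B \<and>
     (\<forall>v \<in> carrier_vec (dim_row A). 0 \<le> ((B - A) *\<^sub>v v) \<bullet>c v)"

definition loewner_less :: "'a :: conjugatable_ordered_field mat \<Rightarrow> 'a mat \<Rightarrow> bool"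
    (infix \<open>\<prec>\<^sub>L\<close> 50) where
  "A \<prec>\<^sub>L B \<longleftrightarrow> hermitian_mat A \<and> hermitian_mat B \<and> dim_row A = dim_row B \<and>
     (\<forall>v \<in> carrier_vec (dim_row A). v \<noteq> 0\<^sub>v (dim_row A) \<longrightarrow> 0 < ((B - A) *\<^sub>v v) \<bullet>c v)"

text \<open>
  The \<open>j\<close>-th eigenvalue (\<open>j \<ge> 1\<close>) in nondecreasing order, counted with algebraic multiplicity.
  It is meant for real symmetric matrices, whose characteristic polynomial splits over the reals,
  so that the list has as many entries as the matrix has rows.
\<close>

definition eigval :: "nat \<Rightarrow> real mat \<Rightarrow> real" where
  "eigval j A = sorted_list_of_multiset (proots (char_poly A)) ! (j - 1)"

text \<open>
  Vectors and matrices indexed by \<open>{-N..N}\<close> are represented with the row and column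
  indices \<open>0, \<dots>, 2N\<close>; index \<open>i\<close> stands for the frequency \<open>i - N\<close>.
\<close>

definition freq :: "nat \<Rightarrow> nat \<Rightarrow> int" where
  "freq N i = int i - int N"

definition Q_mat :: "nat \<Rightarrow> (real \<Rightarrow> real) \<Rightarrow> real mat" where
  "Q_mat N \<psi> = mat (2 * N + 1) (2 * N + 1) (\<lambda>(i, j).
     let m = real_of_int (freq N i); n = real_of_int (freq N j)
     in if i = j then deriv \<psi> m else (\<psi> m - \<psi> n) / (m - n))"


subsection \<open>The real even subspace\<close>

definition even_subspace :: "nat \<Rightarrow> real vec set" where
  "even_subspace N = {x \<in> carrier_vec (2 * N + 1).
     \<forall>i < 2 * N + 1. \<forall>j < 2 * N + 1. freq N j = - freq N i \<longrightarrow> x $ j = x $ i}"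

text \<open>
  The columns are the orthonormal basis \<open>e\<^sub>0\<close>, \<open>(e\<^sub>k + e\<^sub>-\<^sub>k) / sqrt 2\<close> (\<open>1 \<le> k \<le> N\<close>) of the even
  subspace; see the lemmas below.
\<close>

definition even_basis :: "nat \<Rightarrow> real mat" where
  "even_basis N = mat (2 * N + 1) (N + 1) (\<lambda>(i, k).
     if \<bar>freq N i\<bar> = int k then (if k = 0 then 1 else 1 / sqrt 2) else 0)"

definition even_compression :: "nat \<Rightarrow> real mat \<Rightarrow> real mat" where
  "even_compression N A = transpose_mat (even_basis N) * A * even_basis N"

lemma even_basis_orthonormal: "transpose_mat (even_basis N) * even_basis N = 1\<^sub>m (N + 1)"
proof (rule eq_matI)
  fix k l assume kl: "k < dim_row (1\<^sub>m (N + 1))" "l < dim_col (1\<^sub>m (N + 1))"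
  let ?V = "even_basis N"
  have "(transpose_mat ?V * ?V) $$ (k, l) = (\<Sum>i = 0..<2 * N + 1. ?V $$ (i, k) * ?V $$ (i, l))"
    using kl by (simp add: scalar_prod_def even_basis_def)
  also have "\<dots> = (\<Sum>i \<in> {N + k, N - k}. ?V $$ (i, k) * ?V $$ (i, l))"
    using kl by (intro sum.mono_neutral_right) (auto simp: even_basis_def freq_def)
  also have "\<dots> = (if k = l then 1 else 0)"
    using kl by (cases "k = 0") (auto simp: even_basis_def freq_def abs_if)
  finally show "(transpose_mat ?V * ?V) $$ (k, l) = 1\<^sub>m (N + 1) $$ (k, l)"
    using kl by simp
qed (simp_all add: even_basis_def)

lemma even_basis_mult_vec:
  assumes "u \<in> carrier_vec (N + 1)" "i < 2 * N + 1"
  shows "(even_basis N *\<^sub>v u) $ i =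
    (if freq N i = 0 then 1 else 1 / sqrt 2) * u $ nat \<bar>freq N i\<bar>"
proof -
  have "(even_basis N *\<^sub>v u) $ i = (\<Sum>k = 0..<N + 1. even_basis N $$ (i, k) * u $ k)"
    using assms by (simp add: scalar_prod_def even_basis_def)
  also have "\<dots> = (\<Sum>k \<in> {nat \<bar>freq N i\<bar>}. even_basis N $$ (i, k) * u $ k)"
    using assms by (intro sum.mono_neutral_right) (auto simp: even_basis_def freq_def)
  also have "\<dots> = (if freq N i = 0 then 1 else 1 / sqrt 2) * u $ nat \<bar>freq N i\<bar>"
    using assms by (auto simp: even_basis_def freq_def)
  finally show ?thesis .
qed

lemma even_basis_span: "(\<lambda>u. even_basis N *\<^sub>v u) ` carrier_vec (N + 1) = even_subspace N"
proof (intro equalityI subsetI)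
  fix x assume "x \<in> (\<lambda>u. even_basis N *\<^sub>v u) ` carrier_vec (N + 1)"
  then obtain u where u: "u \<in> carrier_vec (N + 1)" "x = even_basis N *\<^sub>v u" by auto
  have "x \<in> carrier_vec (2 * N + 1)" by (simp add: u(2) even_basis_def carrier_vecI)
  then show "x \<in> even_subspace N"
    using even_basis_mult_vec[OF u(1)] by (auto simp: even_subspace_def u(2))
next
  fix x assume "x \<in> even_subspace N"
  then have x: "x \<in> carrier_vec (2 * N + 1)"
    and ev: "\<And>i j. i < 2 * N + 1 \<Longrightarrow> j < 2 * N + 1 \<Longrightarrow> freq N j = - freq N i \<Longrightarrow> x $ j = x $ i"
    unfolding even_subspace_def by blast+
  define u where "u = vec (N + 1) (\<lambda>k. (if k = 0 then 1 else sqrt 2) * x $ (N + k))"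
  have u: "u \<in> carrier_vec (N + 1)" by (simp add: u_def)
  have "even_basis N *\<^sub>v u = x"
  proof (rule eq_vecI)
    fix i assume "i < dim_vec x"
    then have i: "i < 2 * N + 1" using x by simp
    have "x $ (N + nat \<bar>freq N i\<bar>) = x $ i"
    proof (cases "freq N i \<ge> 0")
      case True
      then have "N + nat \<bar>freq N i\<bar> = i" by (simp add: freq_def)
      then show ?thesis by simp
    next
      case False
      then show ?thesis using i by (intro ev) (auto simp: freq_def)
    qed
    moreover have "nat \<bar>freq N i\<bar> < N + 1" using i by (auto simp: freq_def)
    ultimately show "(even_basis N *\<^sub>v u) $ i = x $ i"
      unfolding even_basis_mult_vec[OF u i] by (simp add: u_def)
  qed (use x in \<open>simp add: even_basis_def\<close>)
  then show "x \<in> (\<lambda>u. even_basis N *\<^sub>v u) ` carrier_vec (N + 1)" using u by blast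
qed


subsection \<open>The matrices\<close>

definition rho :: "real \<Rightarrow> real" where
  "rho c = 2 * pi / ln c"

definition h_plus :: "real \<Rightarrow> real" where
  "h_plus r = Re (Digamma (1 / 4 + \<i> * complex_of_real r / 2)) - ln pi"

definition psi_prime :: "real \<Rightarrow> real \<Rightarrow> real" where
  "psi_prime c x = - (1 / pi) * (\<Sum>q | primepow q \<and> real q \<le> c.
     mangoldt q / sqrt (real q) * sin (2 * pi * x * (1 - ln (real q) / ln c)))"

definition psi_pole :: "real \<Rightarrow> real \<Rightarrow> real" where
  "psi_pole c x = 1 / pi *
     integral {0..ln c} (\<lambda>y. 2 * cosh (y / 2) * sin (2 * pi * x * (1 - y / ln c)))"

definition S_kernel :: "real \<Rightarrow> real \<Rightarrow> real \<Rightarrow> real" where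
  "S_kernel r x L = integral {0..L} (\<lambda>y. sin (2 * pi * x * (1 - y / L)) * cos (r * y))"

definition psi_arch :: "real \<Rightarrow> real \<Rightarrow> real \<Rightarrow> real" where
  "psi_arch c T x = 1 / (2 * pi\<^sup>2) * integral {-T..T} (\<lambda>r. h_plus r * S_kernel r x (ln c))"

definition Q_prime :: "real \<Rightarrow> nat \<Rightarrow> real mat" where
  "Q_prime c N = Q_mat N (psi_prime c)"

definition Q_pole :: "real \<Rightarrow> nat \<Rightarrow> real mat" where
  "Q_pole c N = Q_mat N (psi_pole c)"

definition Q_arch :: "real \<Rightarrow> nat \<Rightarrow> real \<Rightarrow> real mat" where
  "Q_arch c N T = Q_mat N (psi_arch c T)"

text \<open>
  The entrywise limit exists for \<open>c > 1\<close>; \<open>Lim\<close> is unspecified where it does not.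
\<close>

definition Q_arch_inf :: "real \<Rightarrow> nat \<Rightarrow> real mat" where
  "Q_arch_inf c N = mat (2 * N + 1) (2 * N + 1) (\<lambda>(i, j). Lim at_top (\<lambda>T. Q_arch c N T $$ (i, j)))"

definition Q_tot :: "real \<Rightarrow> nat \<Rightarrow> real \<Rightarrow> real mat" where
  "Q_tot c N T = Q_prime c N + Q_pole c N + Q_arch c N T"

definition Q_inf :: "real \<Rightarrow> nat \<Rightarrow> real mat" where
  "Q_inf c N = Q_prime c N + Q_pole c N + Q_arch_inf c N"


subsection \<open>The tail bound\<close>

definition p_vec :: "real \<Rightarrow> real \<Rightarrow> int \<Rightarrow> real" where
  "p_vec c r n = 1 / (r / rho c - real_of_int n)"

definition q_vec :: "real \<Rightarrow> real \<Rightarrow> int \<Rightarrow> real" where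
  "q_vec c r n = 1 / (r / rho c + real_of_int n)"

text \<open>
  \<open>integral\<close> is the gauge integral, which covers the improper integral over \<open>{T..}\<close>; it is \<open>0\<close>
  on non-integrable functions, so strict positivity of \<open>B_tail\<close> entails convergence.
\<close>

definition B_tail :: "real \<Rightarrow> nat \<Rightarrow> real \<Rightarrow> real" where
  "B_tail c N T = 1 / pi\<^sup>2 * integral {T..} (\<lambda>r. h_plus r * ((sin (ln c * r / 2))\<^sup>2 / rho c) *
     ((L2_set (p_vec c r) {- int N..int N})\<^sup>2 + (L2_set (q_vec c r) {- int N..int N})\<^sup>2))"

end

theory Submission
  imports Defs "HOL-Real_Asymp.Real_Asymp"
begin

text \<open>The prime and pole matrices do not depend on \<open>T\<close>, so \<open>Q_inf - Q_tot\<close> is the part of the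
archimedean integral with \<open>\<bar>r\<bar> > T\<close>. At an integer frequency the kernel \<open>S_kernel r x L\<close> has
a closed form with the factor \<open>1 - cos (L r) = 2 (sin (L r / 2))\<^sup>2\<close>, and its divided
differences over integer frequencies collapse to a sum of two rank-one matrices,
\<open>(sin (L r / 2))\<^sup>2 / \<rho> \<cdot> (p p\<^sup>T + q q\<^sup>T)\<close>, where \<open>p = p_r\<close> and \<open>q = q_r\<close> have the entries
\<open>p_vec c r n\<close> and \<open>q_vec c r n\<close> (\<open>Q_arch_increment\<close>). Hence the quadratic form of \<open>Q_inf - Q_tot\<close> at \<open>x\<close> is
\[ \frac1{\pi^2} \int_T^\infty h_+(r) \frac{\sin^2(Lr/2)}{\rho}
   \bigl((p_r \cdot x)^2 + (q_r \cdot x)^2\bigr)\, dr \]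
(\<open>Q_tail_quadratic_form\<close>).

Everything about the matrices follows from this formula. For \<open>r \<ge> 7\<close> the weight \<open>h_plus\<close>
is positive, so the integrand is nonnegative, and it vanishes only on a countable set when
\<open>x\<close> is not zero: the zeros of the sine are isolated, and \<open>p_r \<cdot> x\<close> is a nonzero rational
function of \<open>r\<close>. So the form is positive
and strictly decreasing in \<open>T\<close>. By Cauchy-Schwarz it is at most \<open>B_tail \<cdot> \<bar>x\<bar>\<^sup>2\<close>. Weyl's
monotonicity principle turns such comparisons of quadratic forms into comparisons of the
\<open>j\<close>-th eigenvalues (\<open>eigval_less\<close>, \<open>eigval_le_add\<close>), and since the comparisons
restrict to every subspace, the same argument serves the even compressions. Convergence of the
eigenvalues is then the squeeze between the two bounds, because \<open>B_tail\<close> tends to \<open>0\<close>.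

The analytic input is the size of \<open>h_plus\<close>. Comparing the digamma series with a telescoping sum
of logarithms gives \<open>h_plus r = ln (r / 2\<pi>) + O(1 / r\<^sup>2)\<close> with a constant small enough for
positivity from \<open>r = 7\<close> on (\<open>h_plus_log_approx\<close>). For the asymptotics of \<open>B_tail\<close> the
integrand is \<open>K (1 - cos (L r)) ln r / r\<^sup>2\<close> with \<open>K = (2 N + 1) \<rho>\<close>, up to a relative error that
tends to \<open>0\<close>; the cosine term has a small primitive, so that only the mean \<open>K ln r / r\<^sup>2\<close>
counts, and this integrates to \<open>K (ln T + 1) / T\<close> (\<open>tail_trace_integral_asymptotics\<close>).\<close>

(* The dot and dollar signs are needed for the vectors of varying dimension; their readings for
   Euclidean spaces and for vectors indexed by a type would make every formula ambiguous. *)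
unbundle no inner_syntax and no vec_syntax

section \<open>Ordered eigenvalues of real symmetric matrices\<close>

definition diag_of_list :: "real list \<Rightarrow> real mat" where
  "diag_of_list es = mat (length es) (length es) (\<lambda>(i, j). if i = j then es ! i else 0)"

text \<open>
  Gram-Schmidt yields an orthogonal basis that starts with \<open>v\<close>; dividing its members by their
  lengths requires square roots, which is why this is a statement about the reals.
\<close>

lemma orthonormal_completion:
  fixes v :: "real vec"
  assumes v: "v \<in> carrier_vec n" "v \<noteq> 0\<^sub>v n"
  shows "\<exists>W s. W \<in> carrier_mat n n \<and> transpose_mat W * W = 1\<^sub>m n \<and> col W 0 = s \<cdot>\<^sub>v v"
proof -
  interpret cof_vec_space n "TYPE(real)" .
  have n: "n \<noteq> 0" using v by (metis carrier_vecD eq_vecI index_zero_vec(2) less_nat_zero_code)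
  define b where "b = basis_completion v"
  define ws where "ws = gram_schmidt n b"
  from basis_completion[OF v, folded b_def]
  have dist_b: "distinct b"
    and indep: "\<not> lin_dep (set b)" and b: "set b \<subseteq> carrier_vec n" and hdb: "hd b = v"
    and len_b: "length b = n" by auto
  from hdb len_b n obtain vs where bv: "b = v # vs" by (cases b, auto)
  from gram_schmidt_result[OF b dist_b indep refl, folded ws_def]
  have ws: "set ws \<subseteq> carrier_vec n" "corthogonal ws" "length ws = n"
    by (auto simp: len_b)
  from gram_schmidt_hd[OF v(1), of vs, folded bv] have hdws: "hd ws = v" unfolding ws_def .
  define f where "f w = (1 / sqrt (w \<bullet> w)) \<cdot>\<^sub>v w" for w :: "real vec"
  define W where "W = mat_of_cols n (map f ws)"
  have wsi: "ws ! i \<in> carrier_vec n" if "i < n" for i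
    using ws that by auto
  have W: "W \<in> carrier_mat n n" using ws by (auto simp: W_def)
  have colW: "col W i = f (ws ! i)" if "i < n" for i
    using that ws wsi[OF that] by (simp add: W_def f_def)
  have orth: "ws ! i \<bullet> ws ! j = 0 \<longleftrightarrow> i \<noteq> j" if "i < n" "j < n" for i j
    using corthogonalD[OF ws(2), of i j] that ws by simp
  have pos: "0 < ws ! i \<bullet> ws ! i" if "i < n" for i
    using orth[OF that that] conjugate_square_ge_0_vec[of "ws ! i"] by simp
  have "transpose_mat W * W = 1\<^sub>m n"
  proof (rule eq_matI)
    fix i j assume ij: "i < dim_row (1\<^sub>m n)" "j < dim_col (1\<^sub>m n)"
    then have ij: "i < n" "j < n" by auto
    have "(transpose_mat W * W) $$ (i, j) = col W i \<bullet> col W j"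
      using W ij by simp
    also have "\<dots> = 1 / sqrt (ws ! i \<bullet> ws ! i) * (1 / sqrt (ws ! j \<bullet> ws ! j)) * (ws ! i \<bullet> ws ! j)"
      using ij wsi[OF ij(1)] wsi[OF ij(2)] by (simp add: colW f_def)
    also have "\<dots> = (if i = j then 1 else 0)"
      using orth[OF ij] pos[OF ij(1)] by (auto simp: field_simps)
    finally show "(transpose_mat W * W) $$ (i, j) = 1\<^sub>m n $$ (i, j)" using ij by simp
  qed (use W in auto)
  moreover have "col W 0 = (1 / sqrt (v \<bullet> v)) \<cdot>\<^sub>v v"
    using colW[of 0] n hdws ws(3) by (cases ws) (auto simp: f_def)
  ultimately show ?thesis using W by blast
qed

text \<open>
  The spectral theorem, with the eigenvalues on the diagonal in any prescribed order \<open>es\<close>: an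
  eigenvector for the first entry of \<open>es\<close> is completed to an orthonormal basis, in which the
  symmetric matrix splits into a block of size one and a symmetric rest. The freedom of order makes it
  possible to choose the sorted one below.
\<close>

lemma symmetric_diagonalization:
  fixes A :: "real mat"
  assumes "A \<in> carrier_mat n n" "transpose_mat A = A" "char_poly A = (\<Prod>e\<leftarrow>es. [:- e, 1:])"
  shows "length es = n \<and>
    (\<exists>P \<in> carrier_mat n n. transpose_mat P * P = 1\<^sub>m n \<and> transpose_mat P * A * P = diag_of_list es)"
  using assms
proof (induction es arbitrary: n A)
  case Nil
  have "n = 0" using degree_monic_char_poly[OF Nil(1)] Nil(3) by simp
  moreover have "1\<^sub>m 0 \<in> carrier_mat 0 0" by simp
  ultimately show ?case using Nil(1) by (auto intro!: bexI[of _ "1\<^sub>m 0"] eq_matI simp: diag_of_list_def)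
next
  case (Cons e es n A)
  note A = Cons.prems(1) and sym = Cons.prems(2)
  let ?q = "\<Prod>e\<leftarrow>es. [:- e, 1:]"
  have cp: "char_poly A = [:- e, 1:] * ?q" using Cons.prems(3) by simp
  have "degree (char_poly A) = Suc (degree ?q)"
    unfolding cp by (subst degree_mult_eq) (auto simp: prod_list_zero_iff)
  then obtain m where n: "n = Suc m" using degree_monic_char_poly[OF A] by auto
  have "eigenvalue A e" unfolding eigenvalue_root_char_poly[OF A] cp by simp
  then obtain v where v: "v \<in> carrier_vec n" "v \<noteq> 0\<^sub>v n" "A *\<^sub>v v = e \<cdot>\<^sub>v v"
    using A unfolding eigenvalue_def eigenvector_def by auto
  obtain W s where W: "W \<in> carrier_mat n n" "transpose_mat W * W = 1\<^sub>m n" "col W 0 = s \<cdot>\<^sub>v v"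
    using orthonormal_completion[OF v(1,2)] by blast
  let ?WT = "transpose_mat W"
  have WT: "?WT \<in> carrier_mat n n" using W by simp
  have WWT: "W * ?WT = 1\<^sub>m n" using mat_mult_left_right_inverse[OF WT W(1) W(2)] .
  define A' where "A' = ?WT * A * W"
  have A': "A' \<in> carrier_mat n n" using A W by (simp add: A'_def)
  have symA': "transpose_mat A' = A'"
    using A W sym WT by (simp add: A'_def transpose_mult[of _ n n _ n] assoc_mult_mat[of _ n n _ n _ n])
  have WW: "col W i \<bullet> col W j = (if i = j then 1 else 0)" if "i < n" "j < n" for i j
    using arg_cong[OF W(2), of "\<lambda>M. M $$ (i, j)"] W(1) that by simp
  have colW: "A *\<^sub>v col W 0 = e \<cdot>\<^sub>v col W 0"
    unfolding W(3) mult_mat_vec[OF A v(1)] v(3) by (simp add: smult_smult_assoc mult.commute)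
  have A'0: "A' $$ (i, 0) = (if i = 0 then e else 0)" if i: "i < n" for i
  proof -
    have "A' = ?WT * (A * W)" unfolding A'_def using A W WT by (simp add: assoc_mult_mat[of _ n n _ n _ n])
    then have "A' $$ (i, 0) = col W i \<bullet> col (A * W) 0"
      using i n A W by simp
    also have "col (A * W) 0 = A *\<^sub>v col W 0"
      by (rule col_mult2[OF A W(1)]) (simp add: n)
    also have "col W i \<bullet> \<dots> = e * (col W i \<bullet> col W 0)"
      unfolding colW by (rule scalar_prod_smult_right) (use W(1) in simp)
    finally show ?thesis using WW[of i 0] i n by simp
  qed
  have A'0': "A' $$ (0, i) = (if i = 0 then e else 0)" if i: "i < n" for i
  proof -
    have "A' $$ (0, i) = transpose_mat A' $$ (i, 0)" using A' i n by simp
    then show ?thesis unfolding symA' using A'0[OF i] by simp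
  qed
  define B where "B = mat m m (\<lambda>(i, j). A' $$ (Suc i, Suc j))"
  define E where "E = mat 1 1 (\<lambda>_. e)"
  have B: "B \<in> carrier_mat m m" by (simp add: B_def)
  have E: "E \<in> carrier_mat 1 1" by (simp add: E_def)
  have blk: "A' = four_block_mat E (0\<^sub>m 1 m) (0\<^sub>m m 1) B"
    by (rule eq_matI) (use A' n A'0 A'0' in \<open>auto simp: B_def E_def Suc_diff_Suc\<close>)
  have symB: "transpose_mat B = B"
  proof (rule eq_matI)
    fix i j assume "i < dim_row B" "j < dim_col B"
    then show "transpose_mat B $$ (i, j) = B $$ (i, j)"
      using arg_cong[OF symA', of "\<lambda>M. M $$ (Suc i, Suc j)"] A' n by (simp add: B_def)
  qed (simp_all add: B_def)
  have "similar_mat_wit A' A ?WT W"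
    by (rule similar_mat_witI[of _ _ n]) (use W WT A A' WWT in \<open>auto simp: A'_def\<close>)
  then have "char_poly A' = char_poly A"
    using char_poly_similar unfolding similar_mat_def by blast
  moreover have "char_poly A' = char_poly E * char_poly B"
    unfolding blk by (rule char_poly_four_block_zeros_col[OF E _ B]) simp
  moreover have "char_poly E = [:- e, 1:]"
    by (simp add: E_def char_poly_defs det_def sign_def)
  ultimately have "[:- e, 1:] * char_poly B = [:- e, 1:] * ?q" using cp by simp
  then have cpB: "char_poly B = ?q"
    by (metis mult_cancel_left pCons_eq_0_iff zero_neq_one)
  from Cons.IH[OF B symB cpB] obtain P where len: "length es = m"
    and P: "P \<in> carrier_mat m m" "transpose_mat P * P = 1\<^sub>m m" "transpose_mat P * B * P = diag_of_list es"
    by auto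
  let ?PT = "transpose_mat P"
  define R where "R = four_block_mat (1\<^sub>m 1) (0\<^sub>m 1 m) (0\<^sub>m m 1) P"
  have R: "R \<in> carrier_mat n n" using P n by (auto simp: R_def)
  have RT: "transpose_mat R = four_block_mat (1\<^sub>m 1) (0\<^sub>m 1 m) (0\<^sub>m m 1) ?PT"
    unfolding R_def using P by (subst transpose_four_block_mat[of _ 1 1 _ m _ m]) auto
  have RTc: "transpose_mat R \<in> carrier_mat n n" using R by simp
  have one: "four_block_mat (1\<^sub>m 1) (0\<^sub>m 1 m) (0\<^sub>m m 1) (1\<^sub>m m) = (1\<^sub>m n :: real mat)"
    by (rule eq_matI) (auto simp: n)
  have RR: "transpose_mat R * R = 1\<^sub>m n"
    unfolding RT unfolding R_def using P
    by (subst mult_four_block_mat[of _ 1 1 _ m _ m _ _ 1 _ m]) (auto simp: one n)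
  have Dc: "diag_of_list es \<in> carrier_mat m m" using len by (simp add: diag_of_list_def)
  have PTB: "?PT * B \<in> carrier_mat m m" using P B by simp
  have "transpose_mat R * A' = four_block_mat E (0\<^sub>m 1 m) (0\<^sub>m m 1) (?PT * B)"
    unfolding RT blk using P B E
    by (subst mult_four_block_mat[of _ 1 1 _ m _ m _ _ 1 _ m]) auto
  then have "transpose_mat R * A' * R = four_block_mat E (0\<^sub>m 1 m) (0\<^sub>m m 1) (?PT * B * P)"
    unfolding R_def using P B E PTB Dc
    by (simp, subst mult_four_block_mat[of _ 1 1 _ m _ m _ _ 1 _ m]) auto
  also have "\<dots> = diag_of_list (e # es)"
    unfolding P(3) by (rule eq_matI) (auto simp: diag_of_list_def E_def len nth_Cons')
  finally have D: "transpose_mat R * A' * R = diag_of_list (e # es)" .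
  have "transpose_mat (W * R) * (W * R) = 1\<^sub>m n"
  proof -
    have "transpose_mat (W * R) * (W * R) = transpose_mat R * (?WT * (W * R))"
      using W R WT RTc by (simp add: transpose_mult[of _ n n _ n] assoc_mult_mat[of _ n n _ n _ n])
    also have "?WT * (W * R) = (?WT * W) * R"
      by (rule assoc_mult_mat[symmetric, OF WT W(1) R])
    finally show ?thesis unfolding W(2) left_mult_one_mat[OF R] RR .
  qed
  moreover have "transpose_mat (W * R) * A * (W * R) = transpose_mat R * A' * R"
    using W R WT RTc A
    by (simp add: A'_def transpose_mult[of _ n n _ n] assoc_mult_mat[of _ n n _ n _ n])
  moreover have "W * R \<in> carrier_mat n n" using W R by simp
  ultimately show ?case using D len n by auto
qed

text \<open>
  Over the complex numbers the characteristic polynomial splits, and its roots \<open>z\<close> are real: for an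
  eigenvector \<open>v\<close>, both \<open>z\<close> and \<open>cnj z\<close> are the quotient of \<open>A v \<bullet>c v\<close> by \<open>v \<bullet>c v\<close>.
\<close>

lemma symmetric_char_poly_splits:
  fixes A :: "real mat"
  assumes A: "A \<in> carrier_mat n n" and sym: "transpose_mat A = A"
  shows "\<exists>es. char_poly A = (\<Prod>e\<leftarrow>es. [:- e, 1:])"
proof -
  interpret R: map_poly_inj_comm_ring_hom complex_of_real ..
  let ?C = "map_mat complex_of_real A"
  have C: "?C \<in> carrier_mat n n" using A by simp
  obtain zs where zs: "char_poly ?C = (\<Prod>z\<leftarrow>zs. [:- z, 1:])"
    using char_poly_factorized[OF C] by blast
  have real: "z \<in> \<real>" if "z \<in> set zs" for z
  proof -
    have "poly (char_poly ?C) z = 0" unfolding zs poly_prod_list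
      using that by (auto simp: prod_list_zero_iff)
    then have "eigenvalue ?C z" unfolding eigenvalue_root_char_poly[OF C] .
    then obtain v where v: "v \<in> carrier_vec n" "v \<noteq> 0\<^sub>v n" "?C *\<^sub>v v = z \<cdot>\<^sub>v v"
      using C unfolding eigenvalue_def eigenvector_def by auto
    have "z * (v \<bullet>c v) = (?C *\<^sub>v v) \<bullet>c v" using v by simp
    also have "?C = transpose_mat ?C"
    proof -
      have "transpose_mat ?C = map_mat complex_of_real (transpose_mat A)" by (auto intro: eq_matI)
      then show ?thesis by (simp add: sym)
    qed
    also have "(transpose_mat ?C *\<^sub>v v) \<bullet>c v = v \<bullet> (?C *\<^sub>v conjugate v)"
      using v C by (intro transpose_vec_mult_scalar) auto
    also have "?C *\<^sub>v conjugate v = conjugate (?C *\<^sub>v v)"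
      using A v(1) by (intro eq_vecI) (auto simp: scalar_prod_def)
    also have "v \<bullet> \<dots> = cnj z * (v \<bullet>c v)" using v by (simp add: conjugate_smult_vec)
    finally have "z = cnj z" using v(2) conjugate_square_eq_0_vec[OF v(1)] by auto
    then show ?thesis by (simp add: Reals_cnj_iff)
  qed
  define es where "es = map Re zs"
  have "map_poly complex_of_real (char_poly A) = char_poly ?C"
    by (simp add: of_real_hom.char_poly_hom[OF A])
  also have "\<dots> = map_poly complex_of_real (\<Prod>e\<leftarrow>es. [:- e, 1:])"
  proof -
    have "map (\<lambda>z. [:- z, 1:]) zs = map (map_poly complex_of_real) (map (\<lambda>e. [:- e, 1:]) es)"
      using real by (auto simp: es_def o_def of_real_Re)
    then show ?thesis unfolding zs by (simp only: R.hom_prod_list)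
  qed
  finally show ?thesis by auto
qed

lemma eigval_sorted_roots:
  assumes "char_poly A = (\<Prod>e\<leftarrow>es. [:- e, 1:])" "sorted es"
  shows "eigval j A = es ! (j - 1)"
proof -
  have "proots (\<Prod>e\<leftarrow>es. [:- e, 1:]) = mset es"
  proof (induction es)
    case (Cons e es)
    have "proots (\<Prod>e\<leftarrow>e # es. [:- e, 1:]) = proots ([:- e, 1:] * (\<Prod>e\<leftarrow>es. [:- e, 1:]))"
      by (simp only: list.map prod_list.Cons)
    also have "\<dots> = proots [:- e, 1:] + proots (\<Prod>e\<leftarrow>es. [:- e, 1:])"
      by (rule proots_mult) (auto simp: prod_list_zero_iff)
    finally show ?case using Cons.IH by simp
  qed simp
  then show ?thesis
    using assms by (simp add: eigval_def sorted_sort_id)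
qed

lemma symmetric_eigenbasis:
  fixes A :: "real mat"
  assumes A: "A \<in> carrier_mat n n" and sym: "transpose_mat A = A"
  obtains P where "P \<in> carrier_mat n n" "transpose_mat P * P = 1\<^sub>m n"
    "transpose_mat P * A * P = mat n n (\<lambda>(i, j). if i = j then eigval (Suc i) A else 0)"
    "\<And>i j. i \<le> j \<Longrightarrow> j < n \<Longrightarrow> eigval (Suc i) A \<le> eigval (Suc j) A"
proof -
  obtain es0 where es0: "char_poly A = (\<Prod>e\<leftarrow>es0. [:- e, 1:])"
    using symmetric_char_poly_splits[OF assms] by blast
  define es where "es = sort es0"
  have "(\<Prod>e\<leftarrow>es0. [:- e, 1:]) = (\<Prod>e\<leftarrow>es. [:- e, 1:])"
    unfolding prod_mset_prod_list[symmetric] mset_map es_def by simp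
  with es0 have es: "char_poly A = (\<Prod>e\<leftarrow>es. [:- e, 1:])" by simp
  have "sorted es" by (simp add: es_def)
  note ev = eigval_sorted_roots[OF es this]
  from symmetric_diagonalization[OF A sym es] obtain P where len: "length es = n" and
    P: "P \<in> carrier_mat n n" "transpose_mat P * P = 1\<^sub>m n" "transpose_mat P * A * P = diag_of_list es"
    by auto
  show ?thesis
  proof (rule that[OF P(1,2)])
    show "transpose_mat P * A * P = mat n n (\<lambda>(i, j). if i = j then eigval (Suc i) A else 0)"
      unfolding P(3) diag_of_list_def len ev by (rule eq_matI) auto
    show "eigval (Suc i) A \<le> eigval (Suc j) A" if "i \<le> j" "j < n" for i j
      using that len \<open>sorted es\<close> by (simp add: ev sorted_iff_nth_mono)
  qed
qed

lemma quadratic_form_orthogonal_change: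
  fixes A P :: "real mat"
  assumes "A \<in> carrier_mat n n" "P \<in> carrier_mat n m" "y \<in> carrier_vec m"
  shows "(A *\<^sub>v (P *\<^sub>v y)) \<bullet> (P *\<^sub>v y) = ((transpose_mat P * A * P) *\<^sub>v y) \<bullet> y"
proof -
  have "((transpose_mat P * A * P) *\<^sub>v y) \<bullet> y = (transpose_mat P *\<^sub>v (A *\<^sub>v (P *\<^sub>v y))) \<bullet> y"
    using assms by (simp add: assoc_mult_mat_vec[of _ m n _ m] assoc_mult_mat_vec[of _ m n _ n])
  also have "\<dots> = (A *\<^sub>v (P *\<^sub>v y)) \<bullet> (P *\<^sub>v y)"
    using assms by (subst transpose_vec_mult_scalar[of _ n m]) auto
  finally show ?thesis by simp
qed

text \<open>
  This is used as the dimension count "one equation less than unknowns": the missing equation is the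
  zero row.
\<close>

lemma square_row_zero_kernel:
  fixes M :: "real mat"
  assumes M: "M \<in> carrier_mat n n" and i: "i < n" and z: "row M i = 0\<^sub>v n"
  obtains u where "u \<in> carrier_vec n" "u \<noteq> 0\<^sub>v n" "M *\<^sub>v u = 0\<^sub>v n"
proof -
  have T: "transpose_mat M \<in> carrier_mat n n" using M by simp
  have "transpose_mat M *\<^sub>v unit_vec n i = 0\<^sub>v n"
  proof (rule eq_vecI)
    fix k assume "k < dim_vec (0\<^sub>v n :: real vec)"
    then have k: "k < n" by simp
    have "(transpose_mat M *\<^sub>v unit_vec n i) $ k = row M i $ k"
      using T i M k by simp
    then show "(transpose_mat M *\<^sub>v unit_vec n i) $ k = 0\<^sub>v n $ k" using z by simp
  qed (use M in simp)
  moreover have "unit_vec n i \<noteq> (0\<^sub>v n :: real vec)"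
    using i by (metis index_unit_vec(2) index_zero_vec(1) zero_neq_one)
  ultimately have "det (transpose_mat M) = 0"
    unfolding det_0_iff_vec_prod_zero_field[OF T] by (metis unit_vec_carrier)
  then have "det M = 0" using det_transpose[OF M] by simp
  then show ?thesis using that det_0_iff_vec_prod_zero_field[OF M] by blast
qed

text \<open>
  The core of the Courant-Fischer argument. The span of the eigenvectors of \<open>A\<close> with indices
  \<open>\<ge> j\<close> and the span of those of \<open>B\<close> with indices \<open>\<le> j\<close> have dimensions that add up to
  \<open>n + 1\<close>, so they share a nonzero vector.
\<close>

lemma eigval_common_test_vector:
  fixes A B :: "real mat"
  assumes A: "A \<in> carrier_mat n n" "transpose_mat A = A"
    and B: "B \<in> carrier_mat n n" "transpose_mat B = B"
    and j: "j \<in> {1..n}"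
  obtains x where "x \<in> carrier_vec n" "x \<noteq> 0\<^sub>v n"
    "eigval j A * (x \<bullet> x) \<le> (A *\<^sub>v x) \<bullet> x" "(B *\<^sub>v x) \<bullet> x \<le> eigval j B * (x \<bullet> x)"
proof -
  obtain k where k: "j = Suc k" "k < n" using j by (cases j) auto
  obtain P where P: "P \<in> carrier_mat n n" "transpose_mat P * P = 1\<^sub>m n"
    "transpose_mat P * A * P = mat n n (\<lambda>(i, j). if i = j then eigval (Suc i) A else 0)"
    and mA: "\<And>i j. i \<le> j \<Longrightarrow> j < n \<Longrightarrow> eigval (Suc i) A \<le> eigval (Suc j) A"
    by (rule symmetric_eigenbasis[OF A]) blast
  obtain R where R: "R \<in> carrier_mat n n" "transpose_mat R * R = 1\<^sub>m n"
    "transpose_mat R * B * R = mat n n (\<lambda>(i, j). if i = j then eigval (Suc i) B else 0)"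
    and mB: "\<And>i j. i \<le> j \<Longrightarrow> j < n \<Longrightarrow> eigval (Suc i) B \<le> eigval (Suc j) B"
    by (rule symmetric_eigenbasis[OF B]) blast
  define C where "C = transpose_mat P * R"
  have C: "C \<in> carrier_mat n n" using P R by (simp add: C_def)
  \<comment> \<open>\<open>k\<close> equations for the \<open>k + 1\<close> coordinates of a vector in the span of the first \<open>k + 1\<close>
    eigenvectors of \<open>B\<close>: it shall be orthogonal to the first \<open>k\<close> eigenvectors of \<open>A\<close>.\<close>
  define M where "M = mat (Suc k) (Suc k) (\<lambda>(i, j). if i < k then C $$ (i, j) else 0)"
  have M: "M \<in> carrier_mat (Suc k) (Suc k)" by (simp add: M_def)
  have "row M k = 0\<^sub>v (Suc k)" by (rule eq_vecI) (auto simp: M_def)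
  then obtain u where u: "u \<in> carrier_vec (Suc k)" "u \<noteq> 0\<^sub>v (Suc k)" "M *\<^sub>v u = 0\<^sub>v (Suc k)"
    using square_row_zero_kernel[OF M, of k] by auto
  define z where "z = vec n (\<lambda>i. if i \<le> k then u $ i else 0)"
  have z: "z \<in> carrier_vec n" by (simp add: z_def)
  define y where "y = C *\<^sub>v z"
  have y: "y \<in> carrier_vec n" using C z by (simp add: y_def)
  \<comment> \<open>The first \<open>k\<close> coordinates of \<open>y = P\<^sup>T R z\<close> vanish by the choice of \<open>u\<close>, and
    \<open>z\<close> is supported on the indices up to \<open>k = j - 1\<close>.\<close>
  have y0: "y $ i = 0" if i: "i < k" for i
  proof -
    have "y $ i = (\<Sum>l<n. C $$ (i, l) * z $ l)"
      using i k C z by (simp add: y_def scalar_prod_def atLeast0LessThan)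
    also have "\<dots> = (\<Sum>l<Suc k. C $$ (i, l) * z $ l)"
      using k by (intro sum.mono_neutral_right) (auto simp: z_def)
    also have "\<dots> = (M *\<^sub>v u) $ i"
      using i k u(1) by (simp add: M_def z_def scalar_prod_def atLeast0LessThan)
    also have "\<dots> = 0" using u(3) i by simp
    finally show ?thesis .
  qed
  define x where "x = R *\<^sub>v z"
  have x: "x \<in> carrier_vec n" using R z by (simp add: x_def)
  have "P * transpose_mat P = 1\<^sub>m n"
    using mat_mult_left_right_inverse[OF _ P(1) P(2)] P(1) by simp
  moreover have "P *\<^sub>v y = (P * transpose_mat P) *\<^sub>v x"
    using P R z by (simp add: x_def y_def C_def assoc_mult_mat_vec[of _ n n _ n])
  ultimately have xP: "x = P *\<^sub>v y" using x by simp
  have norm: "(S *\<^sub>v w) \<bullet> (S *\<^sub>v w) = w \<bullet> w"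
    if "S \<in> carrier_mat n n" "transpose_mat S * S = 1\<^sub>m n" "w \<in> carrier_vec n" for S :: "real mat" and w
    using quadratic_form_orthogonal_change[of "1\<^sub>m n" n S n w] that by simp
  have diag: "(mat n n (\<lambda>(i, j). if i = j then f i else 0) *\<^sub>v w) \<bullet> w = (\<Sum>i<n. f i * (w $ i)\<^sup>2)"
    if "w \<in> carrier_vec n" for f :: "nat \<Rightarrow> real" and w
  proof -
    have "(mat n n (\<lambda>(i, j). if i = j then f i else 0) *\<^sub>v w) $ i = f i * w $ i" if i: "i < n" for i
    proof -
      have "(mat n n (\<lambda>(i, j). if i = j then f i else 0) *\<^sub>v w) $ i
          = (\<Sum>l<n. (if i = l then f i else 0) * w $ l)"
        using i \<open>w \<in> carrier_vec n\<close> by (simp add: scalar_prod_def atLeast0LessThan)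
      also have "\<dots> = (\<Sum>l<n. if l = i then f i * w $ i else 0)"
        by (rule sum.cong) auto
      finally show ?thesis using i by simp
    qed
    then show ?thesis using that
      by (simp add: scalar_prod_def atLeast0LessThan power2_eq_square mult.assoc del: index_mult_mat_vec)
  qed
  have sq: "w \<bullet> w = (\<Sum>i<n. (w $ i)\<^sup>2)" if "w \<in> carrier_vec n" for w :: "real vec"
    using that by (simp add: scalar_prod_def atLeast0LessThan power2_eq_square)
  show ?thesis
  proof (rule that[OF x])
    obtain i where i: "i < Suc k" "u $ i \<noteq> 0" using u(1,2) by (auto simp: vec_eq_iff)
    have "z \<bullet> z \<ge> (z $ i)\<^sup>2"
      unfolding sq[OF z] by (rule member_le_sum) (use i k in auto)
    moreover have "z $ i \<noteq> 0" using i k by (simp add: z_def)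
    ultimately have "x \<bullet> x > 0"
      unfolding x_def norm[OF R(1,2) z] by (smt (verit) zero_less_power2)
    then show "x \<noteq> 0\<^sub>v n" using x by auto
    have "eigval j A * (x \<bullet> x) = (\<Sum>i<n. eigval j A * (y $ i)\<^sup>2)"
      unfolding xP norm[OF P(1,2) y] sq[OF y] sum_distrib_left ..
    also have "\<dots> \<le> (\<Sum>i<n. eigval (Suc i) A * (y $ i)\<^sup>2)"
    proof (rule sum_mono)
      fix i assume "i \<in> {..<n}"
      then show "eigval j A * (y $ i)\<^sup>2 \<le> eigval (Suc i) A * (y $ i)\<^sup>2"
        using y0[of i] mA[of k i] k by (cases "i < k") (auto intro!: mult_right_mono)
    qed
    also have "\<dots> = (A *\<^sub>v x) \<bullet> x"
      unfolding xP quadratic_form_orthogonal_change[OF A(1) P(1) y] P(3) diag[OF y] ..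
    finally show "eigval j A * (x \<bullet> x) \<le> (A *\<^sub>v x) \<bullet> x" .
    have "(B *\<^sub>v x) \<bullet> x = (\<Sum>i<n. eigval (Suc i) B * (z $ i)\<^sup>2)"
      unfolding x_def quadratic_form_orthogonal_change[OF B(1) R(1) z] R(3) diag[OF z] ..
    also have "\<dots> \<le> (\<Sum>i<n. eigval j B * (z $ i)\<^sup>2)"
    proof (rule sum_mono)
      fix i assume "i \<in> {..<n}"
      then show "eigval (Suc i) B * (z $ i)\<^sup>2 \<le> eigval j B * (z $ i)\<^sup>2"
        using mB[of i k] k by (cases "i \<le> k") (auto simp: z_def intro!: mult_right_mono)
    qed
    also have "\<dots> = eigval j B * (x \<bullet> x)"
      unfolding x_def norm[OF R(1,2) z] sq[OF z] sum_distrib_left ..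
    finally show "(B *\<^sub>v x) \<bullet> x \<le> eigval j B * (x \<bullet> x)" .
  qed
qed

text \<open>
  Weyl's monotonicity principle: at the common test vector the two forms enclose the two eigenvalues,
  and a strict inequality between the forms separates them.
\<close>

lemma eigval_less:
  fixes A B :: "real mat"
  assumes A: "A \<in> carrier_mat n n" "transpose_mat A = A"
    and B: "B \<in> carrier_mat n n" "transpose_mat B = B"
    and pos: "\<And>x. x \<in> carrier_vec n \<Longrightarrow> x \<noteq> 0\<^sub>v n \<Longrightarrow> (A *\<^sub>v x) \<bullet> x < (B *\<^sub>v x) \<bullet> x"
    and j: "j \<in> {1..n}"
  shows "eigval j A < eigval j B"
proof -
  obtain x where x: "x \<in> carrier_vec n" "x \<noteq> 0\<^sub>v n"
    "eigval j A * (x \<bullet> x) \<le> (A *\<^sub>v x) \<bullet> x" "(B *\<^sub>v x) \<bullet> x \<le> eigval j B * (x \<bullet> x)"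
    using eigval_common_test_vector[OF A B j] .
  have "x \<bullet> x > 0" using x conjugate_square_greater_0_vec[OF x(1)] by simp
  moreover have "eigval j A * (x \<bullet> x) < eigval j B * (x \<bullet> x)" using pos[OF x(1,2)] x(3,4) by linarith
  ultimately show ?thesis by simp
qed

text \<open>
  Weyl's perturbation bound; here the test vector is taken with the two matrices exchanged.
\<close>

lemma eigval_le_add:
  fixes A B :: "real mat"
  assumes A: "A \<in> carrier_mat n n" "transpose_mat A = A"
    and B: "B \<in> carrier_mat n n" "transpose_mat B = B"
    and le: "\<And>x. x \<in> carrier_vec n \<Longrightarrow> (B *\<^sub>v x) \<bullet> x \<le> (A *\<^sub>v x) \<bullet> x + b * (x \<bullet> x)"
    and j: "j \<in> {1..n}"
  shows "eigval j B \<le> eigval j A + b"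
proof -
  obtain x where x: "x \<in> carrier_vec n" "x \<noteq> 0\<^sub>v n"
    "eigval j B * (x \<bullet> x) \<le> (B *\<^sub>v x) \<bullet> x" "(A *\<^sub>v x) \<bullet> x \<le> eigval j A * (x \<bullet> x)"
    using eigval_common_test_vector[OF B A j] .
  have "x \<bullet> x > 0" using x conjugate_square_greater_0_vec[OF x(1)] by simp
  moreover have "eigval j B * (x \<bullet> x) \<le> (eigval j A + b) * (x \<bullet> x)"
    using le[OF x(1)] x(3,4) by (simp add: distrib_right)
  ultimately show ?thesis by simp
qed

section \<open>The Loewner order through quadratic forms\<close>

lemma quadratic_form_minus:
  fixes A B :: "real mat"
  assumes "A \<in> carrier_mat n n" "B \<in> carrier_mat n n" "x \<in> carrier_vec n"
  shows "((B - A) *\<^sub>v x) \<bullet> x = (B *\<^sub>v x) \<bullet> x - (A *\<^sub>v x) \<bullet> x"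
  using assms by (simp add: minus_mult_distrib_mat_vec minus_scalar_prod_distrib[of _ n])

lemma quadratic_form_scalar:
  fixes x :: "real vec"
  assumes "x \<in> carrier_vec n"
  shows "((b \<cdot>\<^sub>m 1\<^sub>m n) *\<^sub>v x) \<bullet> x = b * (x \<bullet> x)"
proof -
  have "(b \<cdot>\<^sub>m 1\<^sub>m n) *\<^sub>v x = b \<cdot>\<^sub>v x"
  proof (rule eq_vecI)
    fix i assume "i < dim_vec (b \<cdot>\<^sub>v x)"
    then have i: "i < n" using assms by simp
    have "((b \<cdot>\<^sub>m 1\<^sub>m n) *\<^sub>v x) $ i = (\<Sum>l<n. b * (if i = l then 1 else 0) * x $ l)"
      using i assms by (auto simp: scalar_prod_def atLeast0LessThan intro!: sum.cong)
    also have "\<dots> = (\<Sum>l<n. if l = i then b * x $ i else 0)"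
      by (rule sum.cong) auto
    finally show "((b \<cdot>\<^sub>m 1\<^sub>m n) *\<^sub>v x) $ i = (b \<cdot>\<^sub>v x) $ i" using i assms by simp
  qed (use assms in auto)
  then show ?thesis using assms by simp
qed

lemma hermitian_matI:
  fixes A :: "'a :: conjugatable_ordered_field mat"
  assumes "A \<in> carrier_mat n n" "\<And>i j. i < n \<Longrightarrow> j < n \<Longrightarrow> conjugate (A $$ (j, i)) = A $$ (i, j)"
  shows "hermitian_mat A"
  unfolding hermitian_mat_def
proof
  show "mat_adjoint A = A"
    by (rule eq_matI) (use assms in \<open>auto simp: mat_adjoint_def mat_of_rows_def\<close>)
qed (use assms in auto)

lemma symmetric_index:
  assumes "A \<in> carrier_mat n n" "transpose_mat A = A" "i < n" "j < n"
  shows "A $$ (j, i) = A $$ (i, j)"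
  using assms by (metis carrier_matD index_transpose_mat(1))

lemma loewner_realI:
  fixes A B :: "real mat"
  assumes A: "A \<in> carrier_mat n n" "transpose_mat A = A" and B: "B \<in> carrier_mat n n" "transpose_mat B = B"
  shows "(\<And>x. x \<in> carrier_vec n \<Longrightarrow> (A *\<^sub>v x) \<bullet> x \<le> (B *\<^sub>v x) \<bullet> x) \<Longrightarrow> A \<preceq>\<^sub>L B"
    "(\<And>x. x \<in> carrier_vec n \<Longrightarrow> x \<noteq> 0\<^sub>v n \<Longrightarrow> (A *\<^sub>v x) \<bullet> x < (B *\<^sub>v x) \<bullet> x) \<Longrightarrow> A \<prec>\<^sub>L B"
proof -
  have "hermitian_mat A" "hermitian_mat B"
    using symmetric_index[OF A] symmetric_index[OF B] by (auto intro!: hermitian_matI A(1) B(1))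
  then show "(\<And>x. x \<in> carrier_vec n \<Longrightarrow> (A *\<^sub>v x) \<bullet> x \<le> (B *\<^sub>v x) \<bullet> x) \<Longrightarrow> A \<preceq>\<^sub>L B"
    "(\<And>x. x \<in> carrier_vec n \<Longrightarrow> x \<noteq> 0\<^sub>v n \<Longrightarrow> (A *\<^sub>v x) \<bullet> x < (B *\<^sub>v x) \<bullet> x) \<Longrightarrow> A \<prec>\<^sub>L B"
    using A(1) B(1) by (auto simp: loewner_le_def loewner_less_def quadratic_form_minus[OF A(1) B(1)])
qed

text \<open>
  The mixed terms between real and imaginary part cancel by symmetry. Thus the Loewner comparison on
  the complex space reduces to the one on the real space.
\<close>

lemma complexified_quadratic_form:
  fixes M :: "real mat"
  assumes M: "M \<in> carrier_mat n n" "transpose_mat M = M" and v: "v \<in> carrier_vec n"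
  shows "(map_mat complex_of_real M *\<^sub>v v) \<bullet>c v =
    complex_of_real ((M *\<^sub>v map_vec Re v) \<bullet> map_vec Re v + (M *\<^sub>v map_vec Im v) \<bullet> map_vec Im v)"
proof -
  let ?x = "map_vec Re v" and ?y = "map_vec Im v"
  have xy: "?x \<in> carrier_vec n" "?y \<in> carrier_vec n" using v by auto
  have Mv: "(map_mat complex_of_real M *\<^sub>v v) $ i = Complex ((M *\<^sub>v ?x) $ i) ((M *\<^sub>v ?y) $ i)"
    if "i < n" for i
    using that M(1) v by (auto simp: scalar_prod_def complex_eq_iff)
  have "(map_mat complex_of_real M *\<^sub>v v) \<bullet>c v =
      (\<Sum>i<n. Complex ((M *\<^sub>v ?x) $ i) ((M *\<^sub>v ?y) $ i) * cnj (v $ i))"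
    using v by (auto simp: scalar_prod_def[of _ "conjugate v"] atLeast0LessThan Mv
      simp del: index_mult_mat_vec intro!: sum.cong)
  also have "\<dots> = Complex (\<Sum>i<n. (M *\<^sub>v ?x) $ i * ?x $ i + (M *\<^sub>v ?y) $ i * ?y $ i)
      (\<Sum>i<n. (M *\<^sub>v ?y) $ i * ?x $ i - (M *\<^sub>v ?x) $ i * ?y $ i)"
    using v by (auto simp: complex_eq_iff simp del: index_mult_mat_vec intro!: sum.cong)
  also have "(\<Sum>i<n. (M *\<^sub>v ?x) $ i * ?x $ i + (M *\<^sub>v ?y) $ i * ?y $ i)
      = (M *\<^sub>v ?x) \<bullet> ?x + (M *\<^sub>v ?y) \<bullet> ?y"
    using v by (simp add: scalar_prod_def[of "M *\<^sub>v _"] atLeast0LessThan sum.distrib del: index_mult_mat_vec)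
  also have "(\<Sum>i<n. (M *\<^sub>v ?y) $ i * ?x $ i - (M *\<^sub>v ?x) $ i * ?y $ i)
      = (M *\<^sub>v ?y) \<bullet> ?x - (M *\<^sub>v ?x) \<bullet> ?y"
    using v by (simp add: scalar_prod_def[of "M *\<^sub>v _"] atLeast0LessThan sum_subtractf del: index_mult_mat_vec)
  also have "(M *\<^sub>v ?y) \<bullet> ?x = ?y \<bullet> (M *\<^sub>v ?x)"
    using transpose_vec_mult_scalar[OF M(1) xy] unfolding M(2) .
  also have "\<dots> = (M *\<^sub>v ?x) \<bullet> ?y"
    by (rule comm_scalar_prod[of _ n]) (use M xy in auto)
  also have "Complex ((M *\<^sub>v ?x) \<bullet> ?x + (M *\<^sub>v ?y) \<bullet> ?y) ((M *\<^sub>v ?x) \<bullet> ?y - (M *\<^sub>v ?x) \<bullet> ?y)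
      = complex_of_real ((M *\<^sub>v ?x) \<bullet> ?x + (M *\<^sub>v ?y) \<bullet> ?y)"
    by (simp add: complex_eq_iff)
  finally show ?thesis .
qed

lemma loewner_complexI:
  fixes A B :: "real mat"
  assumes A: "A \<in> carrier_mat n n" "transpose_mat A = A" and B: "B \<in> carrier_mat n n" "transpose_mat B = B"
  shows "(\<And>x. x \<in> carrier_vec n \<Longrightarrow> (A *\<^sub>v x) \<bullet> x \<le> (B *\<^sub>v x) \<bullet> x) \<Longrightarrow>
      map_mat complex_of_real A \<preceq>\<^sub>L map_mat complex_of_real B" (is "PROP ?P1")
    "(\<And>x. x \<in> carrier_vec n \<Longrightarrow> x \<noteq> 0\<^sub>v n \<Longrightarrow> (A *\<^sub>v x) \<bullet> x < (B *\<^sub>v x) \<bullet> x) \<Longrightarrow>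
      map_mat complex_of_real A \<prec>\<^sub>L map_mat complex_of_real B" (is "PROP ?P2")
proof -
  let ?c = "map_mat complex_of_real"
  have herm: "hermitian_mat (?c A)" "hermitian_mat (?c B)"
    using symmetric_index[OF A] symmetric_index[OF B] A(1) B(1)
    by (auto intro!: hermitian_matI[of _ n])
  have diff: "?c B - ?c A = ?c (B - A)"
    by (rule eq_matI) (use A B in auto)
  have BA: "B - A \<in> carrier_mat n n" using A(1) by (rule minus_carrier_mat)
  have sym: "transpose_mat (B - A) = B - A"
    by (rule eq_matI) (use A B symmetric_index[OF A] symmetric_index[OF B] in auto)
  have form: "((?c B - ?c A) *\<^sub>v v) \<bullet>c v = complex_of_real
      (((B *\<^sub>v map_vec Re v) \<bullet> map_vec Re v - (A *\<^sub>v map_vec Re v) \<bullet> map_vec Re v) +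
       ((B *\<^sub>v map_vec Im v) \<bullet> map_vec Im v - (A *\<^sub>v map_vec Im v) \<bullet> map_vec Im v))"
    if v: "v \<in> carrier_vec n" for v
    unfolding diff complexified_quadratic_form[OF BA sym v]
    using v by (simp add: quadratic_form_minus[OF A(1) B(1)])
  show "PROP ?P1"
  proof -
    assume le: "\<And>x. x \<in> carrier_vec n \<Longrightarrow> (A *\<^sub>v x) \<bullet> x \<le> (B *\<^sub>v x) \<bullet> x"
    have "0 \<le> ((?c B - ?c A) *\<^sub>v v) \<bullet>c v" if v: "v \<in> carrier_vec n" for v
      unfolding form[OF v] using le[of "map_vec Re v"] le[of "map_vec Im v"] v
      by (simp add: less_eq_complex_def)
    then show ?thesis using A(1) B(1) herm by (auto simp: loewner_le_def)
  qed
  show "PROP ?P2"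
  proof -
    assume less: "\<And>x. x \<in> carrier_vec n \<Longrightarrow> x \<noteq> 0\<^sub>v n \<Longrightarrow> (A *\<^sub>v x) \<bullet> x < (B *\<^sub>v x) \<bullet> x"
    have "0 < ((?c B - ?c A) *\<^sub>v v) \<bullet>c v" if v: "v \<in> carrier_vec n" "v \<noteq> 0\<^sub>v n" for v
    proof -
      let ?q = "\<lambda>x. (B *\<^sub>v x) \<bullet> x - (A *\<^sub>v x) \<bullet> x"
      have q: "?q x \<ge> 0" "x \<noteq> 0\<^sub>v n \<Longrightarrow> ?q x > 0" if "x \<in> carrier_vec n" for x
        using less[OF that] A(1) B(1) that by (cases "x = 0\<^sub>v n"; force)+
      have "map_vec Re v \<noteq> 0\<^sub>v n \<or> map_vec Im v \<noteq> 0\<^sub>v n"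
        using v by (auto simp: vec_eq_iff complex_eq_iff)
      then have "?q (map_vec Re v) + ?q (map_vec Im v) > 0"
        using q[of "map_vec Re v"] q[of "map_vec Im v"] v(1) by (auto intro: add_pos_nonneg add_nonneg_pos)
      then show ?thesis unfolding form[OF v(1)] by (simp add: less_complex_def)
    qed
    then show ?thesis using A(1) B(1) herm by (auto simp: loewner_less_def)
  qed
qed

text \<open>
  The two sign rules are consequences of the enclosure of \<open>eigval j B\<close> between \<open>eigval j A\<close> and
  \<open>eigval j A + b\<close>.
\<close>

lemma eigval_sandwich:
  fixes A B :: "real mat"
  assumes A: "A \<in> carrier_mat n n" "transpose_mat A = A" and B: "B \<in> carrier_mat n n" "transpose_mat B = B"
    and less: "\<And>x. x \<in> carrier_vec n \<Longrightarrow> x \<noteq> 0\<^sub>v n \<Longrightarrow> (A *\<^sub>v x) \<bullet> x < (B *\<^sub>v x) \<bullet> x"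
    and le: "\<And>x. x \<in> carrier_vec n \<Longrightarrow> (B *\<^sub>v x) \<bullet> x \<le> (A *\<^sub>v x) \<bullet> x + b * (x \<bullet> x)"
  shows "\<forall>j \<in> {1..n}. eigval j A < eigval j B \<and> eigval j B \<le> eigval j A + b \<and>
    (eigval j A \<ge> 0 \<longrightarrow> eigval j B > 0) \<and> (eigval j A < - b \<longrightarrow> eigval j B < 0)"
proof
  fix j assume j: "j \<in> {1..n}"
  show "eigval j A < eigval j B \<and> eigval j B \<le> eigval j A + b \<and>
    (eigval j A \<ge> 0 \<longrightarrow> eigval j B > 0) \<and> (eigval j A < - b \<longrightarrow> eigval j B < 0)"
    using eigval_less[OF A B less j] eigval_le_add[OF A B le j] by auto
qed

lemma eigval_monotone_convergence:
  fixes A :: "real \<Rightarrow> real mat" and B :: "real mat"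
  assumes A: "\<And>T. A T \<in> carrier_mat n n" "\<And>T. transpose_mat (A T) = A T"
    and B: "B \<in> carrier_mat n n" "transpose_mat B = B"
    and mono: "\<And>T T' x. T > t \<Longrightarrow> T < T' \<Longrightarrow> x \<in> carrier_vec n \<Longrightarrow> x \<noteq> 0\<^sub>v n \<Longrightarrow>
      (A T *\<^sub>v x) \<bullet> x < (A T' *\<^sub>v x) \<bullet> x"
    and sandwich: "\<And>T. T > t \<Longrightarrow> \<forall>j \<in> {1..n}. eigval j (A T) < eigval j B \<and> eigval j B \<le> eigval j (A T) + b T \<and>
      (eigval j (A T) \<ge> 0 \<longrightarrow> eigval j B > 0) \<and> (eigval j (A T) < - b T \<longrightarrow> eigval j B < 0)"
    and b: "(b \<longlongrightarrow> 0) at_top"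
  shows "\<forall>j \<in> {1..n}. strict_mono_on {t<..} (\<lambda>T. eigval j (A T)) \<and>
    ((\<lambda>T. eigval j (A T)) \<longlongrightarrow> eigval j B) at_top"
proof (intro ballI conjI)
  fix j assume j: "j \<in> {1..n}"
  show "strict_mono_on {t<..} (\<lambda>T. eigval j (A T))"
    using eigval_less[OF A A mono j] by (intro strict_mono_onI) auto
  have low: "((\<lambda>T. eigval j B - b T) \<longlongrightarrow> eigval j B) at_top"
    using tendsto_diff[OF tendsto_const[of "eigval j B"] b] by simp
  show "((\<lambda>T. eigval j (A T)) \<longlongrightarrow> eigval j B) at_top"
  proof (rule tendsto_sandwich[OF _ _ low tendsto_const])
    show "\<forall>\<^sub>F T in at_top. eigval j B - b T \<le> eigval j (A T)"
      by (rule eventually_mono[OF eventually_gt_at_top[of t]]) (use sandwich j in fastforce)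
    show "\<forall>\<^sub>F T in at_top. eigval j (A T) \<le> eigval j B"
      by (rule eventually_mono[OF eventually_gt_at_top[of t]]) (use sandwich j in fastforce)
  qed
qed

section \<open>The digamma function on the line with real part 1/4\<close>

text \<open>
  The function on the left has derivative \<open>2 z\<^sup>2 / (1 - z\<^sup>2)\<close> and vanishes at \<open>0\<close>; the mean value
  estimate on the disc of radius \<open>norm s\<close> gives the cubic bound.
\<close>

lemma Ln_midpoint_error:
  fixes s :: complex
  assumes "norm s \<le> 1 / 2"
  shows "norm (Ln (1 + s) - Ln (1 - s) - 2 * s) \<le> 8 / 3 * norm s ^ 3"
proof -
  let ?f = "\<lambda>z. Ln (1 + z) - Ln (1 - z) - 2 * z"
  let ?f' = "\<lambda>z. 1 / (1 + z) + 1 / (1 - z) - 2 :: complex"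
  have re: "0 < 1 + Re z" "0 < 1 - Re z" "1 + z \<noteq> 0" "1 - z \<noteq> 0"
    if "z \<in> cball 0 (norm s)" for z
  proof -
    have "\<bar>Re z\<bar> \<le> 1 / 2" using that assms abs_Re_le_cmod[of z] by simp
    then show "0 < 1 + Re z" "0 < 1 - Re z" by linarith+
    then show "1 + z \<noteq> 0" "1 - z \<noteq> 0" by (auto simp: complex_eq_iff)
  qed
  have "norm (?f s - ?f 0) \<le> (8 / 3 * norm s ^ 2) * norm (s - 0)"
  proof (rule field_differentiable_bound[of "cball 0 (norm s)" ?f ?f'])
    fix z :: complex assume z: "z \<in> cball 0 (norm s)"
    note re = re[OF z]
    show "(?f has_field_derivative ?f' z) (at z within cball 0 (norm s))"
      using re by (auto intro!: derivative_eq_intros simp: complex_nonpos_Reals_iff divide_inverse)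
    have "norm z ^ 2 \<le> (1 / 2)^2" using z assms by (intro power_mono) auto
    then have q: "norm (1 - z^2) \<ge> 3 / 4"
      using norm_triangle_ineq2[of 1 "z^2"] by (simp add: norm_power power2_eq_square norm_mult)
    have "?f' z = 2 * z^2 / (1 - z^2)"
    proof -
      have "1 - z^2 = (1 + z) * (1 - z)" by (simp add: power2_eq_square algebra_simps)
      moreover have "1 / (1 + z) + 1 / (1 - z) - 2 = 2 * z^2 / ((1 + z) * (1 - z))"
      proof -
        have "1 / (1 + z) + 1 / (1 - z) = 2 / ((1 + z) * (1 - z))"
          using re(3,4) by (simp add: divide_simps)
        moreover have "2 = 2 * ((1 + z) * (1 - z)) / ((1 + z) * (1 - z))"
          using re(3,4) by simp
        ultimately have "1 / (1 + z) + 1 / (1 - z) - 2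
            = 2 / ((1 + z) * (1 - z)) - 2 * ((1 + z) * (1 - z)) / ((1 + z) * (1 - z))" by simp
        also have "\<dots> = (2 - 2 * ((1 + z) * (1 - z))) / ((1 + z) * (1 - z))"
          by (simp only: diff_divide_distrib)
        also have "2 - 2 * ((1 + z) * (1 - z)) = 2 * z^2" by (simp add: power2_eq_square algebra_simps)
        finally show ?thesis .
      qed
      ultimately show ?thesis by simp
    qed
    then have "norm (?f' z) = 2 * norm z ^ 2 / norm (1 - z^2)"
      by (simp add: norm_divide norm_mult norm_power)
    also have "\<dots> \<le> 2 * norm s ^ 2 / (3 / 4)"
      using z q by (intro frac_le mult_left_mono power_mono) auto
    finally show "norm (?f' z) \<le> 8 / 3 * norm s ^ 2" by simp
  qed auto
  then show ?thesis by (simp add: power3_eq_cube power2_eq_square mult.assoc)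
qed

text \<open>
  The estimate \<open>Ln_midpoint_error\<close> at \<open>s = 1 / (2 w)\<close>. Only real parts are compared, so that the branch of the
  logarithm is irrelevant: the real part of \<open>Ln\<close> is the logarithm of the modulus.
\<close>

lemma ln_norm_midpoint_error:
  fixes w :: complex
  assumes "norm w \<ge> 1"
  shows "\<bar>ln (norm (w + 1 / 2)) - ln (norm (w - 1 / 2)) - Re (1 / w)\<bar> \<le> 1 / (3 * norm w ^ 3)"
proof -
  define s where "s = 1 / (2 * w)"
  have w: "w \<noteq> 0" using assms by auto
  have s: "norm s = 1 / (2 * norm w)" by (simp add: s_def norm_divide norm_mult)
  have s2: "norm s \<le> 1 / 2" using assms unfolding s by (simp add: divide_simps)
  have nz: "1 + s \<noteq> 0" "1 - s \<noteq> 0" using s2 by (auto simp: add_eq_0_iff2 eq_neg_iff_add_eq_0[symmetric] minus_equation_iff[of s])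
  have "w + 1 / 2 = w * (1 + s)" "w - 1 / 2 = w * (1 - s)" "1 / w = 2 * s"
    using w by (simp_all add: s_def field_simps)
  then have "ln (norm (w + 1 / 2)) - ln (norm (w - 1 / 2)) - Re (1 / w)
      = Re (Ln (1 + s) - Ln (1 - s) - 2 * s)"
    using nz w by (simp add: norm_mult ln_mult)
  also have "\<bar>\<dots>\<bar> \<le> 8 / 3 * norm s ^ 3"
    using abs_Re_le_cmod Ln_midpoint_error[OF s2] by (rule order_trans)
  also have "\<dots> = 1 / (3 * norm w ^ 3)" by (simp add: s power_divide power_mult_distrib)
  finally show ?thesis .
qed

text \<open>
  With \<open>u = n + 1/4\<close>, one factor of the cube is at least \<open>t\<close>, the other two give
  \<open>u\<^sup>2 + t\<^sup>2 \<ge> (u + t)\<^sup>2 / 2\<close>, and \<open>1 / y\<^sup>2 \<le> 1 / (y - 1/2) - 1 / (y + 1/2)\<close> telescopes.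
\<close>

lemma sum_inverse_cube_bound:
  fixes t :: real
  assumes t: "t \<ge> 1"
  shows "(\<Sum>n<m. 1 / norm (Complex (1 / 4 + real n) t) ^ 3) \<le> 2 / (t * (t - 1 / 4))"
proof -
  \<comment> \<open>\<open>t + n - 1/4\<close> is \<open>u + t - 1/2\<close> for \<open>u = n + 1/4\<close>.\<close>
  let ?g = "\<lambda>n. 2 / t * (1 / (t + real n - 1 / 4))"
  have "(\<Sum>n<m. 1 / norm (Complex (1 / 4 + real n) t) ^ 3) \<le> (\<Sum>n<m. ?g n - ?g (Suc n))"
  proof (rule sum_mono)
    fix n
    define u where "u = 1 / 4 + real n"
    have u: "u > 0" by (simp add: u_def)
    let ?w = "Complex u t"
    have w1: "norm ?w \<ge> t" using abs_Im_le_cmod[of ?w] t by simp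
    have "(norm ?w)\<^sup>2 = u\<^sup>2 + t\<^sup>2" by (simp add: cmod_def)
    also have "\<dots> \<ge> (u + t)\<^sup>2 / 2"
      using zero_le_power2[of "u - t"] by (simp add: power2_eq_square algebra_simps)
    finally have w2: "(norm ?w)\<^sup>2 \<ge> (u + t)\<^sup>2 / 2" .
    have "norm ?w ^ 3 = norm ?w * (norm ?w)\<^sup>2" by (simp add: power3_eq_cube power2_eq_square)
    also have "\<dots> \<ge> t * ((u + t)\<^sup>2 / 2)" using w1 w2 t by (intro mult_mono) auto
    finally have "1 / norm ?w ^ 3 \<le> 1 / (t * ((u + t)\<^sup>2 / 2))"
    proof (intro divide_left_mono mult_pos_pos)
      show "0 < norm ?w ^ 3" using w1 t by (intro zero_less_power) linarith
    qed (use u t in auto)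
    also have "\<dots> = 2 / t * (1 / (u + t)\<^sup>2)" by simp
    also have "\<dots> \<le> 2 / t * (1 / (u + t - 1 / 2) - 1 / (u + t + 1 / 2))"
    proof (rule mult_left_mono)
      have "(u + t)\<^sup>2 > 1\<^sup>2" using u t by (intro power_strict_mono) auto
      then have q: "1 < (u + t)\<^sup>2" by simp
      then have "0 < (u + t)\<^sup>2 - 1 / 4" "0 < (u + t)\<^sup>2" by linarith+
      then have "0 < (u + t)\<^sup>2 * ((u + t)\<^sup>2 - 1 / 4)" by (rule mult_pos_pos[rotated])
      then have "1 / (u + t)\<^sup>2 \<le> 1 / ((u + t)\<^sup>2 - 1 / 4)" by (intro divide_left_mono) auto
      also have "(u + t)\<^sup>2 - 1 / 4 = (u + t - 1 / 2) * (u + t + 1 / 2)"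
        by (simp add: power2_eq_square algebra_simps)
      also have "1 / \<dots> = 1 / (u + t - 1 / 2) - 1 / (u + t + 1 / 2)"
        using u t by (simp add: divide_simps)
      finally show "1 / (u + t)\<^sup>2 \<le> 1 / (u + t - 1 / 2) - 1 / (u + t + 1 / 2)" .
    qed (use t in simp)
    also have "\<dots> = ?g n - ?g (Suc n)"
      by (simp add: u_def algebra_simps)
    finally show "1 / norm (Complex (1 / 4 + real n) t) ^ 3 \<le> ?g n - ?g (Suc n)" by (simp add: u_def)
  qed
  also have "\<dots> = ?g 0 - ?g m" by (rule sum_lessThan_telescope')
  also have "\<dots> \<le> ?g 0" using t by simp
  finally show ?thesis by simp
qed

text \<open>
  The partial sums of the digamma series are compared, term by term, with the telescoping sum of
  \<open>ln \<bar>w + 1/2\<bar> - ln \<bar>w - 1/2\<bar>\<close> over \<open>w = 1/4 + n + i t\<close>. Centering each unit step at \<open>w\<close> is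
  what makes the error of order \<open>1 / t\<^sup>2\<close>; it moves the starting point to \<open>- 1/4 + i t\<close>.
\<close>

lemma Re_Digamma_quarter_line:
  fixes t :: real
  assumes t: "t \<ge> 1"
  shows "\<bar>Re (Digamma (Complex (1 / 4) t)) - ln (norm (Complex (- 1 / 4) t))\<bar> \<le> 2 / (3 * t * (t - 1 / 4))"
proof -
  define w where "w n = Complex (1 / 4 + real n) t" for n
  have w_eq: "w n = Complex (1 / 4) t + of_nat n" for n by (simp add: w_def complex_eq_iff)
  define l where "l n = ln (norm (w n - 1 / 2))" for n
  have w1: "norm (w n) \<ge> 1" for n using abs_Im_le_cmod[of "w n"] t by (simp add: w_def)
  define a where "a m = ln (real m) - (\<Sum>n<m. Re (1 / w n))" for m
  have "(\<lambda>m. Re (of_real (ln (real m)) - (\<Sum>n<m. inverse (Complex (1 / 4) t + of_nat n))))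
      \<longlonglongrightarrow> Re (Digamma (Complex (1 / 4) t))"
    using t by (intro tendsto_Re Digamma_LIMSEQ) (auto simp: complex_eq_iff)
  then have lim: "a \<longlonglongrightarrow> Re (Digamma (Complex (1 / 4) t))"
    unfolding a_def by (simp add: w_eq inverse_eq_divide)
  have step: "\<bar>l (Suc n) - l n - Re (1 / w n)\<bar> \<le> 1 / 3 * (1 / norm (w n) ^ 3)" for n
  proof -
    have "w (Suc n) - 1 / 2 = w n + 1 / 2" by (simp add: w_eq complex_eq_iff)
    then have "l (Suc n) = ln (norm (w n + 1 / 2))" by (simp only: l_def)
    then show ?thesis using ln_norm_midpoint_error[OF w1[of n]] by (simp add: l_def)
  qed
  have bound: "\<bar>a m - (ln (real m) - l m) - l 0\<bar> \<le> 2 / (3 * t * (t - 1 / 4))" for m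
  proof -
    have "a m - (ln (real m) - l m) - l 0 = (\<Sum>n<m. l (Suc n) - l n - Re (1 / w n))"
      using sum_lessThan_telescope[of l m] by (simp add: a_def sum_subtractf)
    also have "\<bar>\<dots>\<bar> \<le> (\<Sum>n<m. 1 / 3 * (1 / norm (w n) ^ 3))"
      by (rule order_trans[OF sum_abs sum_mono]) (rule step)
    also have "\<dots> = 1 / 3 * (\<Sum>n<m. 1 / norm (w n) ^ 3)" by (simp only: sum_distrib_left)
    also have "\<dots> \<le> 1 / 3 * (2 / (t * (t - 1 / 4)))"
      unfolding w_def by (intro mult_left_mono sum_inverse_cube_bound t) simp
    finally show ?thesis by simp
  qed
  have "(\<lambda>m. ln (real m) - l m) \<longlonglongrightarrow> 0"
  proof -
    have "l m = ln (sqrt ((real m - 1 / 4)\<^sup>2 + t\<^sup>2))" for m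
      by (simp add: l_def w_def cmod_def)
    then show ?thesis by (simp, real_asymp)
  qed
  from tendsto_diff[OF tendsto_diff[OF lim this] tendsto_const[of "l 0"]]
  have "(\<lambda>m. \<bar>a m - (ln (real m) - l m) - l 0\<bar>) \<longlonglongrightarrow> \<bar>Re (Digamma (Complex (1 / 4) t)) - l 0\<bar>"
    by (intro tendsto_rabs) simp
  then have "\<bar>Re (Digamma (Complex (1 / 4) t)) - l 0\<bar> \<le> 2 / (3 * t * (t - 1 / 4))"
    by (rule LIMSEQ_le_const2) (use bound in auto)
  moreover have "w 0 - 1 / 2 = Complex (- 1 / 4) t" by (simp add: w_def complex_eq_iff)
  ultimately show ?thesis by (simp add: l_def)
qed

text \<open>
  The explicit constant matters: at \<open>r = 7\<close> the main term is only about \<open>0.108\<close>, and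
  \<open>3 / 49 < 0.062\<close>.
\<close>

lemma h_plus_log_approx:
  assumes r: "r \<ge> 7"
  shows "\<bar>h_plus r - ln (r / (2 * pi))\<bar> \<le> 3 / r\<^sup>2"
proof -
  define t where "t = r / 2"
  have t: "t \<ge> 7 / 2" using r by (simp add: t_def)
  have "1 / 4 + \<i> * complex_of_real r / 2 = Complex (1 / 4) t"
    by (simp add: t_def complex_eq_iff)
  then have h: "h_plus r = Re (Digamma (Complex (1 / 4) t)) - ln pi" by (simp add: h_plus_def)
  have n2: "norm (Complex (- 1 / 4) t) = sqrt (t\<^sup>2 * (1 + 1 / (16 * t\<^sup>2)))"
    using t by (simp add: cmod_def field_simps power2_eq_square)
  have ln_n: "ln (norm (Complex (- 1 / 4) t)) = ln t + ln (1 + 1 / (16 * t\<^sup>2)) / 2"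
    
  proof -
    have "1 + 1 / (16 * t\<^sup>2) > 0" using t by (intro add_pos_nonneg) auto
    then show ?thesis unfolding n2 using t by (simp add: ln_sqrt ln_mult ln_realpow add_divide_distrib)
  qed
  have pos: "0 \<le> ln (1 + 1 / (16 * t\<^sup>2))" using t by (intro ln_ge_zero) simp
  have small: "ln (1 + 1 / (16 * t\<^sup>2)) \<le> 1 / (16 * t\<^sup>2)" using t by (intro ln_add_one_self_le_self) simp
  have "2 / (3 * t * (t - 1 / 4)) \<le> 2 / (3 * t * (13 / 14 * t))"
    using t by (intro divide_left_mono mult_left_mono mult_pos_pos) auto
  also have "\<dots> = 28 / (39 * t\<^sup>2)" by (simp add: power2_eq_square)
  finally have e: "2 / (3 * t * (t - 1 / 4)) \<le> 28 / (39 * t\<^sup>2)" .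
  have "28 / (39 * t\<^sup>2) + 1 / (16 * t\<^sup>2) / 2 \<le> 3 / (4 * t\<^sup>2) + 0 / t\<^sup>2"
    using t by (simp add: field_simps)
  then have sum: "28 / (39 * t\<^sup>2) + 1 / (16 * t\<^sup>2) / 2 \<le> 3 / (4 * t\<^sup>2)" by simp
  have "ln (r / (2 * pi)) = ln t - ln pi" using r by (simp add: t_def ln_div ln_mult)
  then have "\<bar>h_plus r - ln (r / (2 * pi))\<bar> \<le> 3 / (4 * t\<^sup>2)"
    using Re_Digamma_quarter_line[of t] t e sum pos small unfolding h ln_n by linarith
  also have "\<dots> = 3 / r\<^sup>2" by (simp add: t_def power_divide)
  finally show ?thesis .
qed

lemma h_plus_pos:
  assumes r: "r \<ge> 7"
  shows "h_plus r > 0"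
proof -
  \<comment> \<open>\<open>1 - 2 \<pi> / 7\<close> exceeds \<open>0.08\<close> already for \<open>\<pi> < 3.2\<close>, and the error is at most \<open>3 / 49 < 0.062\<close>.\<close>
  have "1 - 1 / (r / (2 * pi)) \<le> ln (r / (2 * pi))"
    using r ln_le_minus_one[of "1 / (r / (2 * pi))"] by (simp add: ln_div)
  moreover have "1 / (r / (2 * pi)) \<le> 2 * pi / 7" using r by (simp add: field_simps)
  moreover have "pi < 3.2" using pi_approx(2) by simp
  moreover have "3 / r\<^sup>2 \<le> 3 / 7\<^sup>2" using r by (intro divide_left_mono power_mono) auto
  ultimately show ?thesis using h_plus_log_approx[OF r] by (simp add: abs_le_iff)
qed

lemma h_plus_le_ln:
  assumes r: "r \<ge> 7"
  shows "h_plus r \<le> ln r"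
proof -
  \<comment> \<open>The error term is absorbed by \<open>ln (2 \<pi>) \<ge> 1\<close>.\<close>
  have "ln (exp 1) \<le> ln (2 * pi)"
    using pi_gt3 exp_le by (subst ln_le_cancel_iff) auto
  moreover have "3 / r\<^sup>2 \<le> 3 / 7\<^sup>2" using r by (intro divide_left_mono power_mono) auto
  moreover have "ln (r / (2 * pi)) = ln r - ln (2 * pi)" using r by (simp add: ln_div)
  ultimately show ?thesis using h_plus_log_approx[OF r] by (simp add: abs_le_iff)
qed

lemma continuous_on_h_plus [continuous_intros]: "continuous_on S h_plus"
proof -
  have nz: "1 / 4 + \<i> * complex_of_real r / 2 \<notin> \<int>\<^sub>\<le>\<^sub>0" for r
    by (auto elim!: nonpos_Ints_cases simp: complex_eq_iff)
  show ?thesis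
    unfolding h_plus_def
    by (intro continuous_at_imp_continuous_on ballI continuous_intros isCont_Polygamma) (auto simp: nz)
qed

lemma h_plus_minus: "h_plus (- r) = h_plus r"
proof -
  let ?z = "1 / 4 + \<i> * complex_of_real r / 2"
  let ?a = "\<lambda>z m. of_real (ln (real m)) - (\<Sum>n<m. inverse (z + of_nat n))"
  have nz: "?z \<noteq> 0" by (auto simp: complex_eq_iff)
  have "(\<lambda>m. cnj (?a ?z m)) \<longlonglongrightarrow> cnj (Digamma ?z)"
    by (intro tendsto_cnj Digamma_LIMSEQ nz)
  moreover have "(\<lambda>m. ?a (cnj ?z) m) \<longlonglongrightarrow> Digamma (cnj ?z)"
    using nz by (intro Digamma_LIMSEQ) (simp only: complex_cnj_zero_iff not_False_eq_True)
  ultimately have "Digamma (cnj ?z) = cnj (Digamma ?z)"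
    by (intro LIMSEQ_unique) simp_all
  moreover have "cnj ?z = 1 / 4 + \<i> * complex_of_real (- r) / 2" by simp
  ultimately have "Re (Digamma (1 / 4 + \<i> * complex_of_real (- r) / 2)) = Re (Digamma ?z)" by simp
  then show ?thesis by (simp add: h_plus_def)
qed

section \<open>Divided differences of the archimedean kernel\<close>

text \<open>
  With \<open>b = 2 \<pi> x / L\<close>, the integrand \<open>sin (b (L - y)) cos (r y)\<close> has the primitive
  \<open>(b cos (b (L - y)) cos (r y) - r sin (b (L - y)) sin (r y)) / (b\<^sup>2 - r\<^sup>2)\<close>.
\<close>

lemma S_kernel_closed_form:
  assumes L: "L > 0" and ne: "r\<^sup>2 \<noteq> (2 * pi * x / L)\<^sup>2"
  shows "S_kernel r x L =
    (cos (2 * pi * x) - cos (r * L)) * (2 * pi * x / L) / (r\<^sup>2 - (2 * pi * x / L)\<^sup>2)"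
proof -
  define b where "b = 2 * pi * x / L"
  have ne': "b\<^sup>2 - r\<^sup>2 \<noteq> 0" using ne by (simp add: b_def)
  have ph: "2 * pi * x * (1 - y / L) = b * (L - y)" for y
    using L by (simp add: b_def field_simps)
  let ?G = "\<lambda>y. (b * cos (b * (L - y)) * cos (r * y) - r * sin (b * (L - y)) * sin (r * y)) / (b\<^sup>2 - r\<^sup>2)"
  have "((\<lambda>y. sin (b * (L - y)) * cos (r * y)) has_integral (?G L - ?G 0)) {0..L}"
  proof (rule fundamental_theorem_of_calculus)
    fix y
    have "(?G has_field_derivative (b\<^sup>2 - r\<^sup>2) * (sin (b * (L - y)) * cos (r * y)) / (b\<^sup>2 - r\<^sup>2))
        (at y within {0..L})"
      by (rule DERIV_cdivide) (auto intro!: derivative_eq_intros simp: power2_eq_square algebra_simps)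
    then show "(?G has_vector_derivative sin (b * (L - y)) * cos (r * y)) (at y within {0..L})"
      using ne' by (simp add: has_real_derivative_iff_has_vector_derivative)
  qed (use L in simp)
  then have "S_kernel r x L = ?G L - ?G 0"
    unfolding S_kernel_def ph by (rule integral_unique)
  also have "\<dots> = (cos (b * L) - cos (r * L)) * b / (r\<^sup>2 - b\<^sup>2)"
    using ne' by (simp add: divide_simps) (simp add: algebra_simps)
  also have "b * L = 2 * pi * x" using L by (simp add: b_def)
  finally show ?thesis by (simp add: b_def)
qed

text \<open>
  The derivative of \<open>S_kernel r x L\<close> in \<open>x\<close>. It is kept as an integral because the closed form
  is singular at \<open>r = \<plusminus> 2 \<pi> x / L\<close>, and integrals over \<open>{- T..T}\<close> may run through these points.
\<close>

definition S_kernel_deriv :: "real \<Rightarrow> real \<Rightarrow> real \<Rightarrow> real" where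
  "S_kernel_deriv r x L =
     integral {0..L} (\<lambda>y. 2 * pi * (1 - y / L) * cos (2 * pi * x * (1 - y / L)) * cos (r * y))"

lemma has_derivative_S_kernel:
  "((\<lambda>x. S_kernel r x L) has_field_derivative S_kernel_deriv r x L) (at x)"
proof -
  have "((\<lambda>x. integral (cbox 0 L) (\<lambda>y. sin (2 * pi * x * (1 - y / L)) * cos (r * y)))
     has_field_derivative
     integral (cbox 0 L) (\<lambda>y. 2 * pi * (1 - y / L) * cos (2 * pi * x * (1 - y / L)) * cos (r * y)))
     (at x within UNIV)"
  proof (rule leibniz_rule_field_derivative)
    show "continuous_on (UNIV \<times> cbox 0 L)
        (\<lambda>(x, y). 2 * pi * (1 - y / L) * cos (2 * pi * x * (1 - y / L)) * cos (r * y))"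
      unfolding divide_inverse by (auto intro!: continuous_intros simp: split_beta)
    show "(\<lambda>y. sin (2 * pi * x * (1 - y / L)) * cos (r * y)) integrable_on cbox 0 L" for x
      unfolding divide_inverse by (intro integrable_continuous continuous_intros)
  qed (auto intro!: derivative_eq_intros)
  then show ?thesis unfolding S_kernel_def S_kernel_deriv_def by simp
qed

lemma continuous_S_kernel:
  "continuous_on S (\<lambda>(x, r). S_kernel r x L)"
  "continuous_on S (\<lambda>(x, r). S_kernel_deriv r x L)"
proof -
  have "continuous_on S (\<lambda>p. integral (cbox 0 L)
      (\<lambda>y. sin (2 * pi * fst p * (1 - y / L)) * cos (snd p * y)))"
    unfolding divide_inverse
    by (rule integral_continuous_on_param) (auto intro!: continuous_intros simp: split_beta)
  then show "continuous_on S (\<lambda>(x, r). S_kernel r x L)"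
    by (simp add: S_kernel_def split_beta)
  have "continuous_on S (\<lambda>p. integral (cbox 0 L)
      (\<lambda>y. 2 * pi * (1 - y / L) * cos (2 * pi * fst p * (1 - y / L)) * cos (snd p * y)))"
    unfolding divide_inverse
    by (rule integral_continuous_on_param) (auto intro!: continuous_intros simp: split_beta)
  then show "continuous_on S (\<lambda>(x, r). S_kernel_deriv r x L)"
    by (simp add: S_kernel_deriv_def split_beta)
qed

lemma continuous_on_S_kernel_r [continuous_intros]:
  "continuous_on S (\<lambda>r. S_kernel r x L)" "continuous_on S (\<lambda>r. S_kernel_deriv r x L)"
  using continuous_on_compose2[OF continuous_S_kernel(1)[of UNIV L], of S "\<lambda>r. (x, r)"]
    continuous_on_compose2[OF continuous_S_kernel(2)[of UNIV L], of S "\<lambda>r. (x, r)"]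
  by (auto simp: continuous_on_Pair)

lemma deriv_psi_arch:
  "deriv (psi_arch c T) x =
     1 / (2 * pi\<^sup>2) * integral {- T..T} (\<lambda>r. h_plus r * S_kernel_deriv r x (ln c))"
proof (rule DERIV_imp_deriv)
  let ?L = "ln c"
  have "((\<lambda>x. integral (cbox (- T) T) (\<lambda>r. h_plus r * S_kernel r x ?L)) has_field_derivative
      integral (cbox (- T) T) (\<lambda>r. h_plus r * S_kernel_deriv r x ?L)) (at x within UNIV)"
  proof (rule leibniz_rule_field_derivative)
    show "((\<lambda>x. h_plus r * S_kernel r x ?L) has_field_derivative h_plus r * S_kernel_deriv r x ?L)
        (at x within UNIV)" for x r
      by (intro DERIV_cmult has_derivative_S_kernel)
    show "(\<lambda>r. h_plus r * S_kernel r x ?L) integrable_on cbox (- T) T" for x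
      by (intro integrable_continuous continuous_intros)
    have "continuous_on (UNIV \<times> cbox (- T) T) (\<lambda>p. h_plus (snd p))"
      by (rule continuous_on_compose2[OF continuous_on_h_plus[of UNIV]]) (auto intro!: continuous_intros)
    from continuous_on_mult[OF this continuous_S_kernel(2)]
    show "continuous_on (UNIV \<times> cbox (- T) T) (\<lambda>(x, r). h_plus r * S_kernel_deriv r x ?L)"
      by (simp add: split_beta)
  qed auto
  then show "(psi_arch c T has_field_derivative
      1 / (2 * pi\<^sup>2) * integral {- T..T} (\<lambda>r. h_plus r * S_kernel_deriv r x ?L)) (at x)"
    unfolding psi_arch_def by (intro DERIV_cmult) simp
qed

lemma integral_even_annulus:
  fixes g :: "real \<Rightarrow> real"
  assumes g: "continuous_on UNIV g" and even: "\<And>r. g (- r) = g r" and T: "0 \<le> T" "T \<le> T'"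
  shows "integral {- T'..T'} g - integral {- T..T} g = 2 * integral {T..T'} g"
proof -
  have int: "g integrable_on {a..b}" for a b
    by (rule integrable_continuous_interval) (rule continuous_on_subset[OF g], simp)
  have "integral {- T'..- T} g + integral {- T..T'} g = integral {- T'..T'} g"
    using T by (intro Henstock_Kurzweil_Integration.integral_combine int) auto
  moreover have "integral {- T..T} g + integral {T..T'} g = integral {- T..T'} g"
    using T by (intro Henstock_Kurzweil_Integration.integral_combine int) auto
  moreover have "integral {- T'..- T} g = integral {T..T'} g"
    using Henstock_Kurzweil_Integration.integral_reflect_real[of T' T g] by (simp add: even)
  ultimately show ?thesis by simp
qed

lemma S_kernel_minus:
  "S_kernel (- r) x L = S_kernel r x L" "S_kernel_deriv (- r) x L = S_kernel_deriv r x L"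
  by (simp_all add: S_kernel_def S_kernel_deriv_def)

lemma rho_pos: "c > 1 \<Longrightarrow> rho c > 0"
  by (simp add: rho_def)

text \<open>
  At \<open>x = m\<close> the function \<open>cos (2 \<pi> x)\<close> is \<open>1\<close> and its derivative vanishes, so both the
  kernel and its derivative carry the factor \<open>1 - cos (L r)\<close>. In the variable \<open>a = r / \<rho>\<close> the
  remaining factors are \<open>m / (a\<^sup>2 - m\<^sup>2)\<close> and the derivative of this expression in \<open>m\<close>.
\<close>

lemma S_kernel_at_integer:
  assumes c: "c > 1" and r: "\<bar>rho c * real_of_int m\<bar> < r"
  defines "a \<equiv> r / rho c" and "w \<equiv> 2 * (sin (ln c * r / 2))\<^sup>2 / rho c"
  shows "S_kernel r (real_of_int m) (ln c) = w * (real_of_int m / (a\<^sup>2 - (real_of_int m)\<^sup>2))"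
    "S_kernel_deriv r (real_of_int m) (ln c) = w * ((a\<^sup>2 + (real_of_int m)\<^sup>2) / (a\<^sup>2 - (real_of_int m)\<^sup>2)\<^sup>2)"
proof -
  define L where "L = ln c"
  define R where "R = rho c"
  have L: "L > 0" using c by (simp add: L_def)
  have R: "R > 0" using rho_pos[OF c] by (simp add: R_def)
  have RL: "2 * pi * x / L = R * x" for x by (simp add: R_def rho_def L_def)
  have aR: "r = a * R" using R by (simp add: a_def R_def)
  have w: "w * R = 1 - cos (r * L)"
    using R cos_double_sin[of "L * r / 2"] by (simp add: w_def R_def L_def mult.commute)
  have m2: "real_of_int m ^ 2 < a\<^sup>2"
  proof -
    have "(R * real_of_int m)\<^sup>2 < r\<^sup>2"
      using r by (metis R_def abs_ge_zero power2_abs power_strict_mono zero_less_numeral)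
    then show ?thesis using R by (simp add: aR power_mult_distrib mult.commute)
  qed
  have closed: "S_kernel r x L = (cos (2 * pi * x) - cos (r * L)) * (R * x) / (r\<^sup>2 - (R * x)\<^sup>2)"
    if "x \<in> ball 0 a" for x
  proof -
    have "x\<^sup>2 < a\<^sup>2"
      using that by (metis abs_ge_zero dist_0_norm mem_ball power2_abs power_strict_mono real_norm_def zero_less_numeral)
    then have "R\<^sup>2 * x\<^sup>2 < R\<^sup>2 * a\<^sup>2" using R by simp
    then have "(R * x)\<^sup>2 < r\<^sup>2" by (simp add: aR power_mult_distrib mult.commute)
    then show ?thesis using S_kernel_closed_form[OF L, of r x] by (simp add: RL)
  qed
  have "\<bar>real_of_int m\<bar> < a"
    using r R by (simp add: a_def R_def[symmetric] pos_less_divide_eq abs_mult mult.commute)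
  then have mball: "real_of_int m \<in> ball 0 a" by simp
  have cos1: "cos (2 * pi * real_of_int m) = 1" and sin0: "sin (2 * pi * real_of_int m) = 0"
    by (simp_all add: cos_int_2pin sin_int_2pin)
  have den: "r\<^sup>2 - (R * x)\<^sup>2 = R\<^sup>2 * (a\<^sup>2 - x\<^sup>2)" for x
    by (simp add: aR power_mult_distrib algebra_simps)
  show "S_kernel r (real_of_int m) (ln c) = w * (real_of_int m / (a\<^sup>2 - (real_of_int m)\<^sup>2))"
    using closed[OF mball] R m2 unfolding cos1 den w[symmetric] L_def[symmetric]
    by (simp add: power2_eq_square)
  let ?F = "\<lambda>x. (cos (2 * pi * x) - cos (r * L)) * (R * x) / (r\<^sup>2 - (R * x)\<^sup>2)"
  let ?m = "real_of_int m"
  have dne: "r\<^sup>2 - (R * ?m)\<^sup>2 \<noteq> 0" unfolding den using R m2 by simp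
  have "(?F has_field_derivative
      ((1 - cos (r * L)) * R * (r\<^sup>2 - (R * ?m)\<^sup>2) + (1 - cos (r * L)) * (R * ?m) * (2 * R * (R * ?m)))
        / (r\<^sup>2 - (R * ?m)\<^sup>2)\<^sup>2) (at ?m)"
    using dne by (auto intro!: derivative_eq_intros simp: cos1 sin0 power2_eq_square)
  moreover have "((\<lambda>x. S_kernel r x L) has_field_derivative S_kernel_deriv r ?m L) (at ?m)"
    by (rule has_derivative_S_kernel)
  \<comment> \<open>The closed form holds in a neighbourhood of \<open>m\<close>, so it has the same derivative there.\<close>
  then have "(?F has_field_derivative S_kernel_deriv r ?m L) (at ?m)"
    by (rule has_field_derivative_transform_within_open[where S = "ball 0 a"]) (use mball closed in auto)
  ultimately have "S_kernel_deriv r ?m L =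
      ((1 - cos (r * L)) * R * (r\<^sup>2 - (R * ?m)\<^sup>2) + (1 - cos (r * L)) * (R * ?m) * (2 * R * (R * ?m)))
        / (r\<^sup>2 - (R * ?m)\<^sup>2)\<^sup>2"
    by (rule DERIV_unique[rotated])
  also have "\<dots> = (w * R) * R * (R\<^sup>2 * (a\<^sup>2 + ?m\<^sup>2)) / (R\<^sup>2 * (a\<^sup>2 - ?m\<^sup>2))\<^sup>2"
    unfolding den w by (simp add: power2_eq_square algebra_simps)
  also have "\<dots> = w * ((a\<^sup>2 + ?m\<^sup>2) / (a\<^sup>2 - ?m\<^sup>2)\<^sup>2)"
    using R by (simp add: power2_eq_square)
  finally show "S_kernel_deriv r (real_of_int m) (ln c) = w * ((a\<^sup>2 + (real_of_int m)\<^sup>2) / (a\<^sup>2 - (real_of_int m)\<^sup>2)\<^sup>2)"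
    by (simp add: L_def)
qed

text \<open>
  The entry, at the frequencies \<open>m\<close> and \<open>n\<close>, of the matrix that is integrated over \<open>{T..}\<close> to
  give \<open>\<pi>\<^sup>2\<close> times the difference of \<open>Q_inf\<close> and \<open>Q_tot\<close>.
\<close>

definition tail_kernel :: "real \<Rightarrow> real \<Rightarrow> int \<Rightarrow> int \<Rightarrow> real" where
  "tail_kernel c r m n = h_plus r * ((sin (ln c * r / 2))\<^sup>2 / rho c) *
     (p_vec c r m * p_vec c r n + q_vec c r m * q_vec c r n)"

text \<open>
  Both sides equal \<open>2 (a\<^sup>2 + m n) / ((a\<^sup>2 - m\<^sup>2) (a\<^sup>2 - n\<^sup>2))\<close>. Its right-hand
  side is what turns the matrix of divided differences into a sum of two rank-one matrices.
\<close>

lemma divided_difference_identity: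
  fixes a m n :: real
  assumes "a \<noteq> m" "a \<noteq> - m" "a \<noteq> n" "a \<noteq> - n" "m \<noteq> n"
  shows "2 * ((m / (a\<^sup>2 - m\<^sup>2) - n / (a\<^sup>2 - n\<^sup>2)) / (m - n)) =
    1 / (a - m) * (1 / (a - n)) + 1 / (a + m) * (1 / (a + n))"
proof -
  have f: "a\<^sup>2 - m\<^sup>2 = (a - m) * (a + m)" "a\<^sup>2 - n\<^sup>2 = (a - n) * (a + n)"
    by (simp_all add: power2_eq_square algebra_simps)
  have nz: "a - m \<noteq> 0" "a + m \<noteq> 0" "a - n \<noteq> 0" "a + n \<noteq> 0" "m - n \<noteq> 0" using assms by auto
  show ?thesis unfolding f using nz by (simp add: divide_simps) (simp add: power2_eq_square algebra_simps)
qed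

lemma divided_difference_identity_diag:
  fixes a m :: real
  assumes "a \<noteq> m" "a \<noteq> - m"
  shows "2 * ((a\<^sup>2 + m\<^sup>2) / (a\<^sup>2 - m\<^sup>2)\<^sup>2) = 1 / (a - m) * (1 / (a - m)) + 1 / (a + m) * (1 / (a + m))"
proof -
  have f: "a\<^sup>2 - m\<^sup>2 = (a - m) * (a + m)" by (simp add: power2_eq_square algebra_simps)
  have nz: "a - m \<noteq> 0" "a + m \<noteq> 0" using assms by auto
  show ?thesis unfolding f using nz by (simp add: divide_simps) (simp add: power2_eq_square algebra_simps)
qed

lemma abs_freq_le: "i < 2 * N + 1 \<Longrightarrow> \<bar>real_of_int (freq N i)\<bar> \<le> real N"
  by (auto simp: freq_def)

text \<open>
  Increasing the cutoff from \<open>T\<close> to \<open>T'\<close> adds the integral over \<open>T \<le> \<bar>r\<bar> \<le> T'\<close>, which by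
  evenness is twice the one over \<open>{T..T'}\<close>. There all integer frequencies lie below \<open>r / \<rho>\<close>, so
  the closed forms apply; on the diagonal they describe the derivative, off the diagonal the divided
  difference.
\<close>

lemma Q_arch_increment:
  assumes c: "c > 1" and ij: "i < 2 * N + 1" "j < 2 * N + 1"
    and T: "rho c * real N < T" "T \<le> T'"
  shows "Q_arch c N T' $$ (i, j) - Q_arch c N T $$ (i, j) =
    1 / pi\<^sup>2 * integral {T..T'} (\<lambda>r. tail_kernel c r (freq N i) (freq N j))"
proof -
  have R: "rho c > 0" by (rule rho_pos[OF c])
  have T0: "0 \<le> T" using T R by (smt (verit) mult_nonneg_nonneg of_nat_0_le_iff)
  have lt: "\<bar>rho c * real_of_int (freq N k)\<bar> < r" if "k < 2 * N + 1" "r \<in> {T..T'}" for k r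
  proof -
    have "rho c * \<bar>real_of_int (freq N k)\<bar> \<le> rho c * real N"
      using R abs_freq_le[OF that(1)] by simp
    moreover have "\<bar>rho c * real_of_int (freq N k)\<bar> = rho c * \<bar>real_of_int (freq N k)\<bar>"
      using R by (simp add: abs_mult)
    ultimately show ?thesis using T(1) that(2) by simp
  qed
  have ne: "r / rho c \<noteq> real_of_int (freq N k)" "r / rho c \<noteq> - real_of_int (freq N k)"
    if "k < 2 * N + 1" "r \<in> {T..T'}" for k r
  proof -
    have "r = rho c * y" if "r / rho c = y" for y using that R by auto
    then show "r / rho c \<noteq> real_of_int (freq N k)" "r / rho c \<noteq> - real_of_int (freq N k)"
      using lt[OF that] abs_ge_self[of "rho c * freq N k"] abs_ge_minus_self[of "rho c * freq N k"]
      by fastforce+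
  qed
  have int: "(\<lambda>r. h_plus r * S_kernel r x (ln c)) integrable_on {T..T'}" for x
    by (intro integrable_continuous_interval continuous_intros)
  show ?thesis
  proof (cases "i = j")
    case True
    let ?m = "real_of_int (freq N i)"
    have "Q_arch c N T' $$ (i, j) - Q_arch c N T $$ (i, j) =
        1 / (2 * pi\<^sup>2) * (integral {- T'..T'} (\<lambda>r. h_plus r * S_kernel_deriv r ?m (ln c))
          - integral {- T..T} (\<lambda>r. h_plus r * S_kernel_deriv r ?m (ln c)))"
      using ij True by (simp add: Q_arch_def Q_mat_def deriv_psi_arch right_diff_distrib)
    also have "\<dots> = 1 / (2 * pi\<^sup>2) * (2 * integral {T..T'} (\<lambda>r. h_plus r * S_kernel_deriv r ?m (ln c)))"
      by (subst integral_even_annulus)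
         (use T T0 in \<open>auto intro!: continuous_intros simp: h_plus_minus S_kernel_minus\<close>)
    also have "integral {T..T'} (\<lambda>r. h_plus r * S_kernel_deriv r ?m (ln c)) =
        integral {T..T'} (\<lambda>r. tail_kernel c r (freq N i) (freq N j))"
    proof (rule Henstock_Kurzweil_Integration.integral_cong)
      fix r assume r: "r \<in> {T..T'}"
      show "h_plus r * S_kernel_deriv r ?m (ln c) = tail_kernel c r (freq N i) (freq N j)"
        unfolding S_kernel_at_integer(2)[OF c lt[OF ij(1) r]] tail_kernel_def p_vec_def q_vec_def
          True[symmetric] divided_difference_identity_diag[OF ne[OF ij(1) r], symmetric]
        by simp
    qed
    finally show ?thesis by simp
  next
    case False
    let ?m = "real_of_int (freq N i)" and ?n = "real_of_int (freq N j)"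
    have mn: "?m \<noteq> ?n" using False by (simp add: freq_def)
    have diff: "psi_arch c T' x - psi_arch c T x =
        1 / pi\<^sup>2 * integral {T..T'} (\<lambda>r. h_plus r * S_kernel r x (ln c))" for x
    proof -
      have "psi_arch c T' x - psi_arch c T x =
        1 / (2 * pi\<^sup>2) * (integral {- T'..T'} (\<lambda>r. h_plus r * S_kernel r x (ln c))
          - integral {- T..T} (\<lambda>r. h_plus r * S_kernel r x (ln c)))"
        by (simp add: psi_arch_def right_diff_distrib)
      also have "\<dots> = 1 / (2 * pi\<^sup>2) * (2 * integral {T..T'} (\<lambda>r. h_plus r * S_kernel r x (ln c)))"
        by (subst integral_even_annulus)
           (use T T0 in \<open>auto intro!: continuous_intros simp: h_plus_minus S_kernel_minus\<close>)
      finally show ?thesis by simp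
    qed
    have "Q_arch c N T' $$ (i, j) - Q_arch c N T $$ (i, j) =
        ((psi_arch c T' ?m - psi_arch c T ?m) - (psi_arch c T' ?n - psi_arch c T ?n)) / (?m - ?n)"
      using ij False by (simp add: Q_arch_def Q_mat_def Let_def diff_divide_distrib)
    also have "\<dots> = 1 / pi\<^sup>2 * ((integral {T..T'} (\<lambda>r. h_plus r * S_kernel r ?m (ln c))
        - integral {T..T'} (\<lambda>r. h_plus r * S_kernel r ?n (ln c))) * (1 / (?m - ?n)))"
      unfolding diff by (simp add: right_diff_distrib diff_divide_distrib)
    also have "(integral {T..T'} (\<lambda>r. h_plus r * S_kernel r ?m (ln c))
        - integral {T..T'} (\<lambda>r. h_plus r * S_kernel r ?n (ln c))) * (1 / (?m - ?n)) =
        integral {T..T'} (\<lambda>r. (h_plus r * S_kernel r ?m (ln c) - h_plus r * S_kernel r ?n (ln c)) * (1 / (?m - ?n)))"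
      by (simp only: Henstock_Kurzweil_Integration.integral_mult_left Henstock_Kurzweil_Integration.integral_diff[OF int int])
    also have "\<dots> = integral {T..T'} (\<lambda>r. tail_kernel c r (freq N i) (freq N j))"
    proof (rule Henstock_Kurzweil_Integration.integral_cong)
      fix r assume r: "r \<in> {T..T'}"
      show "(h_plus r * S_kernel r ?m (ln c) - h_plus r * S_kernel r ?n (ln c)) * (1 / (?m - ?n))
          = tail_kernel c r (freq N i) (freq N j)"
        unfolding S_kernel_at_integer(1)[OF c lt[OF ij(1) r]] S_kernel_at_integer(1)[OF c lt[OF ij(2) r]]
          tail_kernel_def p_vec_def q_vec_def
          divided_difference_identity[OF ne[OF ij(1) r] ne[OF ij(2) r] mn, symmetric]
        by (simp add: algebra_simps diff_divide_distrib)
    qed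
    finally show ?thesis .
  qed
qed

section \<open>Improper integrals dominated by ln r / r^2\<close>

lemma improper_FTC:
  fixes F f :: "real \<Rightarrow> real"
  assumes deriv: "\<And>r. r \<ge> a \<Longrightarrow> (F has_real_derivative f r) (at r)"
    and nonneg: "\<And>r. r \<ge> a \<Longrightarrow> f r \<ge> 0" and lim: "(F \<longlongrightarrow> l) at_top"
  shows "(f has_integral (l - F a)) {a..}"
proof -
  have ftc: "(f has_integral (F y - F a)) {a..y}" if "a \<le> y" for y
    using that by (intro fundamental_theorem_of_calculus)
      (auto intro!: DERIV_subset[OF deriv] simp: has_real_derivative_iff_has_vector_derivative[symmetric])
  show ?thesis
  proof (rule has_integral_to_inf)
    show "f integrable_on {a..y}" for y
      using ftc[of y] by (cases "a \<le> y") auto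
    have "((\<lambda>y. F y - F a) \<longlongrightarrow> l - F a) at_top" by (intro tendsto_intros lim)
    moreover have "\<forall>\<^sub>F y in at_top. F y - F a = integral {a..y} f"
      by (rule eventually_mono[OF eventually_ge_at_top[of a]]) (simp add: integral_unique[OF ftc])
    ultimately show "((\<lambda>y. integral {a..y} f) \<longlongrightarrow> l - F a) at_top"
      by (rule Lim_transform_eventually)
  qed (use nonneg in auto)
qed

lemma has_integral_ln_over_square:
  fixes T :: real
  assumes "T \<ge> 1"
  shows "((\<lambda>r. ln r / r\<^sup>2) has_integral (ln T + 1) / T) {T..}"
proof -
  have "((\<lambda>r. ln r / r\<^sup>2) has_integral (0 - (- ((ln T + 1) / T)))) {T..}"
  proof (rule improper_FTC[where F = "\<lambda>r. - ((ln r + 1) / r)"])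
    fix r assume "T \<le> r"
    then show "((\<lambda>r. - ((ln r + 1) / r)) has_real_derivative ln r / r\<^sup>2) (at r)"
      using assms by (auto intro!: derivative_eq_intros simp: power2_eq_square field_simps)
  next
    show "((\<lambda>r::real. - ((ln r + 1) / r)) \<longlongrightarrow> 0) at_top" by real_asymp
  qed (use assms in auto)
  then show ?thesis by simp
qed

text \<open>
  All the improper integrals below have integrands of the order \<open>ln r / r\<^sup>2\<close>, whose integral over
  \<open>{T..}\<close> is \<open>(ln T + 1) / T\<close>. The domination gives integrability, and the part beyond \<open>T'\<close> tends
  to \<open>0\<close>.
\<close>

lemma ln_over_square_dominated:
  fixes f :: "real \<Rightarrow> real"
  assumes T: "T \<ge> 1" and cont: "continuous_on {T..} f"
    and bound: "\<And>r. r \<ge> T \<Longrightarrow> \<bar>f r\<bar> \<le> C * (ln r / r\<^sup>2)"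
  shows "f integrable_on {T..}"
    and "T \<le> T' \<Longrightarrow> integral {T..T'} f + integral {T'..} f = integral {T..} f"
    and "((\<lambda>T'. integral {T..T'} f) \<longlongrightarrow> integral {T..} f) at_top"
proof -
  have dom: "f integrable_on {S..}" "\<bar>integral {S..} f\<bar> \<le> C * ((ln S + 1) / S)" if S: "T \<le> S" for S
  proof -
    have meas: "f \<in> borel_measurable (lebesgue_on {S..})"
      by (rule continuous_imp_measurable_on_sets_lebesgue[OF continuous_on_subset[OF cont]]) (use S in auto)
    have g: "((\<lambda>r. C * (ln r / r\<^sup>2)) has_integral C * ((ln S + 1) / S)) {S..}"
      using S T by (intro has_integral_mult_right has_integral_ln_over_square) simp
    show "f integrable_on {S..}"
      by (rule measurable_bounded_by_integrable_imp_integrable[OF meas has_integral_integrable[OF g]])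
        (use bound S in auto)
    show "\<bar>integral {S..} f\<bar> \<le> C * ((ln S + 1) / S)"
      using integral_norm_bound_integral'[OF _ meas _ g] bound S by auto
  qed
  show "f integrable_on {T..}" by (rule dom) simp
  have split: "integral {T..T'} f + integral {T'..} f = integral {T..} f" if T': "T \<le> T'" for T'
  proof -
    have "f integrable_on {T..T'}"
      by (intro integrable_continuous_interval continuous_on_subset[OF cont]) auto
    then have "(f has_integral (integral {T..T'} f + integral {T'..} f)) ({T..T'} \<union> {T'..})"
      using T' by (intro has_integral_Un integrable_integral dom)
        (auto simp: Int_atLeastAtMostR1 intro!: negligible_subset[of "{T'}"])
    moreover have "{T..T'} \<union> {T'..} = {T..}" using T' by auto
    ultimately show ?thesis by (simp add: integral_unique)
  qed
  then show "T \<le> T' \<Longrightarrow> integral {T..T'} f + integral {T'..} f = integral {T..} f" .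
  have "((\<lambda>T'. C * ((ln T' + 1) / T')) \<longlongrightarrow> 0) at_top" by real_asymp
  then have "((\<lambda>T'. integral {T'..} f) \<longlongrightarrow> 0) at_top"
    by (rule Lim_null_comparison[rotated])
       (rule eventually_mono[OF eventually_ge_at_top[of T]], use dom in simp)
  from tendsto_diff[OF tendsto_const[of "integral {T..} f"] this]
  have "((\<lambda>T'. integral {T..} f - integral {T'..} f) \<longlongrightarrow> integral {T..} f) at_top" by simp
  then show "((\<lambda>T'. integral {T..T'} f) \<longlongrightarrow> integral {T..} f) at_top"
    by (rule Lim_transform_eventually)
       (rule eventually_mono[OF eventually_ge_at_top[of T]], use split in \<open>simp add: algebra_simps\<close>)
qed


section \<open>The quadratic form of the matrix tail\<close>

lemma p_q_vec_bound:
  assumes c: "c > 1" and n: "\<bar>real_of_int n\<bar> \<le> real N" and r: "r > rho c * real N"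
  shows "\<bar>p_vec c r n\<bar> \<le> rho c / (r - rho c * real N)" "\<bar>q_vec c r n\<bar> \<le> rho c / (r - rho c * real N)"
    "r / rho c - real_of_int n > 0" "r / rho c + real_of_int n > 0"
proof -
  have R: "rho c > 0" by (rule rho_pos[OF c])
  have d: "0 < (r - rho c * real N) / rho c" using R r by simp
  have le: "(r - rho c * real N) / rho c \<le> r / rho c - real_of_int n"
    "(r - rho c * real N) / rho c \<le> r / rho c + real_of_int n"
    using n R by (auto simp: diff_divide_distrib)
  then show pos: "r / rho c - real_of_int n > 0" "r / rho c + real_of_int n > 0" using d by linarith+
  have "1 / y \<le> rho c / (r - rho c * real N)" if "(r - rho c * real N) / rho c \<le> y" for y
  proof -
    have "y > 0" using d that by linarith
    then show ?thesis using divide_left_mono[OF that, of 1] mult_pos_pos[OF _ d, of y] by simp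
  qed
  from this[OF le(1)] this[OF le(2)]
  show "\<bar>p_vec c r n\<bar> \<le> rho c / (r - rho c * real N)" "\<bar>q_vec c r n\<bar> \<le> rho c / (r - rho c * real N)"
    using pos by (simp_all add: p_vec_def q_vec_def)
qed

lemma tail_kernel_bound:
  assumes c: "c > 1" and m: "\<bar>real_of_int m\<bar> \<le> real N" and n: "\<bar>real_of_int n\<bar> \<le> real N"
    and r: "r > rho c * real N" "r \<ge> 7"
  shows "\<bar>tail_kernel c r m n\<bar> \<le> 2 * rho c * (ln r / (r - rho c * real N)\<^sup>2)"
proof -
  have R: "rho c > 0" by (rule rho_pos[OF c])
  let ?b = "rho c / (r - rho c * real N)"
  have b: "0 \<le> ?b" using R r by simp
  have "\<bar>p_vec c r m * p_vec c r n\<bar> \<le> ?b * ?b" "\<bar>q_vec c r m * q_vec c r n\<bar> \<le> ?b * ?b"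
    unfolding abs_mult
    by (intro mult_mono p_q_vec_bound[OF c m r(1)] p_q_vec_bound[OF c n r(1)] b abs_ge_zero)+
  then have pq: "\<bar>p_vec c r m * p_vec c r n + q_vec c r m * q_vec c r n\<bar> \<le> 2 * ?b\<^sup>2"
    unfolding power2_eq_square by linarith
  have s: "\<bar>(sin (ln c * r / 2))\<^sup>2 / rho c\<bar> \<le> 1 / rho c"
    using R by (simp add: divide_right_mono abs_square_le_1)
  have h: "\<bar>h_plus r\<bar> \<le> ln r" using h_plus_pos[OF r(2)] h_plus_le_ln[OF r(2)] by simp
  have "\<bar>tail_kernel c r m n\<bar> \<le> ln r * (1 / rho c) * (2 * ?b\<^sup>2)"
    unfolding tail_kernel_def abs_mult
    using h s pq R r by (intro mult_mono) (auto simp: abs_mult)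
  also have "\<dots> = 2 * rho c * (ln r / (r - rho c * real N)\<^sup>2)"
    using R by (simp add: power_divide) (simp add: power2_eq_square)
  finally show ?thesis .
qed

lemma continuous_on_tail_kernel:
  assumes c: "c > 1" and m: "\<bar>real_of_int m\<bar> \<le> real N" and n: "\<bar>real_of_int n\<bar> \<le> real N"
    and S: "\<And>r. r \<in> S \<Longrightarrow> r > rho c * real N"
  shows "continuous_on S (\<lambda>r. tail_kernel c r m n)"
proof -
  have "rho c \<noteq> 0" using rho_pos[OF c] by simp
  moreover have "r / rho c - real_of_int m \<noteq> 0" "r / rho c + real_of_int m \<noteq> 0"
    "r / rho c - real_of_int n \<noteq> 0" "r / rho c + real_of_int n \<noteq> 0" if "r \<in> S" for r
    using p_q_vec_bound(3,4)[OF c m S[OF that]] p_q_vec_bound(3,4)[OF c n S[OF that]] by auto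
  ultimately show ?thesis
    unfolding tail_kernel_def p_vec_def q_vec_def by (intro continuous_intros) auto
qed

text \<open>
  On \<open>{T..}\<close> the quotient \<open>r / (r - \<rho> N)\<close> is at most its value at \<open>T\<close>. Replacing
  \<open>r - \<rho> N\<close> by a multiple of \<open>r\<close> in this way treats \<open>N = 0\<close> and \<open>N > 0\<close> alike.
\<close>

lemma tail_kernel_ln_over_square_bound:
  assumes c: "c > 1" and m: "\<bar>real_of_int m\<bar> \<le> real N" and n: "\<bar>real_of_int n\<bar> \<le> real N"
    and T: "T > rho c * real N" "T \<ge> 7" and r: "r \<ge> T"
  shows "\<bar>tail_kernel c r m n\<bar> \<le> (2 * rho c * (T / (T - rho c * real N))\<^sup>2) * (ln r / r\<^sup>2)"
proof -
  define A where "A = rho c * real N"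
  have R: "rho c > 0" by (rule rho_pos[OF c])
  have A: "0 \<le> A" "A < T" using R T by (simp_all add: A_def)
  have "A * T \<le> A * r" using A r by (intro mult_left_mono) auto
  then have "r * (T - A) \<le> T * (r - A)" by (simp add: algebra_simps)
  then have "1 / (r - A) \<le> T / (T - A) * (1 / r)"
    using A r T by (simp add: field_simps)
  then have "(1 / (r - A))\<^sup>2 \<le> (T / (T - A) * (1 / r))\<^sup>2"
    using A r by (intro power_mono) auto
  then have "ln r * (1 / (r - A))\<^sup>2 \<le> ln r * (T / (T - A) * (1 / r))\<^sup>2"
    using r T by (intro mult_left_mono) auto
  then have "2 * rho c * (ln r / (r - A)\<^sup>2) \<le> 2 * rho c * (ln r * (T / (T - A) * (1 / r))\<^sup>2)"
    using R by (intro mult_left_mono) (auto simp: power_divide)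
  also have "\<dots> = (2 * rho c * (T / (T - A))\<^sup>2) * (ln r / r\<^sup>2)"
    by (simp add: power_mult_distrib power_divide)
  finally show ?thesis
    using tail_kernel_bound[OF c m n, of r] T r by (simp add: A_def)
qed

lemma tail_kernel_integral:
  assumes c: "c > 1" and m: "\<bar>real_of_int m\<bar> \<le> real N" and n: "\<bar>real_of_int n\<bar> \<le> real N"
    and T: "T > rho c * real N" "T \<ge> 7"
  shows "(\<lambda>r. tail_kernel c r m n) integrable_on {T..}"
    "((\<lambda>T'. integral {T..T'} (\<lambda>r. tail_kernel c r m n)) \<longlongrightarrow> integral {T..} (\<lambda>r. tail_kernel c r m n)) at_top"
  using ln_over_square_dominated(1,3)[OF _ continuous_on_tail_kernel[OF c m n]
      tail_kernel_ln_over_square_bound[OF c m n T], of T] T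
  by auto

lemma Q_carrier:
  "Q_tot c N T \<in> carrier_mat (2 * N + 1) (2 * N + 1)"
  "Q_inf c N \<in> carrier_mat (2 * N + 1) (2 * N + 1)"
  "Q_arch c N T \<in> carrier_mat (2 * N + 1) (2 * N + 1)"
  by (auto intro!: carrier_matI
      simp: Q_tot_def Q_inf_def Q_prime_def Q_pole_def Q_arch_def Q_arch_inf_def Q_mat_def)

lemma Q_mat_symmetric: "i < 2 * N + 1 \<Longrightarrow> j < 2 * N + 1 \<Longrightarrow> Q_mat N \<psi> $$ (i, j) = Q_mat N \<psi> $$ (j, i)"
proof -
  have swap: "(\<psi> m - \<psi> n) / (m - n) = (\<psi> n - \<psi> m) / (n - m)" for m n
    using minus_divide_divide[of "\<psi> m - \<psi> n" "m - n"] by simp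
  assume ij: "i < 2 * N + 1" "j < 2 * N + 1"
  show ?thesis
  proof (cases "i = j")
    case False
    let ?m = "real_of_int (freq N i)" and ?n = "real_of_int (freq N j)"
    have "Q_mat N \<psi> $$ (i, j) = (\<psi> ?m - \<psi> ?n) / (?m - ?n)" using False ij by (simp add: Q_mat_def Let_def)
    also have "\<dots> = (\<psi> ?n - \<psi> ?m) / (?n - ?m)" by (rule swap)
    also have "\<dots> = Q_mat N \<psi> $$ (j, i)" using False ij by (simp add: Q_mat_def Let_def)
    finally show ?thesis .
  qed simp
qed

lemma Q_tot_symmetric: "transpose_mat (Q_tot c N T) = Q_tot c N T"
proof (rule eq_matI)
  fix i j assume "i < dim_row (Q_tot c N T)" "j < dim_col (Q_tot c N T)"
  then have ij: "i < 2 * N + 1" "j < 2 * N + 1"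
    by (auto simp: Q_tot_def Q_prime_def Q_pole_def Q_arch_def Q_mat_def)
  have dims: "dim_row (Q_mat N \<psi>) = 2 * N + 1" "dim_col (Q_mat N \<psi>) = 2 * N + 1" for \<psi>
    by (simp_all add: Q_mat_def)
  show "transpose_mat (Q_tot c N T) $$ (i, j) = Q_tot c N T $$ (i, j)"
    using ij Q_mat_symmetric[OF ij]
    by (simp add: Q_tot_def Q_prime_def Q_pole_def Q_arch_def dims)
qed (simp_all add: Q_tot_def Q_prime_def Q_pole_def Q_arch_def Q_mat_def)

lemma Q_arch_inf_symmetric:
  "i < 2 * N + 1 \<Longrightarrow> j < 2 * N + 1 \<Longrightarrow> Q_arch_inf c N $$ (i, j) = Q_arch_inf c N $$ (j, i)"
  using Q_mat_symmetric[of i N j] by (simp add: Q_arch_inf_def Q_arch_def)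

lemma Q_inf_symmetric: "transpose_mat (Q_inf c N) = Q_inf c N"
proof (rule eq_matI)
  fix i j assume "i < dim_row (Q_inf c N)" "j < dim_col (Q_inf c N)"
  then have ij: "i < 2 * N + 1" "j < 2 * N + 1" by (auto simp: Q_inf_def Q_arch_inf_def)
  have dims: "dim_row (Q_mat N \<psi>) = 2 * N + 1" "dim_col (Q_mat N \<psi>) = 2 * N + 1"
    "dim_row (Q_arch_inf c N) = 2 * N + 1" "dim_col (Q_arch_inf c N) = 2 * N + 1" for \<psi>
    by (simp_all add: Q_mat_def Q_arch_inf_def)
  show "transpose_mat (Q_inf c N) $$ (i, j) = Q_inf c N $$ (i, j)"
    using ij Q_mat_symmetric[OF ij] Q_arch_inf_symmetric[OF ij]
    by (simp add: Q_inf_def Q_prime_def Q_pole_def dims)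
qed (simp_all add: Q_inf_def Q_arch_inf_def)

text \<open>
  In \<open>Q_arch_increment\<close> the upper cutoff tends to infinity; this also shows that the entrywise
  limit in the definition of \<open>Q_arch_inf\<close> exists.
\<close>

lemma Q_inf_minus_Q_tot_index:
  assumes c: "c > 1" and T: "T > rho c * real N" "T \<ge> 7" and ij: "i < 2 * N + 1" "j < 2 * N + 1"
  shows "(Q_inf c N - Q_tot c N T) $$ (i, j) =
    1 / pi\<^sup>2 * integral {T..} (\<lambda>r. tail_kernel c r (freq N i) (freq N j))"
proof -
  let ?k = "\<lambda>r. tail_kernel c r (freq N i) (freq N j)"
  have "((\<lambda>T'. Q_arch c N T $$ (i, j) + 1 / pi\<^sup>2 * integral {T..T'} ?k)
      \<longlongrightarrow> Q_arch c N T $$ (i, j) + 1 / pi\<^sup>2 * integral {T..} ?k) at_top"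
    by (intro tendsto_intros tail_kernel_integral(2)[OF c abs_freq_le[OF ij(1)] abs_freq_le[OF ij(2)] T])
  then have "((\<lambda>T'. Q_arch c N T' $$ (i, j))
      \<longlongrightarrow> Q_arch c N T $$ (i, j) + 1 / pi\<^sup>2 * integral {T..} ?k) at_top"
  proof (rule Lim_transform_eventually)
    show "\<forall>\<^sub>F T' in at_top. Q_arch c N T $$ (i, j) + 1 / pi\<^sup>2 * integral {T..T'} ?k = Q_arch c N T' $$ (i, j)"
    proof (rule eventually_mono[OF eventually_ge_at_top[of T]])
      fix T' assume "T \<le> T'"
      from Q_arch_increment[OF c ij T(1) this]
      show "Q_arch c N T $$ (i, j) + 1 / pi\<^sup>2 * integral {T..T'} ?k = Q_arch c N T' $$ (i, j)"
        by linarith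
    qed
  qed
  then have "Q_arch_inf c N $$ (i, j) = Q_arch c N T $$ (i, j) + 1 / pi\<^sup>2 * integral {T..} ?k"
    using ij by (simp add: Q_arch_inf_def tendsto_Lim)
  then show ?thesis
    using ij by (simp add: Q_inf_def Q_tot_def Q_prime_def Q_pole_def Q_arch_def Q_mat_def Q_arch_inf_def)
qed

text \<open>
  The integrand of the quadratic form of the tail at \<open>x\<close>, written so that its sign and the use of
  Cauchy-Schwarz are visible.
\<close>

definition tail_form :: "real \<Rightarrow> nat \<Rightarrow> real vec \<Rightarrow> real \<Rightarrow> real" where
  "tail_form c N x r = h_plus r * ((sin (ln c * r / 2))\<^sup>2 / rho c) *
     ((\<Sum>i<2 * N + 1. p_vec c r (freq N i) * x $ i)\<^sup>2 + (\<Sum>i<2 * N + 1. q_vec c r (freq N i) * x $ i)\<^sup>2)"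

lemma tail_form_eq_kernel_sum:
  "tail_form c N x r =
    (\<Sum>i<2 * N + 1. \<Sum>j<2 * N + 1. tail_kernel c r (freq N i) (freq N j) * (x $ j * x $ i))"
proof -
  let ?w = "h_plus r * ((sin (ln c * r / 2))\<^sup>2 / rho c)"
  have sq: "?w * (\<Sum>i<2 * N + 1. u i * x $ i)\<^sup>2 =
      (\<Sum>i<2 * N + 1. \<Sum>j<2 * N + 1. ?w * (u i * u j) * (x $ j * x $ i))" for u :: "nat \<Rightarrow> real"
    unfolding power2_eq_square[of "sum _ _"] sum_product
    unfolding sum_distrib_left
    by (intro sum.cong refl) (simp add: mult_ac)
  show ?thesis
    unfolding tail_form_def distrib_left sq sum.distrib[symmetric] tail_kernel_def
    by (intro sum.cong refl) (simp add: distrib_right)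
qed

lemma tail_form_regular:
  assumes c: "c > 1" and T: "T > rho c * real N" "T \<ge> 7"
  shows "continuous_on {T..} (tail_form c N x)" "tail_form c N x integrable_on {T..}"
    "T \<le> T' \<Longrightarrow> integral {T..T'} (tail_form c N x) + integral {T'..} (tail_form c N x)
      = integral {T..} (tail_form c N x)"
proof -
  let ?n = "2 * N + 1"
  have eq: "tail_form c N x =
      (\<lambda>r. \<Sum>i<?n. \<Sum>j<?n. tail_kernel c r (freq N i) (freq N j) * (x $ j * x $ i))"
    by (rule ext) (rule tail_form_eq_kernel_sum)
  show cont: "continuous_on {T..} (tail_form c N x)"
    unfolding eq using T
    by (intro continuous_on_sum continuous_on_mult continuous_on_const
        continuous_on_tail_kernel[OF c abs_freq_le abs_freq_le]) auto
  let ?C = "2 * rho c * (T / (T - rho c * real N))\<^sup>2"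
  have bound: "\<bar>tail_form c N x r\<bar> \<le> (\<Sum>i<?n. \<Sum>j<?n. ?C * \<bar>x $ j * x $ i\<bar>) * (ln r / r\<^sup>2)"
    if r: "r \<ge> T" for r
  proof -
    have "\<bar>tail_form c N x r\<bar> \<le>
        (\<Sum>i<?n. \<Sum>j<?n. \<bar>tail_kernel c r (freq N i) (freq N j)\<bar> * \<bar>x $ j * x $ i\<bar>)"
      unfolding eq abs_mult[symmetric] by (intro order_trans[OF sum_abs] sum_mono) simp
    also have "\<dots> \<le> (\<Sum>i<?n. \<Sum>j<?n. (?C * (ln r / r\<^sup>2)) * \<bar>x $ j * x $ i\<bar>)"
      by (intro sum_mono mult_right_mono tail_kernel_ln_over_square_bound c T r abs_freq_le) auto
    also have "\<dots> = (\<Sum>i<?n. \<Sum>j<?n. ?C * \<bar>x $ j * x $ i\<bar>) * (ln r / r\<^sup>2)"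
      unfolding sum_distrib_right by (intro sum.cong refl) (simp add: mult_ac)
    finally show ?thesis .
  qed
  show "tail_form c N x integrable_on {T..}"
    "T \<le> T' \<Longrightarrow> integral {T..T'} (tail_form c N x) + integral {T'..} (tail_form c N x)
      = integral {T..} (tail_form c N x)"
    using ln_over_square_dominated(1,2)[OF _ cont bound] T by auto
qed

lemma Q_tail_quadratic_form:
  assumes c: "c > 1" and T: "T > rho c * real N" "T \<ge> 7" and x: "x \<in> carrier_vec (2 * N + 1)"
  shows "((Q_inf c N - Q_tot c N T) *\<^sub>v x) \<bullet> x = 1 / pi\<^sup>2 * integral {T..} (tail_form c N x)"
proof -
  let ?n = "2 * N + 1"
  let ?k = "\<lambda>i j r. tail_kernel c r (freq N i) (freq N j)"
  let ?D = "Q_inf c N - Q_tot c N T"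
  have D: "?D \<in> carrier_mat ?n ?n" by (rule minus_carrier_mat) (rule Q_carrier)
  have "(?D *\<^sub>v x) \<bullet> x = (\<Sum>i<?n. (\<Sum>j<?n. ?D $$ (i, j) * x $ j) * x $ i)"
    using D x by (simp add: scalar_prod_def atLeast0LessThan del: index_minus_mat)
  also have "\<dots> = (\<Sum>i<?n. \<Sum>j<?n. 1 / pi\<^sup>2 * (integral {T..} (?k i j) * (x $ j * x $ i)))"
    unfolding sum_distrib_right
    by (intro sum.cong refl) (simp add: Q_inf_minus_Q_tot_index[OF c T] mult_ac del: index_minus_mat)
  also have "\<dots> = 1 / pi\<^sup>2 * (\<Sum>i<?n. \<Sum>j<?n. integral {T..} (\<lambda>r. ?k i j r * (x $ j * x $ i)))"
    by (simp only: sum_distrib_left Henstock_Kurzweil_Integration.integral_mult_left)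
  also have "(\<Sum>i<?n. \<Sum>j<?n. integral {T..} (\<lambda>r. ?k i j r * (x $ j * x $ i))) =
      integral {T..} (\<lambda>r. \<Sum>i<?n. \<Sum>j<?n. ?k i j r * (x $ j * x $ i))"
    by (subst Henstock_Kurzweil_Integration.integral_sum,
        auto intro!: Henstock_Kurzweil_Integration.integrable_sum integrable_on_mult_left
          tail_kernel_integral(1)[OF c abs_freq_le abs_freq_le T] sum.cong simp del: sum.lessThan_Suc)
       (subst Henstock_Kurzweil_Integration.integral_sum,
        auto intro!: integrable_on_mult_left
          tail_kernel_integral(1)[OF c abs_freq_le abs_freq_le T] simp del: sum.lessThan_Suc)
  also have "(\<lambda>r. \<Sum>i<?n. \<Sum>j<?n. ?k i j r * (x $ j * x $ i)) = tail_form c N x"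
    by (rule ext) (rule tail_form_eq_kernel_sum[symmetric])
  finally show ?thesis .
qed

lemma tail_form_nonneg:
  assumes "c > 1" "r \<ge> 7"
  shows "tail_form c N x r \<ge> 0"
  unfolding tail_form_def using h_plus_pos[OF assms(2)] rho_pos[OF assms(1)]
  by (intro mult_nonneg_nonneg add_nonneg_nonneg) auto

lemma countable_sin_zeros:
  fixes L :: real
  assumes "L > 0"
  shows "countable {r. sin (L * r / 2) = 0}"
proof -
  have "{r. sin (L * r / 2) = 0} \<subseteq> range (\<lambda>k::int. 2 * (real_of_int k * pi) / L)"
  proof
    fix r assume "r \<in> {r. sin (L * r / 2) = 0}"
    then obtain k :: int where "L * r / 2 = real_of_int k * pi" by (auto simp: sin_zero_iff_int2)
    then have "r = 2 * (real_of_int k * pi) / L" using assms by (simp add: field_simps)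
    then show "r \<in> range (\<lambda>k::int. 2 * (real_of_int k * pi) / L)" by blast
  qed
  then show ?thesis by (rule countable_subset) simp
qed

text \<open>
  Multiplied by the common denominator, \<open>p_r \<cdot> x\<close> becomes a polynomial in \<open>a = r / \<rho>\<close>. Its value
  at the frequency belonging to a nonzero coordinate of \<open>x\<close> is that coordinate times a product of
  differences of distinct frequencies, so the polynomial is not zero and has finitely many roots.
\<close>

lemma countable_partial_fraction_zeros:
  assumes c: "c > 1" and x: "x \<in> carrier_vec (2 * N + 1)" "x \<noteq> 0\<^sub>v (2 * N + 1)"
  shows "countable {r. r > rho c * real N \<and> (\<Sum>i<2 * N + 1. p_vec c r (freq N i) * x $ i) = 0}"
proof -
  let ?n = "2 * N + 1"
  let ?f = "\<lambda>i. real_of_int (freq N i)"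
  have R: "rho c > 0" by (rule rho_pos[OF c])
  define P where "P = (\<Sum>i<?n. Polynomial.smult (x $ i) (\<Prod>k\<in>{..<?n} - {i}. [:- ?f k, 1:]))"
  have polyP: "poly P a = (\<Sum>i<?n. x $ i * (\<Prod>k\<in>{..<?n} - {i}. a - ?f k))" for a
    by (simp add: P_def poly_sum poly_prod del: sum.lessThan_Suc)
  obtain i where i: "i < ?n" "x $ i \<noteq> 0" using x by (auto simp: vec_eq_iff)
  have "poly P (?f i) = (\<Sum>j\<in>{i}. x $ j * (\<Prod>k\<in>{..<?n} - {j}. ?f i - ?f k))"
    unfolding polyP
  proof (rule sum.mono_neutral_right)
    show "\<forall>j\<in>{..<?n} - {i}. x $ j * (\<Prod>k\<in>{..<?n} - {j}. ?f i - ?f k) = 0"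
      using i by (auto intro!: prod_zero)
  qed (use i in auto)
  also have "\<dots> \<noteq> 0" using i by (auto simp: freq_def)
  finally have "P \<noteq> 0" by auto
  then have fin: "finite {a. poly P a = 0}" by (rule poly_roots_finite)
  have "{r. r > rho c * real N \<and> (\<Sum>i<?n. p_vec c r (freq N i) * x $ i) = 0}
      \<subseteq> (\<lambda>a. a * rho c) ` {a. poly P a = 0}"
  proof (clarify)
    fix r assume r: "r > rho c * real N" and z: "(\<Sum>i<?n. p_vec c r (freq N i) * x $ i) = 0"
    let ?a = "r / rho c"
    have nz: "?a - ?f i \<noteq> 0" if "i < ?n" for i
      using p_q_vec_bound(3)[OF c abs_freq_le[OF that] r] by simp
    have "poly P ?a = (\<Sum>i<?n. (\<Prod>k<?n. ?a - ?f k) * (p_vec c r (freq N i) * x $ i))"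
      unfolding polyP
    proof (rule sum.cong[OF refl])
      fix i assume "i \<in> {..<?n}"
      then have "(\<Prod>k<?n. ?a - ?f k) = (?a - ?f i) * (\<Prod>k\<in>{..<?n} - {i}. ?a - ?f k)"
        by (intro prod.remove) auto
      then show "x $ i * (\<Prod>k\<in>{..<?n} - {i}. ?a - ?f k) =
          (\<Prod>k<?n. ?a - ?f k) * (p_vec c r (freq N i) * x $ i)"
        using nz[of i] \<open>i \<in> {..<?n}\<close> by (simp add: p_vec_def)
    qed
    also have "\<dots> = (\<Prod>k<?n. ?a - ?f k) * (\<Sum>i<?n. p_vec c r (freq N i) * x $ i)"
      by (simp only: sum_distrib_left)
    finally have "poly P ?a = 0" using z by simp
    moreover have "r = ?a * rho c" using R by simp
    ultimately show "r \<in> (\<lambda>a. a * rho c) ` {a. poly P a = 0}" by blast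
  qed
  then show ?thesis using fin by (meson countable_finite countable_subset finite_imageI)
qed

text \<open>
  If the integral of the continuous nonnegative integrand were \<open>0\<close>, the integrand would vanish on
  the whole interval; but it vanishes only at the countably many zeros of the sine and of
  \<open>p_r \<cdot> x\<close>.
\<close>

lemma integral_tail_form_pos:
  assumes c: "c > 1" and T: "T > rho c * real N" "T \<ge> 7" "T < T'"
    and x: "x \<in> carrier_vec (2 * N + 1)" "x \<noteq> 0\<^sub>v (2 * N + 1)"
  shows "integral {T..T'} (tail_form c N x) > 0"
proof -
  have cont: "continuous_on {T..T'} (tail_form c N x)"
    by (rule continuous_on_subset[OF tail_form_regular(1)[OF c T(1,2)]]) auto
  have nonneg: "tail_form c N x r \<ge> 0" if "r \<in> {T..T'}" for r
    using tail_form_nonneg[OF c] T that by auto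
  have "integral {T..T'} (tail_form c N x) \<ge> 0"
    using nonneg by (intro Henstock_Kurzweil_Integration.integral_nonneg integrable_continuous_interval cont) auto
  moreover have "integral {T..T'} (tail_form c N x) \<noteq> 0"
  proof
    assume "integral {T..T'} (tail_form c N x) = 0"
    then have zero: "tail_form c N x r = 0" if "r \<in> {T..T'}" for r
      using integral_eq_0_iff[OF cont T(3) nonneg] that by simp
    let ?Z = "{r. sin (ln c * r / 2) = 0} \<union>
      {r. r > rho c * real N \<and> (\<Sum>i<2 * N + 1. p_vec c r (freq N i) * x $ i) = 0}"
    have "{T..T'} \<subseteq> ?Z"
    proof
      fix r assume r: "r \<in> {T..T'}"
      have "h_plus r \<noteq> 0" "rho c \<noteq> 0"
        using h_plus_pos[of r] rho_pos[OF c] r T by auto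
      then have "sin (ln c * r / 2) = 0 \<or> (\<Sum>i<2 * N + 1. p_vec c r (freq N i) * x $ i) = 0"
        using zero[OF r] unfolding tail_form_def by (simp add: add_nonneg_eq_0_iff) blast
      then show "r \<in> ?Z" using r T by auto
    qed
    moreover have "countable ?Z"
      using countable_sin_zeros[of "ln c"] countable_partial_fraction_zeros[OF c x] c by simp
    ultimately have "countable {T..T'}" by (rule countable_subset)
    then show False using T(3) uncountable_closed_interval by blast
  qed
  ultimately show ?thesis by simp
qed

lemma integral_tail_form_strict_decreasing:
  assumes c: "c > 1" and T: "T > rho c * real N" "T \<ge> 7" "T < T'"
    and x: "x \<in> carrier_vec (2 * N + 1)" "x \<noteq> 0\<^sub>v (2 * N + 1)"
  shows "integral {T'..} (tail_form c N x) < integral {T..} (tail_form c N x)"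
  using integral_tail_form_pos[OF assms] tail_form_regular(3)[OF c T(1,2), of T' x] T(3) by simp

lemma integral_tail_form_nonneg:
  assumes c: "c > 1" and T: "T > rho c * real N" "T \<ge> 7"
  shows "integral {T..} (tail_form c N x) \<ge> 0"
  using tail_form_nonneg[OF c] T
  by (intro Henstock_Kurzweil_Integration.integral_nonneg tail_form_regular(2)[OF c T]) auto

text \<open>
  The trace of the integrand of the matrix tail; its integral is \<open>B_tail\<close> up to the factor
  \<open>1 / \<pi>\<^sup>2\<close>.
\<close>

definition tail_trace :: "real \<Rightarrow> nat \<Rightarrow> real \<Rightarrow> real" where
  "tail_trace c N r = (\<Sum>i<2 * N + 1. tail_kernel c r (freq N i) (freq N i))"

lemma L2_set_freq: "(L2_set f {- int N..int N})\<^sup>2 = (\<Sum>i<2 * N + 1. (f (freq N i))\<^sup>2)"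
proof -
  have "(L2_set f {- int N..int N})\<^sup>2 = (\<Sum>k\<in>{- int N..int N}. (f k)\<^sup>2)"
    unfolding L2_set_def by (simp add: sum_nonneg)
  also have "\<dots> = (\<Sum>i<2 * N + 1. (f (freq N i))\<^sup>2)"
    by (rule sum.reindex_bij_witness[of _ "freq N" "\<lambda>k. nat (k + int N)"]) (auto simp: freq_def)
  finally show ?thesis .
qed

lemma tail_trace_alt:
  "tail_trace c N r = h_plus r * ((sin (ln c * r / 2))\<^sup>2 / rho c) *
     ((L2_set (p_vec c r) {- int N..int N})\<^sup>2 + (L2_set (q_vec c r) {- int N..int N})\<^sup>2)"
  unfolding L2_set_freq tail_trace_def tail_kernel_def sum_distrib_left[symmetric] sum.distrib
  by (simp add: power2_eq_square del: sum.lessThan_Suc)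

lemma B_tail_eq: "B_tail c N T = 1 / pi\<^sup>2 * integral {T..} (tail_trace c N)"
  unfolding B_tail_def tail_trace_alt ..

lemma tail_trace_integrable:
  assumes c: "c > 1" and T: "T > rho c * real N" "T \<ge> 7"
  shows "tail_trace c N integrable_on {T..}"
  unfolding tail_trace_def
  by (intro Henstock_Kurzweil_Integration.integrable_sum tail_kernel_integral(1)[OF c abs_freq_le abs_freq_le T]) auto

lemma tail_form_le_trace:
  assumes c: "c > 1" and r: "r \<ge> 7" and x: "x \<in> carrier_vec (2 * N + 1)"
  shows "tail_form c N x r \<le> tail_trace c N r * (x \<bullet> x)"
proof -
  let ?n = "2 * N + 1"
  have xx: "x \<bullet> x = (\<Sum>i<?n. (x $ i)\<^sup>2)"
    using x by (simp add: scalar_prod_def atLeast0LessThan power2_eq_square)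
  have "tail_form c N x r \<le> h_plus r * ((sin (ln c * r / 2))\<^sup>2 / rho c) *
      ((\<Sum>i<?n. (p_vec c r (freq N i))\<^sup>2) * (x \<bullet> x) + (\<Sum>i<?n. (q_vec c r (freq N i))\<^sup>2) * (x \<bullet> x))"
    unfolding tail_form_def xx using h_plus_pos[OF r] rho_pos[OF c]
    by (intro mult_left_mono add_mono Cauchy_Schwarz_ineq_sum) auto
  also have "\<dots> = tail_trace c N r * (x \<bullet> x)"
    unfolding tail_trace_alt L2_set_freq by (simp add: algebra_simps del: sum.lessThan_Suc)
  finally show ?thesis .
qed

lemma integral_tail_form_le:
  assumes c: "c > 1" and T: "T > rho c * real N" "T \<ge> 7" and x: "x \<in> carrier_vec (2 * N + 1)"
  shows "1 / pi\<^sup>2 * integral {T..} (tail_form c N x) \<le> B_tail c N T * (x \<bullet> x)"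
proof -
  have "integral {T..} (tail_form c N x) \<le> integral {T..} (\<lambda>r. tail_trace c N r * (x \<bullet> x))"
    using tail_form_le_trace[OF c _ x] T
    by (intro integral_le tail_form_regular(2)[OF c T] integrable_on_mult_left tail_trace_integrable[OF c T]) auto
  then show ?thesis by (simp add: B_tail_eq divide_right_mono)
qed

lemma Q_tot_form:
  assumes c: "c > 1" and T: "T > rho c * real N" "T \<ge> 7" and x: "x \<in> carrier_vec (2 * N + 1)"
  shows "(Q_tot c N T *\<^sub>v x) \<bullet> x = (Q_inf c N *\<^sub>v x) \<bullet> x - 1 / pi\<^sup>2 * integral {T..} (tail_form c N x)"
  using Q_tail_quadratic_form[OF assms] quadratic_form_minus[OF Q_carrier(1,2) x] by simp

lemma Q_tot_form_strict_mono:
  assumes c: "c > 1" and T: "T > rho c * real N" "T \<ge> 7" "T < T'"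
    and x: "x \<in> carrier_vec (2 * N + 1)" "x \<noteq> 0\<^sub>v (2 * N + 1)"
  shows "(Q_tot c N T *\<^sub>v x) \<bullet> x < (Q_tot c N T' *\<^sub>v x) \<bullet> x"
  using integral_tail_form_strict_decreasing[OF assms] T
  by (simp add: Q_tot_form[OF c _ _ x(1)] divide_strict_right_mono)

lemma Q_tot_form_less_Q_inf:
  assumes c: "c > 1" and T: "T > rho c * real N" "T \<ge> 7"
    and x: "x \<in> carrier_vec (2 * N + 1)" "x \<noteq> 0\<^sub>v (2 * N + 1)"
  shows "(Q_tot c N T *\<^sub>v x) \<bullet> x < (Q_inf c N *\<^sub>v x) \<bullet> x"
proof -
  \<comment> \<open>Strictness comes from the interval \<open>{T..T + 1}\<close>; the rest of the tail is nonnegative.\<close>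
  have "(Q_tot c N T *\<^sub>v x) \<bullet> x < (Q_tot c N (T + 1) *\<^sub>v x) \<bullet> x"
    using T by (intro Q_tot_form_strict_mono c x) auto
  also have "\<dots> \<le> (Q_inf c N *\<^sub>v x) \<bullet> x"
    using T integral_tail_form_nonneg[OF c, of N "T + 1" x] by (simp add: Q_tot_form[OF c _ _ x(1)])
  finally show ?thesis .
qed

lemma Q_inf_form_le:
  assumes c: "c > 1" and T: "T > rho c * real N" "T \<ge> 7" and x: "x \<in> carrier_vec (2 * N + 1)"
  shows "(Q_inf c N *\<^sub>v x) \<bullet> x \<le> (Q_tot c N T *\<^sub>v x) \<bullet> x + B_tail c N T * (x \<bullet> x)"
  using integral_tail_form_le[OF assms] Q_tot_form[OF assms] by simp

section \<open>Size of the tail bound\<close>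

lemma tail_trace_bound:
  assumes c: "c > 1" and r: "r > rho c * real N" "r \<ge> 7"
  shows "tail_trace c N r \<le> 2 * (2 * real N + 1) * rho c * (ln r / (r - rho c * real N)\<^sup>2)"
proof -
  have "tail_trace c N r \<le> (\<Sum>i<2 * N + 1. 2 * rho c * (ln r / (r - rho c * real N)\<^sup>2))"
    unfolding tail_trace_def
  proof (rule sum_mono)
    fix i assume "i \<in> {..<2 * N + 1}"
    then have "\<bar>real_of_int (freq N i)\<bar> \<le> real N" by (intro abs_freq_le) simp
    then show "tail_kernel c r (freq N i) (freq N i) \<le> 2 * rho c * (ln r / (r - rho c * real N)\<^sup>2)"
      using tail_kernel_bound[OF c _ _ r] abs_le_D1 by blast
  qed
  also have "\<dots> = 2 * (2 * real N + 1) * rho c * (ln r / (r - rho c * real N)\<^sup>2)"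
  proof -
    have "real (2 * N + 1) = 2 * real N + 1" by simp
    then show ?thesis by (simp only: sum_constant card_lessThan mult_ac)
  qed
  finally show ?thesis .
qed

text \<open>
  A primitive is \<open>- ln r / (r - A) + 1 / A \<cdot> ln ((r - A) / r)\<close>, by parts and partial fractions.
\<close>

lemma has_integral_ln_over_shifted_square:
  fixes A T :: real
  assumes A: "0 < A" "A < T" and T: "T \<ge> 1"
  shows "((\<lambda>r. ln r / (r - A)\<^sup>2) has_integral (ln T / (T - A) + 1 / A * ln (T / (T - A)))) {T..}"
proof -
  let ?F = "\<lambda>r. - (ln r / (r - A)) + 1 / A * ln ((r - A) / r)"
  have "((\<lambda>r. ln r / (r - A)\<^sup>2) has_integral (0 - ?F T)) {T..}"
  proof (rule improper_FTC)
    fix r assume r: "T \<le> r"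
    have rA: "r - A > 0" "r > 0" using A T r by auto
    have "(?F has_real_derivative
        - ((1 / r * (r - A) - ln r * 1) / ((r - A) * (r - A))) + 1 / A * (((1 * r - (r - A) * 1) / (r * r)) / ((r - A) / r)))
        (at r)"
      using rA by (auto intro!: derivative_eq_intros)
    also have "- ((1 / r * (r - A) - ln r * 1) / ((r - A) * (r - A))) + 1 / A * (((1 * r - (r - A) * 1) / (r * r)) / ((r - A) / r))
        = ln r / (r - A)\<^sup>2"
      using rA A by (simp add: divide_simps) (simp add: power2_eq_square algebra_simps)
    finally show "(?F has_real_derivative ln r / (r - A)\<^sup>2) (at r)" .
  next
    show "(?F \<longlongrightarrow> 0) at_top" by real_asymp
  qed (use T in auto)
  moreover have "ln ((T - A) / T) = - ln (T / (T - A))"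
    using A T by (simp add: ln_div)
  ultimately show ?thesis by (simp add: add.commute)
qed

lemma B_tail_upper_bound:
  assumes c: "c > 1" and N: "N \<ge> 1" and T: "T > rho c * real N" "T \<ge> 7"
  shows "B_tail c N T \<le> 2 * (2 * real N + 1) * rho c / pi\<^sup>2 *
    (ln T / (T - rho c * real N) + 1 / (rho c * real N) * ln (T / (T - rho c * real N)))"
proof -
  let ?A = "rho c * real N" and ?K = "2 * (2 * real N + 1) * rho c"
  let ?I = "ln T / (T - ?A) + 1 / ?A * ln (T / (T - ?A))"
  have A: "?A > 0" using rho_pos[OF c] N by simp
  have "((\<lambda>r. ?K * (ln r / (r - ?A)\<^sup>2)) has_integral ?K * ?I) {T..}"
    using T by (intro has_integral_mult_right has_integral_ln_over_shifted_square A) auto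
  then have "integral {T..} (tail_trace c N) \<le> ?K * ?I"
    using T tail_trace_bound[OF c]
    by (intro has_integral_le[OF integrable_integral[OF tail_trace_integrable[OF c T]]]) auto
  then have "1 / pi\<^sup>2 * integral {T..} (tail_trace c N) \<le> 1 / pi\<^sup>2 * (?K * ?I)"
    by (intro mult_left_mono) auto
  then show ?thesis unfolding B_tail_eq by simp
qed

text \<open>
  The trace of the integrand without its oscillating factor \<open>1 - cos (L r)\<close>, relative to
  \<open>ln r / r\<^sup>2\<close>.
\<close>

definition tail_amplitude :: "real \<Rightarrow> nat \<Rightarrow> real \<Rightarrow> real" where
  "tail_amplitude c N r = h_plus r / ln r * (\<Sum>i<2 * N + 1.
     r\<^sup>2 / rho c * ((p_vec c r (freq N i))\<^sup>2 + (q_vec c r (freq N i))\<^sup>2) / 2)"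

lemma tail_trace_amplitude:
  assumes "r > 1"
  shows "tail_trace c N r = (1 - cos (ln c * r)) * tail_amplitude c N r * (ln r / r\<^sup>2)"
proof -
  have "2 * (sin (ln c * r / 2))\<^sup>2 = 1 - cos (ln c * r)"
    using cos_double_sin[of "ln c * r / 2"] by simp
  then have s: "(sin (ln c * r / 2))\<^sup>2 = (1 - cos (ln c * r)) / 2" by simp
  define S where "S = (\<Sum>i<2 * N + 1. (p_vec c r (freq N i))\<^sup>2 + (q_vec c r (freq N i))\<^sup>2)"
  have "tail_trace c N r = h_plus r * ((sin (ln c * r / 2))\<^sup>2 / rho c) * S"
    unfolding S_def tail_trace_def tail_kernel_def sum_distrib_left[symmetric]
    by (simp only: power2_eq_square[of "p_vec _ _ _"] power2_eq_square[of "q_vec _ _ _"])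
  moreover have "tail_amplitude c N r = h_plus r / ln r * (r\<^sup>2 / rho c * S / 2)"
    unfolding S_def tail_amplitude_def by (simp only: sum_distrib_left sum_divide_distrib)
  ultimately show ?thesis
    using assms unfolding s by (simp add: mult_ac)
qed

lemma h_plus_ratio: "((\<lambda>r. h_plus r / ln r) \<longlongrightarrow> 1) at_top"
proof -
  have "((\<lambda>r. h_plus r / ln r - ln (r / (2 * pi)) / ln r) \<longlongrightarrow> 0) at_top"
  proof (rule Lim_null_comparison)
    show "\<forall>\<^sub>F r in at_top. norm (h_plus r / ln r - ln (r / (2 * pi)) / ln r) \<le> 3 / r\<^sup>2 / ln r"
    proof (rule eventually_mono[OF eventually_ge_at_top[of 7]])
      fix r :: real assume r: "7 \<le> r"
      then have "ln r > 0" by simp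
      then show "norm (h_plus r / ln r - ln (r / (2 * pi)) / ln r) \<le> 3 / r\<^sup>2 / ln r"
        unfolding diff_divide_distrib[symmetric] real_norm_def abs_divide
        using h_plus_log_approx[OF r] by (simp add: divide_right_mono del: divide_divide_eq_left)
    qed
    show "((\<lambda>r::real. 3 / r\<^sup>2 / ln r) \<longlongrightarrow> 0) at_top" by real_asymp
  qed
  moreover have "((\<lambda>r. ln (r / (2 * pi)) / ln r) \<longlongrightarrow> 1) at_top" by real_asymp
  ultimately have "((\<lambda>r. (h_plus r / ln r - ln (r / (2 * pi)) / ln r) + ln (r / (2 * pi)) / ln r) \<longlongrightarrow> 0 + 1) at_top"
    by (rule tendsto_add)
  then show ?thesis by simp
qed

lemma tail_amplitude_limit:
  assumes c: "c > 1"
  shows "(tail_amplitude c N \<longlongrightarrow> (2 * real N + 1) * rho c) at_top"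
proof -
  define R where "R = rho c"
  have R: "R > 0" using rho_pos[OF c] by (simp add: R_def)
  have each: "((\<lambda>r. r\<^sup>2 / rho c * ((p_vec c r n)\<^sup>2 + (q_vec c r n)\<^sup>2) / 2) \<longlongrightarrow> rho c) at_top" for n
  proof -
    define y where "y = real_of_int n"
    have "((\<lambda>r. r\<^sup>2 / R * ((1 / (r / R - y))\<^sup>2 + (1 / (r / R + y))\<^sup>2) / 2) \<longlongrightarrow> R) at_top"
      using R by (real_asymp, simp add: power2_eq_square)
    then show ?thesis by (simp add: p_vec_def q_vec_def R_def y_def)
  qed
  have "(tail_amplitude c N \<longlongrightarrow> 1 * (\<Sum>i<2 * N + 1. rho c)) at_top"
    unfolding tail_amplitude_def by (intro tendsto_mult h_plus_ratio tendsto_sum each)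
  also have "1 * (\<Sum>i<2 * N + 1. rho c) = (2 * real N + 1) * rho c"
    by (simp del: sum.lessThan_Suc)
  finally show ?thesis .
qed

text \<open>
  Write the trace as \<open>(1 - cos (L r)) (K + o(1)) ln r / r\<^sup>2\<close>. The main part is replaced by the
  derivative \<open>F'\<close> of the function
  \<open>F r = - K (ln r + 1) / r - (K / L) sin (L r) ln r / r\<^sup>2\<close>. The difference is \<open>o(ln r / r\<^sup>2)\<close>, since
  differentiating the factor \<open>ln r / r\<^sup>2\<close> next to the sine gains a factor \<open>1 / r\<close>. So
  the integral is \<open>- F T\<close> up to \<open>o((ln T + 1) / T)\<close>, and the sine term of \<open>F\<close> is of lower order.
\<close>

lemma tail_trace_integral_asymptotics:
  assumes c: "c > 1"
  shows "((\<lambda>T. integral {T..} (tail_trace c N) * T / (ln T + 1)) \<longlongrightarrow> (2 * real N + 1) * rho c) at_top"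
proof -
  define L where "L = ln c"
  define K where "K = (2 * real N + 1) * rho c"
  define f where "f = tail_trace c N"
  define F where "F r = - (K * ((ln r + 1) / r)) - K / L * (sin (L * r) * (ln r / r\<^sup>2))" for r
  define F' where "F' r = K * (ln r / r\<^sup>2) - K * cos (L * r) * (ln r / r\<^sup>2)
    - K / L * sin (L * r) * ((1 - 2 * ln r) / r ^ 3)" for r
  have L: "L > 0" using c by (simp add: L_def)
  have dF: "(F has_real_derivative F' r) (at r)" if r: "r > 0" for r
    unfolding F_def F'_def using r L
    by (auto intro!: derivative_eq_intros simp: field_simps power2_eq_square power3_eq_cube)
  have e_eq: "f r - F' r = ((1 - cos (L * r)) * (tail_amplitude c N r - K)
      + sin (L * r) * (K / L * ((1 - 2 * ln r) / (r * ln r)))) * (ln r / r\<^sup>2)" if r: "r > 1" for r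
    unfolding f_def tail_trace_amplitude[OF r] F'_def L_def[symmetric]
    using r L by (simp add: field_simps power2_eq_square power3_eq_cube)
  have small: "\<forall>\<^sub>F r in at_top. \<bar>f r - F' r\<bar> \<le> \<epsilon> * (ln r / r\<^sup>2)" if \<epsilon>: "\<epsilon> > 0" for \<epsilon>
  proof -
    have "(tail_amplitude c N \<longlongrightarrow> K) at_top"
      unfolding K_def by (rule tail_amplitude_limit[OF c])
    then have "\<forall>\<^sub>F r in at_top. \<bar>tail_amplitude c N r - K\<bar> < \<epsilon> / 4"
      using tendstoD[where e = "\<epsilon> / 4"] \<epsilon> by (fastforce simp: dist_real_def)
    moreover have "((\<lambda>r. K / L * ((1 - 2 * ln r) / (r * ln r))) \<longlongrightarrow> 0) at_top" by real_asymp
    then have "\<forall>\<^sub>F r in at_top. \<bar>K / L * ((1 - 2 * ln r) / (r * ln r))\<bar> < \<epsilon> / 2"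
      using tendstoD[where e = "\<epsilon> / 2"] \<epsilon> by (fastforce simp: dist_real_def)
    ultimately show ?thesis
      using eventually_gt_at_top[of 1]
    proof eventually_elim
      case (elim r)
      have "\<bar>1 - cos (L * r)\<bar> \<le> 2" using cos_le_one[of "L * r"] cos_ge_minus_one[of "L * r"] by simp
      then have "\<bar>(1 - cos (L * r)) * (tail_amplitude c N r - K)\<bar> \<le> 2 * (\<epsilon> / 4)"
        unfolding abs_mult using elim(1) by (intro mult_mono) auto
      moreover have "\<bar>sin (L * r) * (K / L * ((1 - 2 * ln r) / (r * ln r)))\<bar> \<le> 1 * (\<epsilon> / 2)"
        unfolding abs_mult[of "sin _"] using elim(2) by (intro mult_mono) auto
      ultimately have "\<bar>(1 - cos (L * r)) * (tail_amplitude c N r - K)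
          + sin (L * r) * (K / L * ((1 - 2 * ln r) / (r * ln r)))\<bar> \<le> 2 * (\<epsilon> / 4) + 1 * (\<epsilon> / 2)"
        by (rule order_trans[OF abs_triangle_ineq add_mono])
      then have le: "\<bar>(1 - cos (L * r)) * (tail_amplitude c N r - K)
          + sin (L * r) * (K / L * ((1 - 2 * ln r) / (r * ln r)))\<bar> \<le> \<epsilon>"
        by simp
      have nn: "0 \<le> ln r / r\<^sup>2" using elim(3) by simp
      show ?case
        unfolding e_eq[OF elim(3)] abs_mult[of _ "ln r / r\<^sup>2"] abs_of_nonneg[OF nn]
        by (rule mult_right_mono[OF le nn])
    qed
  qed
  have limF: "(F \<longlongrightarrow> 0) at_top"
  proof (rule Lim_null_comparison)
    show "\<forall>\<^sub>F r in at_top. norm (F r) \<le> \<bar>K\<bar> * ((ln r + 1) / r) + \<bar>K / L\<bar> * (ln r / r\<^sup>2)"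
    proof (rule eventually_mono[OF eventually_ge_at_top[of 1]])
      fix r :: real assume r: "1 \<le> r"
      have "\<bar>sin (L * r) * (ln r / r\<^sup>2)\<bar> \<le> 1 * (ln r / r\<^sup>2)"
        unfolding abs_mult using r by (intro mult_mono) auto
      then have "\<bar>K / L * (sin (L * r) * (ln r / r\<^sup>2))\<bar> \<le> \<bar>K / L\<bar> * (ln r / r\<^sup>2)"
        unfolding abs_mult[of "K / L"] by (intro mult_left_mono) auto
      moreover have "\<bar>K * ((ln r + 1) / r)\<bar> = \<bar>K\<bar> * ((ln r + 1) / r)"
        using r by (simp add: abs_mult)
      ultimately show "norm (F r) \<le> \<bar>K\<bar> * ((ln r + 1) / r) + \<bar>K / L\<bar> * (ln r / r\<^sup>2)"
        unfolding F_def real_norm_def by linarith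
    qed
    show "((\<lambda>r. \<bar>K\<bar> * ((ln r + 1) / r) + \<bar>K / L\<bar> * (ln r / r\<^sup>2)) \<longlongrightarrow> 0) at_top" by real_asymp
  qed
  have ev_T: "\<forall>\<^sub>F T in at_top. T > rho c * real N \<and> T \<ge> 7"
    by (intro eventually_conj eventually_gt_at_top eventually_ge_at_top)
  have remainder: "\<forall>\<^sub>F T in at_top. \<bar>integral {T..} f + F T\<bar> \<le> \<epsilon> * ((ln T + 1) / T)" if \<epsilon>: "\<epsilon> > 0" for \<epsilon>
  proof -
    obtain T0 where T0: "\<And>r. r \<ge> T0 \<Longrightarrow> \<bar>f r - F' r\<bar> \<le> \<epsilon> * (ln r / r\<^sup>2)"
      using small[OF \<epsilon>] unfolding eventually_at_top_linorder by blast
    show ?thesis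
      using ev_T eventually_ge_at_top[of T0]
    proof eventually_elim
      case (elim T)
      then have T: "T > rho c * real N" "T \<ge> 7" "T \<ge> T0" by auto
      have cont: "continuous_on {T..} f"
        unfolding f_def tail_trace_def using T
        by (intro continuous_on_sum continuous_on_tail_kernel[OF c abs_freq_le abs_freq_le]) auto
      let ?g = "\<lambda>r. \<epsilon> * (ln r / r\<^sup>2)"
      have g: "(?g has_integral \<epsilon> * ((ln T + 1) / T)) {T..}"
        using T by (intro has_integral_mult_right has_integral_ln_over_square) auto
      have bound: "\<bar>integral {T..T'} f - (F T' - F T)\<bar> \<le> \<epsilon> * ((ln T + 1) / T)" if T': "T' \<ge> T" for T'
      proof -
        have f_int: "(f has_integral integral {T..T'} f) {T..T'}"
          by (intro integrable_integral integrable_continuous_interval continuous_on_subset[OF cont]) auto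
        have F_int: "(F' has_integral (F T' - F T)) {T..T'}"
          using T' T by (intro fundamental_theorem_of_calculus)
            (auto intro!: DERIV_subset[OF dF] simp: has_real_derivative_iff_has_vector_derivative[symmetric])
        have d: "((\<lambda>r. f r - F' r) has_integral (integral {T..T'} f - (F T' - F T))) {T..T'}"
          by (rule has_integral_diff[OF f_int F_int])
        have gi: "?g integrable_on {T..T'}"
          by (rule integrable_on_subinterval[OF has_integral_integrable[OF g]]) auto
        have "norm (integral {T..T'} (\<lambda>r. f r - F' r)) \<le> integral {T..T'} ?g"
          by (rule Henstock_Kurzweil_Integration.integral_norm_bound_integral[OF has_integral_integrable[OF d] gi]) (use T0 T in auto)
        also have "\<dots> \<le> integral {T..} ?g"
          using T \<epsilon> by (intro integral_subset_le gi has_integral_integrable[OF g]) auto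
        also have "\<dots> = \<epsilon> * ((ln T + 1) / T)" using g by (rule integral_unique)
        finally show ?thesis using integral_unique[OF d] by simp
      qed
      have "((\<lambda>T'. integral {T..T'} f) \<longlongrightarrow> integral {T..} f) at_top"
      proof -
        have "\<bar>f r\<bar> \<le> (\<Sum>i<2 * N + 1. 2 * rho c * (T / (T - rho c * real N))\<^sup>2) * (ln r / r\<^sup>2)" if "r \<ge> T" for r
          unfolding f_def tail_trace_def sum_distrib_right
          by (intro order_trans[OF sum_abs] sum_mono tail_kernel_ln_over_square_bound[OF c abs_freq_le abs_freq_le T(1,2) that]) auto
        then show ?thesis using T by (intro ln_over_square_dominated(3)[OF _ cont]) auto
      qed
      then have "((\<lambda>T'. \<bar>integral {T..T'} f - (F T' - F T)\<bar>) \<longlongrightarrow> \<bar>integral {T..} f - (0 - F T)\<bar>) at_top"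
        by (intro tendsto_intros limF)
      then have "\<bar>integral {T..} f - (0 - F T)\<bar> \<le> \<epsilon> * ((ln T + 1) / T)"
        by (rule tendsto_upperbound)
           (rule eventually_mono[OF eventually_ge_at_top[of T]], rule bound, assumption, simp)
      then show ?case by simp
    qed
  qed
  have lim0: "((\<lambda>T. (integral {T..} f + F T) * T / (ln T + 1)) \<longlongrightarrow> 0) at_top"
  proof (rule tendstoI)
    fix e :: real assume e: "e > 0"
    show "\<forall>\<^sub>F T in at_top. dist ((integral {T..} f + F T) * T / (ln T + 1)) 0 < e"
      using remainder[OF half_gt_zero[OF e]] eventually_gt_at_top[of 1]
    proof eventually_elim
      case (elim T)
      have pos: "T / (ln T + 1) > 0" using elim(2) by (intro divide_pos_pos add_pos_pos) auto
      have "\<bar>(integral {T..} f + F T) * (T / (ln T + 1))\<bar> \<le> e / 2 * ((ln T + 1) / T) * (T / (ln T + 1))"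
        unfolding abs_mult using elim e pos by (intro mult_mono) auto
      also have "\<dots> = e / 2"
      proof -
        have "ln T + 1 \<noteq> 0" using ln_gt_zero[OF elim(2)] by linarith
        then have "(ln T + 1) / T * (T / (ln T + 1)) = 1" using elim(2) by simp
        then show ?thesis by (simp only: mult.assoc mult_1_right)
      qed
      also have "\<dots> < e" using e by simp
      finally show ?case by simp
    qed
  qed
  have limF2: "((\<lambda>T. - F T * T / (ln T + 1)) \<longlongrightarrow> K) at_top"
  proof -
    have "((\<lambda>T. K / L * (sin (L * T) * (ln T / (T * (ln T + 1))))) \<longlongrightarrow> K / L * 0) at_top"
    proof (intro tendsto_mult tendsto_const)
      show "((\<lambda>T. sin (L * T) * (ln T / (T * (ln T + 1)))) \<longlongrightarrow> 0) at_top"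
      proof (rule Lim_null_comparison)
        show "\<forall>\<^sub>F T in at_top. norm (sin (L * T) * (ln T / (T * (ln T + 1)))) \<le> \<bar>ln T / (T * (ln T + 1))\<bar>"
        proof (intro always_eventually allI)
          fix T
          have "\<bar>sin (L * T)\<bar> * \<bar>ln T / (T * (ln T + 1))\<bar> \<le> 1 * \<bar>ln T / (T * (ln T + 1))\<bar>"
            by (intro mult_right_mono abs_sin_le_one abs_ge_zero)
          then show "norm (sin (L * T) * (ln T / (T * (ln T + 1)))) \<le> \<bar>ln T / (T * (ln T + 1))\<bar>"
            by (simp only: real_norm_def abs_mult[of "sin _"] mult_1)
        qed
        show "((\<lambda>T::real. \<bar>ln T / (T * (ln T + 1))\<bar>) \<longlongrightarrow> 0) at_top" by real_asymp
      qed
    qed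
    from tendsto_add[OF tendsto_const[of K] this]
    have "((\<lambda>T. K + K / L * (sin (L * T) * (ln T / (T * (ln T + 1))))) \<longlongrightarrow> K) at_top" by simp
    then show ?thesis
    proof (rule Lim_transform_eventually)
      show "\<forall>\<^sub>F T in at_top. K + K / L * (sin (L * T) * (ln T / (T * (ln T + 1)))) = - F T * T / (ln T + 1)"
      proof (rule eventually_mono[OF eventually_gt_at_top[of 1]])
        fix T :: real assume T: "1 < T"
        then have "ln T + 1 \<noteq> 0" using ln_gt_zero[OF T] by linarith
        then show "K + K / L * (sin (L * T) * (ln T / (T * (ln T + 1)))) = - F T * T / (ln T + 1)"
          using T by (simp add: F_def divide_simps power2_eq_square)
      qed
    qed
  qed
  from tendsto_add[OF lim0 limF2]
  have "((\<lambda>T. (integral {T..} f + F T) * T / (ln T + 1) + - F T * T / (ln T + 1)) \<longlongrightarrow> K) at_top" by simp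
  moreover have "(integral {T..} f + F T) * T / (ln T + 1) + - F T * T / (ln T + 1)
      = integral {T..} f * T / (ln T + 1)" for T
    by (simp add: add_divide_distrib distrib_right)
  ultimately have "((\<lambda>T. integral {T..} f * T / (ln T + 1)) \<longlongrightarrow> K) at_top"
    by (simp only:)
  then show ?thesis unfolding f_def K_def .
qed

lemma B_tail_normalized_limit:
  assumes c: "c > 1"
  shows "((\<lambda>T. B_tail c N T * T / (ln T + 1)) \<longlongrightarrow> (2 * real N + 1) * rho c / pi\<^sup>2) at_top"
  using tendsto_mult[OF tendsto_const[of "1 / pi\<^sup>2"] tail_trace_integral_asymptotics[OF c, of N]]
  by (simp add: B_tail_eq mult.assoc)

lemma B_tail_tendsto_0:
  assumes c: "c > 1"
  shows "(B_tail c N \<longlongrightarrow> 0) at_top"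
proof -
  have "((\<lambda>T::real. (ln T + 1) / T) \<longlongrightarrow> 0) at_top" by real_asymp
  from tendsto_mult[OF B_tail_normalized_limit[OF c, of N] this]
  have "((\<lambda>T. B_tail c N T * T / (ln T + 1) * ((ln T + 1) / T)) \<longlongrightarrow> 0) at_top" by simp
  then show ?thesis
  proof (rule Lim_transform_eventually)
    show "\<forall>\<^sub>F T in at_top. B_tail c N T * T / (ln T + 1) * ((ln T + 1) / T) = B_tail c N T"
    proof (rule eventually_mono[OF eventually_gt_at_top[of 1]])
      fix T :: real assume T: "1 < T"
      then have "ln T + 1 \<noteq> 0" using ln_gt_zero[OF T] by linarith
      then show "B_tail c N T * T / (ln T + 1) * ((ln T + 1) / T) = B_tail c N T" using T by simp
    qed
  qed
qed

lemma B_tail_asymp_equiv: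
  assumes c: "c > 1"
  shows "B_tail c N \<sim>[at_top] (\<lambda>T. (2 * real N + 1) * rho c / (pi\<^sup>2 * T) * (ln (T / (2 * pi)) + 1))"
proof (rule asymp_equivI')
  let ?k = "(2 * real N + 1) * rho c / pi\<^sup>2"
  have k: "?k \<noteq> 0" using rho_pos[OF c] by simp
  have "((\<lambda>T. (ln T + 1) / (ln (T / (2 * pi)) + 1)) \<longlongrightarrow> 1) at_top" by real_asymp
  from tendsto_mult[OF tendsto_divide[OF B_tail_normalized_limit[OF c, of N] tendsto_const[of ?k] k] this]
  have "((\<lambda>T. B_tail c N T * T / (ln T + 1) / ?k * ((ln T + 1) / (ln (T / (2 * pi)) + 1))) \<longlongrightarrow> ?k / ?k * 1) at_top"
    .
  moreover have "?k / ?k * 1 = 1" using k by simp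
  ultimately have "((\<lambda>T. B_tail c N T * T / (ln T + 1) / ?k * ((ln T + 1) / (ln (T / (2 * pi)) + 1))) \<longlongrightarrow> 1) at_top"
    by (simp only:)
  then show "((\<lambda>T. B_tail c N T / ((2 * real N + 1) * rho c / (pi\<^sup>2 * T) * (ln (T / (2 * pi)) + 1))) \<longlongrightarrow> 1) at_top"
  proof (rule Lim_transform_eventually)
    show "\<forall>\<^sub>F T in at_top. B_tail c N T * T / (ln T + 1) / ?k * ((ln T + 1) / (ln (T / (2 * pi)) + 1))
        = B_tail c N T / ((2 * real N + 1) * rho c / (pi\<^sup>2 * T) * (ln (T / (2 * pi)) + 1))"
    proof (rule eventually_mono[OF eventually_gt_at_top[of 1]])
      fix T :: real assume T: "1 < T"
      then have "ln T + 1 \<noteq> 0" using ln_gt_zero[OF T] by linarith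
      then show "B_tail c N T * T / (ln T + 1) / ?k * ((ln T + 1) / (ln (T / (2 * pi)) + 1))
        = B_tail c N T / ((2 * real N + 1) * rho c / (pi\<^sup>2 * T) * (ln (T / (2 * pi)) + 1))"
        using T by simp
    qed
  qed
qed

lemma B_tail_doubling:
  assumes c: "c > 1"
  shows "((\<lambda>T. B_tail c N (2 * T) / B_tail c N T) \<longlongrightarrow> 1 / 2) at_top"
proof -
  let ?\<beta> = "\<lambda>T. B_tail c N T * T / (ln T + 1)"
  let ?k = "(2 * real N + 1) * rho c / pi\<^sup>2"
  have k: "?k \<noteq> 0" using rho_pos[OF c] by simp
  have "filterlim (\<lambda>T::real. 2 * T) at_top at_top" by real_asymp
  from tendsto_divide[OF filterlim_compose[OF B_tail_normalized_limit[OF c, of N] this]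
      B_tail_normalized_limit[OF c, of N] k]
  have "((\<lambda>T. ?\<beta> (2 * T) / ?\<beta> T) \<longlongrightarrow> ?k / ?k) at_top" .
  moreover have "((\<lambda>T::real. (ln (2 * T) + 1) / (2 * (ln T + 1))) \<longlongrightarrow> 1 / 2) at_top" by real_asymp
  ultimately have "((\<lambda>T. ?\<beta> (2 * T) / ?\<beta> T * ((ln (2 * T) + 1) / (2 * (ln T + 1)))) \<longlongrightarrow> ?k / ?k * (1 / 2)) at_top"
    by (rule tendsto_mult)
  moreover have "?k / ?k * (1 / 2) = 1 / 2" using k by simp
  ultimately have "((\<lambda>T. ?\<beta> (2 * T) / ?\<beta> T * ((ln (2 * T) + 1) / (2 * (ln T + 1)))) \<longlongrightarrow> 1 / 2) at_top"
    by (simp only:)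
  then show ?thesis
  proof (rule Lim_transform_eventually)
    show "\<forall>\<^sub>F T in at_top. ?\<beta> (2 * T) / ?\<beta> T * ((ln (2 * T) + 1) / (2 * (ln T + 1)))
        = B_tail c N (2 * T) / B_tail c N T"
    proof (rule eventually_mono[OF eventually_gt_at_top[of 1]])
      fix T :: real assume T: "1 < T"
      then have "ln T + 1 \<noteq> 0" "ln (2 * T) + 1 \<noteq> 0"
        using ln_gt_zero[OF T] ln_gt_zero[of "2 * T"] by linarith+
      then show "?\<beta> (2 * T) / ?\<beta> T * ((ln (2 * T) + 1) / (2 * (ln T + 1)))
        = B_tail c N (2 * T) / B_tail c N T"
        using T by simp
    qed
  qed
qed

section \<open>The even subspace and the comparison theorem\<close>

lemma even_compression_carrier:
  assumes "A \<in> carrier_mat (2 * N + 1) (2 * N + 1)"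
  shows "even_compression N A \<in> carrier_mat (N + 1) (N + 1)"
  using assms by (auto simp: even_compression_def even_basis_def intro!: carrier_matI)

lemma even_basis_carrier: "even_basis N \<in> carrier_mat (2 * N + 1) (N + 1)"
  by (simp add: even_basis_def)

lemma even_compression_symmetric:
  assumes A: "A \<in> carrier_mat (2 * N + 1) (2 * N + 1)" "transpose_mat A = A"
  shows "transpose_mat (even_compression N A) = even_compression N A"
proof -
  let ?V = "even_basis N"
  note V = even_basis_carrier[of N]
  have VT: "transpose_mat ?V \<in> carrier_mat (N + 1) (2 * N + 1)" using V by (rule transpose_carrier_mat[THEN iffD2])
  have "transpose_mat (transpose_mat ?V * A * ?V) = transpose_mat ?V * transpose_mat (transpose_mat ?V * A)"
    by (rule transpose_mult[OF mult_carrier_mat[OF VT A(1)] V])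
  also have "transpose_mat (transpose_mat ?V * A) = transpose_mat A * ?V"
    using transpose_mult[OF VT A(1)] by simp
  also have "transpose_mat ?V * (transpose_mat A * ?V) = transpose_mat ?V * A * ?V"
    unfolding A(2) by (rule assoc_mult_mat[symmetric, OF VT A(1) V])
  finally show ?thesis unfolding even_compression_def .
qed

lemma even_compression_form:
  assumes A: "A \<in> carrier_mat (2 * N + 1) (2 * N + 1)" and u: "u \<in> carrier_vec (N + 1)"
  shows "(even_compression N A *\<^sub>v u) \<bullet> u = (A *\<^sub>v (even_basis N *\<^sub>v u)) \<bullet> (even_basis N *\<^sub>v u)"
  unfolding even_compression_def
  by (rule quadratic_form_orthogonal_change[symmetric, OF A even_basis_carrier u])

text \<open>
  The columns of \<open>even_basis\<close> are orthonormal, hence strict inequalities between quadratic forms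
  and the bound by \<open>B_tail\<close> times the squared norm pass from a matrix to its compression.
\<close>

lemma even_basis_isometry:
  assumes u: "u \<in> carrier_vec (N + 1)"
  shows "even_basis N *\<^sub>v u \<in> carrier_vec (2 * N + 1)"
    "(even_basis N *\<^sub>v u) \<bullet> (even_basis N *\<^sub>v u) = u \<bullet> u"
    "u \<noteq> 0\<^sub>v (N + 1) \<Longrightarrow> even_basis N *\<^sub>v u \<noteq> 0\<^sub>v (2 * N + 1)"
proof -
  let ?V = "even_basis N"
  show Vu: "?V *\<^sub>v u \<in> carrier_vec (2 * N + 1)"
    using even_basis_carrier u by (rule mult_mat_vec_carrier)
  have VTV: "transpose_mat ?V * 1\<^sub>m (2 * N + 1) * ?V = 1\<^sub>m (N + 1)"
    using right_mult_one_mat[of "transpose_mat ?V" "N + 1" "2 * N + 1"] even_basis_carrier[of N]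
      even_basis_orthonormal[of N] by simp
  show iso: "(?V *\<^sub>v u) \<bullet> (?V *\<^sub>v u) = u \<bullet> u"
    using quadratic_form_orthogonal_change[OF one_carrier_mat even_basis_carrier u]
    unfolding VTV one_mult_mat_vec[OF Vu] one_mult_mat_vec[OF u] .
  show "?V *\<^sub>v u \<noteq> 0\<^sub>v (2 * N + 1)" if "u \<noteq> 0\<^sub>v (N + 1)"
  proof
    assume "?V *\<^sub>v u = 0\<^sub>v (2 * N + 1)"
    then have "u \<bullet> u = 0" using iso by simp
    then show False using conjugate_square_eq_0_vec[OF u] that by simp
  qed
qed

theorem corollary3p3:
  fixes c :: real and N :: nat
  assumes "c > 1"
  shows
    "(\<forall>T > max (rho c * real N) 7.
       (let D = map_mat complex_of_real (Q_inf c N - Q_tot c N T);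
            n = 2 * N + 1
        in 0\<^sub>m n n \<prec>\<^sub>L D \<and> 0\<^sub>m n n \<preceq>\<^sub>L D \<and> D \<preceq>\<^sub>L complex_of_real (B_tail c N T) \<cdot>\<^sub>m 1\<^sub>m n) \<and>
       (\<forall>j \<in> {1..2 * N + 1}.
          eigval j (Q_tot c N T) < eigval j (Q_inf c N) \<and>
          eigval j (Q_inf c N) \<le> eigval j (Q_tot c N T) + B_tail c N T \<and>
          (eigval j (Q_tot c N T) \<ge> 0 \<longrightarrow> eigval j (Q_inf c N) > 0) \<and>
          (eigval j (Q_tot c N T) < - B_tail c N T \<longrightarrow> eigval j (Q_inf c N) < 0)) \<and>
       (N \<ge> 1 \<longrightarrow>
          B_tail c N T \<le> 2 * (2 * real N + 1) * rho c / pi\<^sup>2 *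
            (ln T / (T - rho c * real N) +
             1 / (rho c * real N) * ln (T / (T - rho c * real N)))) \<and>
       (let D = even_compression N (Q_inf c N) - even_compression N (Q_tot c N T);
            n = N + 1
        in 0\<^sub>m n n \<prec>\<^sub>L D \<and> 0\<^sub>m n n \<preceq>\<^sub>L D \<and> D \<preceq>\<^sub>L B_tail c N T \<cdot>\<^sub>m 1\<^sub>m n) \<and>
       (\<forall>j \<in> {1..N + 1}.
          eigval j (even_compression N (Q_tot c N T))
            < eigval j (even_compression N (Q_inf c N)) \<and>
          eigval j (even_compression N (Q_inf c N))
            \<le> eigval j (even_compression N (Q_tot c N T)) + B_tail c N T \<and>
          (eigval j (even_compression N (Q_tot c N T)) \<ge> 0
             \<longrightarrow> eigval j (even_compression N (Q_inf c N)) > 0) \<and>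
          (eigval j (even_compression N (Q_tot c N T)) < - B_tail c N T
             \<longrightarrow> eigval j (even_compression N (Q_inf c N)) < 0))) \<and>
     (\<forall>j \<in> {1..2 * N + 1}.
        strict_mono_on {max (rho c * real N) 7 <..} (\<lambda>T. eigval j (Q_tot c N T)) \<and>
        ((\<lambda>T. eigval j (Q_tot c N T)) \<longlongrightarrow> eigval j (Q_inf c N)) at_top) \<and>
     (\<forall>j \<in> {1..N + 1}.
        strict_mono_on {max (rho c * real N) 7 <..}
          (\<lambda>T. eigval j (even_compression N (Q_tot c N T))) \<and>
        ((\<lambda>T. eigval j (even_compression N (Q_tot c N T)))
           \<longlongrightarrow> eigval j (even_compression N (Q_inf c N))) at_top) \<and>
     (B_tail c N \<sim>[at_top]
        (\<lambda>T. (2 * real N + 1) * rho c / (pi\<^sup>2 * T) * (ln (T / (2 * pi)) + 1))) \<and>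
     ((\<lambda>T. B_tail c N (2 * T) / B_tail c N T) \<longlongrightarrow> 1 / 2) at_top"
proof -
  let ?n = "2 * N + 1" and ?t = "max (rho c * real N) 7"
  let ?Q = "\<lambda>T. Q_tot c N T" and ?Qi = "Q_inf c N"
  let ?E = "\<lambda>T. even_compression N (Q_tot c N T)" and ?Ei = "even_compression N (Q_inf c N)"
  note Qc = Q_carrier(1)[of c N] and Qic = Q_carrier(2)[of c N]
  note Qs = Q_tot_symmetric[of c N] and Qis = Q_inf_symmetric[of c N]
  note Ec = even_compression_carrier[OF Qc] and Eic = even_compression_carrier[OF Qic]
  note Es = even_compression_symmetric[OF Qc Qs] and Eis = even_compression_symmetric[OF Qic Qis]
  note V = even_basis_isometry[of _ N]
  have less: "(?Q T *\<^sub>v x) \<bullet> x < (?Qi *\<^sub>v x) \<bullet> x"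
    if "T > ?t" "x \<in> carrier_vec ?n" "x \<noteq> 0\<^sub>v ?n" for T x
    using that by (intro Q_tot_form_less_Q_inf assms) auto
  have le: "(?Qi *\<^sub>v x) \<bullet> x \<le> (?Q T *\<^sub>v x) \<bullet> x + B_tail c N T * (x \<bullet> x)"
    if "T > ?t" "x \<in> carrier_vec ?n" for T x
    using that by (intro Q_inf_form_le assms) auto
  have mono: "(?Q T *\<^sub>v x) \<bullet> x < (?Q T' *\<^sub>v x) \<bullet> x"
    if "T > ?t" "T < T'" "x \<in> carrier_vec ?n" "x \<noteq> 0\<^sub>v ?n" for T T' x
    using that by (intro Q_tot_form_strict_mono assms) auto
  have Eless: "(?E T *\<^sub>v u) \<bullet> u < (?Ei *\<^sub>v u) \<bullet> u"
    if "T > ?t" "u \<in> carrier_vec (N + 1)" "u \<noteq> 0\<^sub>v (N + 1)" for T u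
    unfolding even_compression_form[OF Qc that(2)] even_compression_form[OF Qic that(2)]
    by (rule less[OF that(1) V(1)[OF that(2)] V(3)[OF that(2,3)]])
  have Ele: "(?Ei *\<^sub>v u) \<bullet> u \<le> (?E T *\<^sub>v u) \<bullet> u + B_tail c N T * (u \<bullet> u)"
    if "T > ?t" "u \<in> carrier_vec (N + 1)" for T u
    unfolding even_compression_form[OF Qc that(2)] even_compression_form[OF Qic that(2)]
      V(2)[OF that(2), symmetric]
    by (rule le[OF that(1) V(1)[OF that(2)]])
  have Emono: "(?E T *\<^sub>v u) \<bullet> u < (?E T' *\<^sub>v u) \<bullet> u"
    if "T > ?t" "T < T'" "u \<in> carrier_vec (N + 1)" "u \<noteq> 0\<^sub>v (N + 1)" for T T' u
    unfolding even_compression_form[OF Qc that(3)]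
    by (rule mono[OF that(1,2) V(1)[OF that(3)] V(3)[OF that(3,4)]])
  have diff_sym: "transpose_mat (B - A) = B - A"
    if "A \<in> carrier_mat n n" "transpose_mat A = A" "B \<in> carrier_mat n n" "transpose_mat B = B"
    for A B :: "real mat" and n
    by (rule eq_matI) (use that symmetric_index[OF that(1,2)] symmetric_index[OF that(3,4)] in auto)
  have zero_form: "(0\<^sub>m n n *\<^sub>v x) \<bullet> x = 0" if "x \<in> carrier_vec n" for x :: "real vec" and n
    using quadratic_form_scalar[OF that, of 0] that by (simp add: scalar_prod_def)
  have zero_vec_form: "(A *\<^sub>v 0\<^sub>v n) \<bullet> 0\<^sub>v n = 0" if "A \<in> carrier_mat n n" for A :: "real mat" and n
    by (rule scalar_prod_right_zero[OF mult_mat_vec_carrier[OF that zero_carrier_vec]])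
  have zero_c: "(0\<^sub>m n n :: real mat) \<in> carrier_mat n n" "transpose_mat (0\<^sub>m n n :: real mat) = 0\<^sub>m n n"
    and one_c: "b \<cdot>\<^sub>m 1\<^sub>m n \<in> carrier_mat n n" "transpose_mat (b \<cdot>\<^sub>m 1\<^sub>m n) = b \<cdot>\<^sub>m 1\<^sub>m n"
    for b :: real and n
    by (auto intro!: eq_matI)
  have cmaps: "map_mat complex_of_real (0\<^sub>m n n) = 0\<^sub>m n n"
    "map_mat complex_of_real (b \<cdot>\<^sub>m 1\<^sub>m n) = complex_of_real b \<cdot>\<^sub>m 1\<^sub>m n" for b n
    by (auto intro!: eq_matI)
  have full: "0\<^sub>m ?n ?n \<prec>\<^sub>L map_mat complex_of_real (?Qi - ?Q T) \<and>
      0\<^sub>m ?n ?n \<preceq>\<^sub>L map_mat complex_of_real (?Qi - ?Q T) \<and>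
      map_mat complex_of_real (?Qi - ?Q T) \<preceq>\<^sub>L complex_of_real (B_tail c N T) \<cdot>\<^sub>m 1\<^sub>m ?n"
    if T: "T > ?t" for T
  proof -
    note Dc = minus_carrier_mat[OF Qc, of ?Qi T] and Ds = diff_sym[OF Qc Qs Qic Qis, of T]
    have form: "((?Qi - ?Q T) *\<^sub>v x) \<bullet> x = (?Qi *\<^sub>v x) \<bullet> x - (?Q T *\<^sub>v x) \<bullet> x" if "x \<in> carrier_vec ?n" for x
      by (rule quadratic_form_minus[OF Qc Qic that])
    have pos: "(0\<^sub>m ?n ?n *\<^sub>v x) \<bullet> x < ((?Qi - ?Q T) *\<^sub>v x) \<bullet> x" if "x \<in> carrier_vec ?n" "x \<noteq> 0\<^sub>v ?n" for x
      unfolding zero_form[OF that(1)] form[OF that(1)] using less[OF T that] by simp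
    have nonneg: "(0\<^sub>m ?n ?n *\<^sub>v x) \<bullet> x \<le> ((?Qi - ?Q T) *\<^sub>v x) \<bullet> x" if "x \<in> carrier_vec ?n" for x
    proof (cases "x = 0\<^sub>v ?n")
      case True
      then show ?thesis unfolding zero_form[OF that] form[OF that] unfolding True zero_vec_form[OF Qc] zero_vec_form[OF Qic] by simp
    qed (use pos[OF that] in simp)
    have upper: "((?Qi - ?Q T) *\<^sub>v x) \<bullet> x \<le> ((B_tail c N T \<cdot>\<^sub>m 1\<^sub>m ?n) *\<^sub>v x) \<bullet> x" if "x \<in> carrier_vec ?n" for x
      unfolding form[OF that] quadratic_form_scalar[OF that] using le[OF T that] by simp
    show ?thesis
      unfolding cmaps[symmetric]
      using loewner_complexI(2)[OF zero_c Dc Ds pos] loewner_complexI(1)[OF zero_c Dc Ds nonneg]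
        loewner_complexI(1)[OF Dc Ds one_c upper] by blast
  qed
  have even: "0\<^sub>m (N + 1) (N + 1) \<prec>\<^sub>L ?Ei - ?E T \<and> 0\<^sub>m (N + 1) (N + 1) \<preceq>\<^sub>L ?Ei - ?E T \<and>
      ?Ei - ?E T \<preceq>\<^sub>L B_tail c N T \<cdot>\<^sub>m 1\<^sub>m (N + 1)"
    if T: "T > ?t" for T
  proof -
    note Dc = minus_carrier_mat[OF Ec, of ?Ei T] and Ds = diff_sym[OF Ec Es Eic Eis, of T]
    have form: "((?Ei - ?E T) *\<^sub>v x) \<bullet> x = (?Ei *\<^sub>v x) \<bullet> x - (?E T *\<^sub>v x) \<bullet> x" if "x \<in> carrier_vec (N + 1)" for x
      by (rule quadratic_form_minus[OF Ec Eic that])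
    have pos: "(0\<^sub>m (N + 1) (N + 1) *\<^sub>v x) \<bullet> x < ((?Ei - ?E T) *\<^sub>v x) \<bullet> x"
      if "x \<in> carrier_vec (N + 1)" "x \<noteq> 0\<^sub>v (N + 1)" for x
      unfolding zero_form[OF that(1)] form[OF that(1)] using Eless[OF T that] by simp
    have nonneg: "(0\<^sub>m (N + 1) (N + 1) *\<^sub>v x) \<bullet> x \<le> ((?Ei - ?E T) *\<^sub>v x) \<bullet> x" if "x \<in> carrier_vec (N + 1)" for x
    proof (cases "x = 0\<^sub>v (N + 1)")
      case True
      then show ?thesis unfolding zero_form[OF that] form[OF that] unfolding True zero_vec_form[OF Ec] zero_vec_form[OF Eic] by simp
    qed (use pos[OF that] in simp)
    have upper: "((?Ei - ?E T) *\<^sub>v x) \<bullet> x \<le> ((B_tail c N T \<cdot>\<^sub>m 1\<^sub>m (N + 1)) *\<^sub>v x) \<bullet> x"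
      if "x \<in> carrier_vec (N + 1)" for x
      unfolding form[OF that] quadratic_form_scalar[OF that] using Ele[OF T that] by simp
    show ?thesis
      using loewner_realI(2)[OF zero_c Dc Ds pos] loewner_realI(1)[OF zero_c Dc Ds nonneg]
        loewner_realI(1)[OF Dc Ds one_c upper] by blast
  qed
  have eig: "\<forall>j \<in> {1..?n}. eigval j (?Q T) < eigval j ?Qi \<and> eigval j ?Qi \<le> eigval j (?Q T) + B_tail c N T \<and>
      (eigval j (?Q T) \<ge> 0 \<longrightarrow> eigval j ?Qi > 0) \<and> (eigval j (?Q T) < - B_tail c N T \<longrightarrow> eigval j ?Qi < 0)"
    if "T > ?t" for T
    by (rule eigval_sandwich[OF Qc Qs Qic Qis less[OF that] le[OF that]])
  have Eeig: "\<forall>j \<in> {1..N + 1}. eigval j (?E T) < eigval j ?Ei \<and> eigval j ?Ei \<le> eigval j (?E T) + B_tail c N T \<and>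
      (eigval j (?E T) \<ge> 0 \<longrightarrow> eigval j ?Ei > 0) \<and> (eigval j (?E T) < - B_tail c N T \<longrightarrow> eigval j ?Ei < 0)"
    if "T > ?t" for T
    by (rule eigval_sandwich[OF Ec Es Eic Eis Eless[OF that] Ele[OF that]])
  have upper: "N \<ge> 1 \<longrightarrow> B_tail c N T \<le> 2 * (2 * real N + 1) * rho c / pi\<^sup>2 *
      (ln T / (T - rho c * real N) + 1 / (rho c * real N) * ln (T / (T - rho c * real N)))"
    if "T > ?t" for T
    using that by (intro impI B_tail_upper_bound assms) auto
  note conv = eigval_monotone_convergence[where A = ?Q and t = ?t and b = "B_tail c N",
      OF Qc Qs Qic Qis mono eig B_tail_tendsto_0[OF assms]]
  note Econv = eigval_monotone_convergence[where A = ?E and t = ?t and b = "B_tail c N",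
      OF Ec Es Eic Eis Emono Eeig B_tail_tendsto_0[OF assms]]
  show ?thesis
    unfolding Let_def
    using full eig upper even Eeig conv Econv B_tail_asymp_equiv[OF assms] B_tail_doubling[OF assms]
    by (intro conjI allI impI) simp_all
qed

end
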